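(* Let $V_+:\mathbb{R}^d\to[0,\infty]$ and $V_-:\mathbb{R}^d\to[0,\infty)$ be measurable and assume that $V_-$ is form small with respect to $-\Delta$ on $L^2(\mathbb{R}^d)$. If the set $\{V_+\le n\}=\{x\in\mathbb{R}^d\mid V_+(x)\le n\}$ is thin at infinity for every $n\in\mathbb{N}$, then $\sigma_{ess}(-\Delta+V_+-V_-)=\emptyset$.
   Context: For $k\in\mathbb{R}^d$ let $C(k)$ be the unit cube in $\mathbb{R}^d$ centered at $k$. A measurable set $E\subset\mathbb{R}^d$ is called thin at infinity if $\lim_{|k|\to\infty}|E\cap C(k)|=0$, where $|\cdot|$ of a set is Lebesgue measure. $V_-$ is form small with respect to $-\Delta$ if there are $q<1$ and $C_q\in\mathbb{R}$ such that $\int V_-|u|^2\,dx\le q\int|\nabla u|^2\,dx+C_q\|u\|^2$ for all $u\in W^{1,2}(\mathbb{R}^d)$. The operator $-\Delta+V_+-V_-$ is defined as a form sum: the form of $-\Delta+V_+$ is $\int|\nabla u|^2\,dx+\int V_+|u|^2\,dx$ on $\{u\in W^{1,2}(\mathbb{R}^d):\int V_+|u|^2\,dx<\infty\}$, which is closed but need not be densely defined; $V_-$ is subtracted using the KLMN theorem (same form domain), and $-\Delta+V_+-V_-$ is the associated selfadjoint operator on the closure of the form domain in $L^2(\mathbb{R}^d)$. *)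

theory Defs
  imports "HOL-Analysis.Analysis"
begin

section \<open>The complex Hilbert space $L^2$\<close>

definition square_integrable :: "('a::euclidean_space \<Rightarrow> complex) \<Rightarrow> bool" where
  "square_integrable f \<longleftrightarrow>
     f \<in> borel_measurable lebesgue \<and> integrable lebesgue (\<lambda>x. (cmod (f x))\<^sup>2)"

definition L2_rel :: "('a::euclidean_space \<Rightarrow> complex) \<Rightarrow> ('a \<Rightarrow> complex) \<Rightarrow> bool" where
  "L2_rel f g \<longleftrightarrow>
     square_integrable f \<and> square_integrable g \<and> (AE x in lebesgue. f x = g x)"

quotient_type (overloaded) 'a L2 = "'a::euclidean_space \<Rightarrow> complex" / partial: L2_rel
proof (rule part_equivpI)
  show "\<exists>f. L2_rel f f"
    by (rule exI[of _ "\<lambda>_. 0"]) (simp add: L2_rel_def square_integrable_def)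
  show "symp L2_rel"
    by (rule sympI) (simp add: L2_rel_def eq_commute)
  show "transp L2_rel"
    unfolding transp_def L2_rel_def
    by (force elim: eventually_elim2)
qed

lemma square_integrableD:
  assumes "square_integrable f"
  shows "f \<in> borel_measurable lebesgue" "integrable lebesgue (\<lambda>x. (cmod (f x))\<^sup>2)"
  using assms by (auto simp: square_integrable_def)

lemma square_integrable_rep_L2: "square_integrable (rep_L2 u)"
  using Quotient3_rep_reflp[OF Quotient3_L2, of u] by (simp add: L2_rel_def)

lemma L2_eq_iff: "u = v \<longleftrightarrow> (AE x in lebesgue. rep_L2 u x = rep_L2 v x)"
  using Quotient3_rel_rep[OF Quotient3_L2, of u v]
  by (simp add: L2_rel_def square_integrable_rep_L2)

lemma rep_abs_L2:
  assumes "square_integrable f"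
  shows "AE x in lebesgue. rep_L2 (abs_L2 f) x = f x"
  using rep_abs_rsp_left[OF Quotient3_L2, of f f] assms by (simp add: L2_rel_def)

lemma integrable_square_integrable_mult:
  assumes "square_integrable f" "square_integrable g"
  shows "integrable lebesgue (\<lambda>x. f x * g x)"
proof (rule Bochner_Integration.integrable_bound)
  show "integrable lebesgue (\<lambda>x. (cmod (f x))\<^sup>2 + (cmod (g x))\<^sup>2)"
    using assms by (simp add: square_integrable_def)
  show "(\<lambda>x. f x * g x) \<in> borel_measurable lebesgue"
    by (intro borel_measurable_times square_integrableD assms)
  have "a * b \<le> a\<^sup>2 + b\<^sup>2" if "0 \<le> a" "0 \<le> b" for a b :: real
    using sum_squares_bound[of a b] mult_nonneg_nonneg[OF that] by linarith
  then show "AE x in lebesgue. norm (f x * g x) \<le> norm ((cmod (f x))\<^sup>2 + (cmod (g x))\<^sup>2)"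
    by (auto simp: norm_mult)
qed

lemma square_integrable_cnj: "square_integrable f \<Longrightarrow> square_integrable (\<lambda>x. cnj (f x))"
  unfolding square_integrable_def
  using borel_measurable_continuous_on[of cnj f lebesgue]
  by (auto intro: continuous_intros)

lemma square_integrable_add:
  assumes f: "square_integrable f" and g: "square_integrable g"
  shows "square_integrable (\<lambda>x. f x + g x)"
  unfolding square_integrable_def
proof
  show m: "(\<lambda>x. f x + g x) \<in> borel_measurable lebesgue"
    by (intro borel_measurable_add square_integrableD assms)
  show "integrable lebesgue (\<lambda>x. (cmod (f x + g x))\<^sup>2)"
  proof (rule Bochner_Integration.integrable_bound)
    show "integrable lebesgue (\<lambda>x. 2 * (cmod (f x))\<^sup>2 + 2 * (cmod (g x))\<^sup>2)"
      using assms by (simp add: square_integrable_def)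
    show "(\<lambda>x. (cmod (f x + g x))\<^sup>2) \<in> borel_measurable lebesgue"
      using borel_measurable_power[OF measurable_compose[OF m borel_measurable_norm], of 2] .
    have "(cmod (a + b))\<^sup>2 \<le> 2 * (cmod a)\<^sup>2 + 2 * (cmod b)\<^sup>2" for a b
    proof -
      have "(cmod (a + b))\<^sup>2 \<le> (cmod a + cmod b)\<^sup>2"
        by (intro power_mono norm_triangle_ineq) auto
      also have "\<dots> \<le> 2 * (cmod a)\<^sup>2 + 2 * (cmod b)\<^sup>2"
        using sum_squares_bound[of "cmod a" "cmod b"] by (simp add: power2_sum)
      finally show ?thesis .
    qed
    then show "AE x in lebesgue. norm ((cmod (f x + g x))\<^sup>2)
        \<le> norm (2 * (cmod (f x))\<^sup>2 + 2 * (cmod (g x))\<^sup>2)"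
      by auto
  qed
qed

lemma square_integrable_cmult:
  assumes "square_integrable f"
  shows "square_integrable (\<lambda>x. c * f x)"
  unfolding square_integrable_def
proof
  show "(\<lambda>x. c * f x) \<in> borel_measurable lebesgue"
    by (intro borel_measurable_times borel_measurable_const square_integrableD assms)
  show "integrable lebesgue (\<lambda>x. (cmod (c * f x))\<^sup>2)"
    using square_integrableD(2)[OF assms] by (simp add: norm_mult power_mult_distrib)
qed

lemma square_integrable_uminus: "square_integrable f \<Longrightarrow> square_integrable (\<lambda>x. - f x)"
  using square_integrable_cmult[of f "-1"] by simp

instantiation L2 :: (euclidean_space) ab_group_add
begin

lift_definition zero_L2 :: "'a L2" is "\<lambda>_. 0"
  by (simp add: L2_rel_def square_integrable_def)

lift_definition plus_L2 :: "'a L2 \<Rightarrow> 'a L2 \<Rightarrow> 'a L2" is "\<lambda>f g x. f x + g x"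
  unfolding L2_rel_def by (auto intro: square_integrable_add elim: eventually_elim2)

lift_definition uminus_L2 :: "'a L2 \<Rightarrow> 'a L2" is "\<lambda>f x. - f x"
  unfolding L2_rel_def by (auto intro: square_integrable_uminus elim: eventually_mono)

definition minus_L2 :: "'a L2 \<Rightarrow> 'a L2 \<Rightarrow> 'a L2" where
  "minus_L2 u v = u + - v"

instance
proof
  fix a b c :: "'a L2"
  show "a + b + c = a + (b + c)"
    by transfer (auto simp: L2_rel_def add.assoc intro!: square_integrable_add)
  show "a + b = b + a"
    by transfer (auto simp: L2_rel_def add.commute intro!: square_integrable_add)
  show "0 + a = a"
    by transfer (auto simp: L2_rel_def)
  show "- a + a = 0"
    by transfer (auto simp: L2_rel_def square_integrable_def)
  show "a - b = a + - b"
    by (rule minus_L2_def)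
qed

end

lift_definition scaleC :: "complex \<Rightarrow> 'a::euclidean_space L2 \<Rightarrow> 'a L2"  (infixr "*\<^sub>C" 75)
  is "\<lambda>c f x. c * f x"
  unfolding L2_rel_def by (auto intro: square_integrable_cmult elim: eventually_mono)

text \<open>Linear in the first argument.\<close>

definition cinner :: "'a::euclidean_space L2 \<Rightarrow> 'a L2 \<Rightarrow> complex" where
  "cinner u v = integral\<^sup>L lebesgue (\<lambda>x. rep_L2 u x * cnj (rep_L2 v x))"

lemma rep_zero_L2: "AE x in lebesgue. rep_L2 (0::'a::euclidean_space L2) x = 0"
  using rep_abs_L2[of "\<lambda>_. 0"] by (simp add: zero_L2_def square_integrable_def)

lemma rep_plus_L2: "AE x in lebesgue. rep_L2 (u + v) x = rep_L2 u x + rep_L2 v x"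
  using rep_abs_L2[OF square_integrable_add[OF square_integrable_rep_L2[of u] square_integrable_rep_L2[of v]]]
  by (simp add: plus_L2_def)

lemma rep_scaleC: "AE x in lebesgue. rep_L2 (c *\<^sub>C u) x = c * rep_L2 u x"
  using rep_abs_L2[OF square_integrable_cmult[OF square_integrable_rep_L2[of u], of c]]
  by (simp add: scaleC_def)

lemma rep_L2_measurable [measurable]: "rep_L2 u \<in> borel_measurable lebesgue"
  using square_integrable_rep_L2[of u] unfolding square_integrable_def by (rule conjunct1)

lemma integrable_cinner: "integrable lebesgue (\<lambda>x. rep_L2 u x * cnj (rep_L2 v x))"
  by (intro integrable_square_integrable_mult square_integrable_cnj square_integrable_rep_L2)

lemma cnj_rep_L2_measurable [measurable]:
  "(\<lambda>x. cnj (rep_L2 u x)) \<in> borel_measurable lebesgue"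
  using square_integrable_cnj[OF square_integrable_rep_L2[of u]]
  unfolding square_integrable_def by (rule conjunct1)

lemma cinner_commute: "cinner u v = cnj (cinner v u)"
  unfolding cinner_def
  by (subst Bochner_Integration.integral_cnj[symmetric]) (simp add: mult.commute)

lemma cinner_add_left: "cinner (u + v) w = cinner u w + cinner v w"
proof -
  have "cinner (u + v) w
      = integral\<^sup>L lebesgue (\<lambda>x. rep_L2 u x * cnj (rep_L2 w x) + rep_L2 v x * cnj (rep_L2 w x))"
    unfolding cinner_def
    by (intro integral_cong_AE)
      (auto intro: eventually_mono[OF rep_plus_L2[of u v]] simp: distrib_right)
  also have "\<dots> = cinner u w + cinner v w"
    unfolding cinner_def by (intro Bochner_Integration.integral_add integrable_cinner)
  finally show ?thesis .
qed

lemma cinner_scaleC_left: "cinner (c *\<^sub>C u) w = c * cinner u w"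
proof -
  have "cinner (c *\<^sub>C u) w = integral\<^sup>L lebesgue (\<lambda>x. c * (rep_L2 u x * cnj (rep_L2 w x)))"
    unfolding cinner_def
    by (intro integral_cong_AE) (auto intro: eventually_mono[OF rep_scaleC[of c u]])
  then show ?thesis
    by (simp add: cinner_def)
qed

lemma cinner_self:
  "cinner u u = complex_of_real (integral\<^sup>L lebesgue (\<lambda>x. (cmod (rep_L2 u x))\<^sup>2))"
  unfolding cinner_def integral_complex_of_real[symmetric] by (simp only: complex_norm_square)

lemma cinner_self_eq_0_iff: "cinner u u = 0 \<longleftrightarrow> u = 0"
proof -
  have "cinner u u = 0 \<longleftrightarrow> (AE x in lebesgue. rep_L2 u x = 0)"
    using square_integrable_rep_L2[of u]
    by (simp add: cinner_self integral_nonneg_eq_0_iff_AE square_integrable_def)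
  also have "\<dots> \<longleftrightarrow> u = 0"
  proof
    assume "AE x in lebesgue. rep_L2 u x = 0"
    then show "u = 0"
      unfolding L2_eq_iff using rep_zero_L2 by eventually_elim simp
  next
    assume "u = 0"
    then show "AE x in lebesgue. rep_L2 u x = 0"
      by (simp add: rep_zero_L2)
  qed
  finally show ?thesis .
qed

interpretation L2: vector_space "scaleC :: complex \<Rightarrow> 'a::euclidean_space L2 \<Rightarrow> 'a L2"
proof
  fix a b :: complex and u v :: "'a L2"
  show "a *\<^sub>C (u + v) = a *\<^sub>C u + a *\<^sub>C v"
    by transfer (auto simp: L2_rel_def distrib_left intro!: square_integrable_add square_integrable_cmult)
  show "(a + b) *\<^sub>C u = a *\<^sub>C u + b *\<^sub>C u"
    by transfer (auto simp: L2_rel_def ring_distribs square_integrable_cmult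
        intro!: square_integrable_add)
  show "a *\<^sub>C b *\<^sub>C u = (a * b) *\<^sub>C u"
    by transfer (auto simp: L2_rel_def mult.assoc intro!: square_integrable_cmult)
  show "1 *\<^sub>C u = u"
    by transfer (auto simp: L2_rel_def)
qed

text \<open>The real Hilbert space structure underlying the complex one; it provides
  the norm and the topology.\<close>

instantiation L2 :: (euclidean_space) real_inner
begin

definition scaleR_L2 :: "real \<Rightarrow> 'a L2 \<Rightarrow> 'a L2" where
  "scaleR_L2 r u = complex_of_real r *\<^sub>C u"

definition inner_L2 :: "'a L2 \<Rightarrow> 'a L2 \<Rightarrow> real" where
  "inner_L2 u v = Re (cinner u v)"

definition norm_L2 :: "'a L2 \<Rightarrow> real" where
  "norm_L2 u = sqrt (u \<bullet> u)"

definition dist_L2 :: "'a L2 \<Rightarrow> 'a L2 \<Rightarrow> real" where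
  "dist_L2 u v = norm (u - v)"

definition sgn_L2 :: "'a L2 \<Rightarrow> 'a L2" where
  "sgn_L2 u = inverse (norm u) *\<^sub>R u"

definition uniformity_L2 :: "('a L2 \<times> 'a L2) filter" where
  "uniformity_L2 = (INF e\<in>{0<..}. principal {(u, v). dist u v < e})"

definition open_L2 :: "'a L2 set \<Rightarrow> bool" where
  "open_L2 U \<longleftrightarrow> (\<forall>u\<in>U. eventually (\<lambda>(u', v). u' = u \<longrightarrow> v \<in> U) uniformity)"

instance
proof
  fix a b :: real and u v w :: "'a L2" and U :: "'a L2 set"
  show "a *\<^sub>R (u + v) = a *\<^sub>R u + a *\<^sub>R v" "(a + b) *\<^sub>R u = a *\<^sub>R u + b *\<^sub>R u"
    "a *\<^sub>R b *\<^sub>R u = (a * b) *\<^sub>R u" "1 *\<^sub>R u = u"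
    by (simp_all add: scaleR_L2_def L2.scale_right_distrib L2.scale_left_distrib)
  show "u \<bullet> v = v \<bullet> u"
    unfolding inner_L2_def by (subst cinner_commute) simp
  show "(u + v) \<bullet> w = u \<bullet> w + v \<bullet> w" "(a *\<^sub>R u) \<bullet> v = a * (u \<bullet> v)"
    by (simp_all add: inner_L2_def scaleR_L2_def cinner_add_left cinner_scaleC_left)
  show "0 \<le> u \<bullet> u"
    by (simp add: inner_L2_def cinner_self)
  show "u \<bullet> u = 0 \<longleftrightarrow> u = 0"
    unfolding inner_L2_def cinner_self_eq_0_iff[symmetric] by (simp add: cinner_self)
qed (rule norm_L2_def dist_L2_def sgn_L2_def uniformity_L2_def open_L2_def)+

end


section \<open>The Sobolev space $W^{1,2}$\<close>

primrec Ck :: "nat \<Rightarrow> ('a::euclidean_space \<Rightarrow> complex) \<Rightarrow> bool" where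
  "Ck 0 f \<longleftrightarrow> continuous_on UNIV f"
| "Ck (Suc k) f \<longleftrightarrow> f differentiable_on UNIV \<and>
     (\<forall>i\<in>Basis. Ck k (\<lambda>x. frechet_derivative f (at x) i))"

definition test_function :: "('a::euclidean_space \<Rightarrow> complex) \<Rightarrow> bool" where
  "test_function \<phi> \<longleftrightarrow> (\<forall>k. Ck k \<phi>) \<and> compact (closure {x. \<phi> x \<noteq> 0})"

definition has_weak_deriv :: "'a::euclidean_space L2 \<Rightarrow> 'a \<Rightarrow> 'a L2 \<Rightarrow> bool" where
  "has_weak_deriv u i g \<longleftrightarrow> (\<forall>\<phi>. test_function \<phi> \<longrightarrow>
     integral\<^sup>L lebesgue (\<lambda>x. rep_L2 u x * frechet_derivative \<phi> (at x) i)
       = - integral\<^sup>L lebesgue (\<lambda>x. rep_L2 g x * \<phi> x))"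

definition W12 :: "'a::euclidean_space L2 set" where
  "W12 = {u. \<forall>i\<in>Basis. \<exists>g. has_weak_deriv u i g}"

definition weak_deriv :: "'a::euclidean_space L2 \<Rightarrow> 'a \<Rightarrow> 'a L2" where
  "weak_deriv u i = (THE g. has_weak_deriv u i g)"

text \<open>The Dirichlet form $\int \nabla u \cdot \overline{\nabla v}\,dx$.\<close>

definition dirichlet_form :: "'a::euclidean_space L2 \<Rightarrow> 'a L2 \<Rightarrow> complex" where
  "dirichlet_form u v = (\<Sum>i\<in>Basis. cinner (weak_deriv u i) (weak_deriv v i))"


section \<open>Schroedinger operators as form sums\<close>

text \<open>Bochner integrability is part of the requirement, because the integral of a
  non-integrable function is 0 by convention.\<close>

definition form_small :: "('a::euclidean_space \<Rightarrow> real) \<Rightarrow> bool" where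
  "form_small V \<longleftrightarrow> (\<exists>q<1. \<exists>C::real. \<forall>u\<in>W12.
     integrable lebesgue (\<lambda>x. V x * (cmod (rep_L2 u x))\<^sup>2) \<and>
     integral\<^sup>L lebesgue (\<lambda>x. V x * (cmod (rep_L2 u x))\<^sup>2)
       \<le> q * (\<Sum>i\<in>Basis. (norm (weak_deriv u i))\<^sup>2) + C * (norm u)\<^sup>2)"

definition form_domain :: "('a::euclidean_space \<Rightarrow> ennreal) \<Rightarrow> 'a L2 set" where
  "form_domain Vp = {u \<in> W12.
     (\<integral>\<^sup>+x. Vp x * ennreal ((cmod (rep_L2 u x))\<^sup>2) \<partial>lebesgue) < \<infinity>}"

text \<open>Elements of the form domain vanish almost everywhere on $\{V_+ = \infty\}$, so the value
  0 of \<^const>\<open>enn2real\<close> at infinity is immaterial.\<close>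

definition schroedinger_form ::
    "('a::euclidean_space \<Rightarrow> ennreal) \<Rightarrow> ('a \<Rightarrow> real) \<Rightarrow> 'a L2 \<Rightarrow> 'a L2 \<Rightarrow> complex" where
  "schroedinger_form Vp Vm u v =
     dirichlet_form u v
     + integral\<^sup>L lebesgue
         (\<lambda>x. complex_of_real (enn2real (Vp x)) * (rep_L2 u x * cnj (rep_L2 v x)))
     - integral\<^sup>L lebesgue
         (\<lambda>x. complex_of_real (Vm x) * (rep_L2 u x * cnj (rep_L2 v x)))"

text \<open>Unbounded operators are represented by their graphs. The operator associated with a
  form acts in the closure of the form domain, which may be a proper subspace.\<close>

definition form_operator ::
    "'a::euclidean_space L2 set \<Rightarrow> ('a L2 \<Rightarrow> 'a L2 \<Rightarrow> complex) \<Rightarrow> ('a L2 \<times> 'a L2) set" where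
  "form_operator Q a =
     {(u, f). u \<in> Q \<and> f \<in> closure Q \<and> (\<forall>v\<in>Q. a u v = cinner f v)}"

definition schroedinger_operator ::
    "('a::euclidean_space \<Rightarrow> ennreal) \<Rightarrow> ('a \<Rightarrow> real) \<Rightarrow> ('a L2 \<times> 'a L2) set" where
  "schroedinger_operator Vp Vm = form_operator (form_domain Vp) (schroedinger_form Vp Vm)"


section \<open>Essential spectrum\<close>

text \<open>In this section \<open>T\<close> is the graph of an operator in the closed subspace \<open>K\<close>.
  The point \<open>z\<close> is in the resolvent set iff \<open>T - z\<close> maps its domain bijectively onto \<open>K\<close> with
  bounded inverse.\<close>

definition resolvent_set :: "'a::euclidean_space L2 set \<Rightarrow> ('a L2 \<times> 'a L2) set \<Rightarrow> complex set" where
  "resolvent_set K T = {z.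
     (\<forall>f\<in>K. \<exists>!u. (u, f + z *\<^sub>C u) \<in> T) \<and>
     (\<exists>C. \<forall>(u, g)\<in>T. norm u \<le> C * norm (g - z *\<^sub>C u))}"

definition spectrum :: "'a::euclidean_space L2 set \<Rightarrow> ('a L2 \<times> 'a L2) set \<Rightarrow> complex set" where
  "spectrum K T = - resolvent_set K T"

definition eigenspace :: "('a::euclidean_space L2 \<times> 'a L2) set \<Rightarrow> complex \<Rightarrow> 'a L2 set" where
  "eigenspace T z = {u. (u, z *\<^sub>C u) \<in> T}"

text \<open>For selfadjoint operators: isolated points of the spectrum that are eigenvalues of finite
  (complex) multiplicity.\<close>

definition discrete_spectrum :: "'a::euclidean_space L2 set \<Rightarrow> ('a L2 \<times> 'a L2) set \<Rightarrow> complex set" where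
  "discrete_spectrum K T = {z. z isolated_in spectrum K T \<and> eigenspace T z \<noteq> {0} \<and>
     (\<exists>B. finite B \<and> eigenspace T z \<subseteq> L2.span B)}"

definition essential_spectrum :: "'a::euclidean_space L2 set \<Rightarrow> ('a L2 \<times> 'a L2) set \<Rightarrow> complex set" where
  "essential_spectrum K T = spectrum K T - discrete_spectrum K T"


section \<open>Thinness at infinity\<close>

definition unit_cube :: "'a::euclidean_space \<Rightarrow> 'a set" where
  "unit_cube k = cbox (k - (1/2) *\<^sub>R One) (k + (1/2) *\<^sub>R One)"

definition thin_at_infinity :: "'a::euclidean_space set \<Rightarrow> bool" where
  "thin_at_infinity E \<longleftrightarrow> E \<in> sets lebesgue \<and>
     ((\<lambda>k. measure lebesgue (E \<inter> unit_cube k)) \<longlongrightarrow> 0) at_infinity"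

end

theory Submission
  imports Defs
begin

text \<open>
Write \<open>d\<close> for the dimension, \<open>T\<close> for the operator, \<open>a\<close> for its form, \<open>Q\<close> for the form domain and
\<open>K\<close> for the closure of \<open>Q\<close>. The essential spectrum is empty because, up to finitely many dimensions,
\<open>T\<close> exceeds every level: for every \<open>M\<close> there are finitely many \<open>w \<in> L\<^sup>2\<close> and a constant \<open>\<beta>\<close>
with \<open>M \<parallel>u\<parallel>\<^sup>2 \<le> a(u, u) + \<beta> \<Sum>\<^sub>w |\<langle>u, w\<rangle>|\<^sup>2\<close> on \<open>Q\<close> (\<open>energy_finite_below\<close>).

This estimate comes from a grid of cubes of side \<open>h\<close>. Translates of a function in \<open>W\<^sup>1\<^sup>,\<^sup>2\<close> satisfy
\<open>\<parallel>u(\<cdot> + z) - u\<parallel> \<le> \<parallel>z \<cdot> \<nabla>u\<parallel>\<close> (\<open>norm_shift_L2_diff_le\<close>), so the integral of \<open>|u(x) - u(y)|\<^sup>2\<close> over pairs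
of points in a common cube is at most of order \<open>h\<^sup>d\<^sup>+\<^sup>2 \<parallel>\<nabla>u\<parallel>\<^sup>2\<close>. Hence \<open>u\<close> nearly equals its mean on each cube.
Three regions are treated separately. Where \<open>V\<^sub>+ > n\<close>, the mass of \<open>u\<close> is at most \<open>1/n\<close> times its potential energy.
In the cubes near the origin, finitely many in number, it is controlled by the means, which are the
scalar products of \<open>u\<close> with indicator functions. Far away, \<open>{V\<^sub>+ \<le> n}\<close> fills only a small fraction of
each cube because it is thin at infinity, and a function close to its mean has only a small part of its mass there
(\<open>L2_mass_cells_thin_set_le\<close>). Form smallness of \<open>V\<^sub>-\<close> bounds the gradient and
the potential energy by \<open>a(u, u) + C \<parallel>u\<parallel>\<^sup>2\<close>.

The locale \<open>discrete_operator\<close> passes from the estimate to the spectrum. A sequence of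
approximate eigenvectors at \<open>z\<close> has a subsequence that converges on the finitely many exceptional directions, and the estimate at a level above \<open>Re z\<close>, applied to differences,
makes it Cauchy (\<open>approximate_eigenvectors_converge\<close>). If \<open>z\<close> is not an eigenvalue, \<open>T - z\<close> is therefore bounded
below; its range is closed, and it is all of \<open>K\<close> because \<open>T\<close> is symmetric and \<open>T + c\<close> is onto for some
real \<open>c\<close>. So the spectrum consists of eigenvalues. Unit eigenvectors for eigenvalues accumulating at \<open>z\<close> would have a
subsequence that converges to an eigenvector for \<open>z\<close> orthogonal to all of them, and an eigenvector at \<open>z\<close> is determined by
its finitely many exceptional components. That \<open>T + c\<close> is onto is the Riesz representation in the form norm, for
which the form has to be closed.
\<close>

section \<open>The Hilbert space of square integrable functions\<close>

lemma norm_L2_square: "(norm u)\<^sup>2 = (LINT x|lebesgue. (cmod (rep_L2 u x))\<^sup>2)"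
  by (simp add: power2_norm_eq_inner inner_L2_def cinner_self)

lemma cinner_self_norm: "cinner u u = complex_of_real ((norm u)\<^sup>2)"
  by (simp add: cinner_self norm_L2_square)

lemma nn_integral_L2:
  "(\<integral>\<^sup>+x. ennreal ((cmod (rep_L2 u x))\<^sup>2) \<partial>lebesgue) = ennreal ((norm u)\<^sup>2)"
  unfolding norm_L2_square
  by (rule nn_integral_eq_integral) (use square_integrable_rep_L2[of u] in \<open>auto simp: square_integrable_def\<close>)

lemma uminus_L2_eq_scaleC: "- u = (-1) *\<^sub>C (u :: 'a::euclidean_space L2)"
  using L2.scale_minus_left[of 1 u] by simp

lemma rep_minus_L2: "AE x in lebesgue. rep_L2 (u - v) x = rep_L2 u x - rep_L2 v x"
proof -
  have "u - v = u + (-1) *\<^sub>C v"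
    by (simp add: uminus_L2_eq_scaleC[symmetric])
  then show ?thesis
    using rep_plus_L2[of u "(-1) *\<^sub>C v"] rep_scaleC[of "-1" v] by (auto elim!: eventually_elim2)
qed

lemma cinner_add_right: "cinner w (u + v) = cinner w u + cinner w v"
  by (metis cinner_add_left cinner_commute complex_cnj_add)

lemma cinner_scaleC_right: "cinner w (c *\<^sub>C u) = cnj c * cinner w u"
  by (metis cinner_scaleC_left cinner_commute complex_cnj_mult)

lemma cinner_minus_left: "cinner (u - v) w = cinner u w - cinner v w"
  using cinner_add_left[of "u - v" v w] by simp

lemma cinner_minus_right: "cinner w (u - v) = cinner w u - cinner w v"
  using cinner_add_right[of w "u - v" v] by simp

lemma cinner_zero [simp]: "cinner 0 u = 0" "cinner u 0 = 0"
  using cinner_minus_left[of 0 0 u] cinner_minus_right[of u 0 0] by auto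

lemma of_real_cmod_square: "(complex_of_real (cmod z))\<^sup>2 = z * cnj z"
  using complex_norm_square[of z] by simp

lemma norm_scaleC: "norm (c *\<^sub>C u) = cmod c * norm (u :: 'a::euclidean_space L2)"
proof -
  have "complex_of_real ((norm (c *\<^sub>C u))\<^sup>2) = complex_of_real ((cmod c * norm u)\<^sup>2)"
    unfolding cinner_self_norm[symmetric] cinner_scaleC_left cinner_scaleC_right
    by (simp add: cinner_self_norm power_mult_distrib of_real_cmod_square)
  then have "(norm (c *\<^sub>C u))\<^sup>2 = (cmod c * norm u)\<^sup>2"
    by (simp only: of_real_eq_iff)
  then show ?thesis
    by (simp add: power2_eq_iff_nonneg)
qed

text \<open>The phase of \<open>\<langle>u, v\<rangle>\<close> can be moved into \<open>u\<close>, so that the inequality reduces to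
  the one for the real part.\<close>

lemma norm_cinner_le: "cmod (cinner u v) \<le> norm u * norm v"
proof (cases "cinner u v = 0")
  case False
  define c where "c = cnj (sgn (cinner u v))"
  have c: "cmod c = 1" "c * cinner u v = cmod (cinner u v)"
  proof -
    show "cmod c = 1"
      using False by (simp only: c_def complex_mod_cnj norm_sgn if_False)
    have "c * cinner u v = (complex_of_real (cmod (cinner u v)))\<^sup>2 / complex_of_real (cmod (cinner u v))"
      unfolding of_real_cmod_square c_def sgn_eq by simp
    then show "c * cinner u v = cmod (cinner u v)"
      by (simp add: power2_eq_square)
  qed
  have "cmod (cinner u v) = Re (cinner (c *\<^sub>C u) v)"
    by (simp add: cinner_scaleC_left c)
  also have "\<dots> \<le> norm (c *\<^sub>C u) * norm v"
    using norm_cauchy_schwarz[of "c *\<^sub>C u" v] by (simp add: inner_L2_def)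
  finally show ?thesis
    by (simp add: norm_scaleC c)
qed auto

lemma tendsto_cinner_left: "(f \<longlongrightarrow> u) F \<Longrightarrow> ((\<lambda>n. cinner (f n) v) \<longlongrightarrow> cinner u v) F"
proof -
  assume "(f \<longlongrightarrow> u) F"
  then have "((\<lambda>n. norm (f n - u) * norm v) \<longlongrightarrow> 0) F"
    by (intro tendsto_mult_left_zero tendsto_norm_zero) (simp add: LIM_zero)
  then have "((\<lambda>n. cinner (f n) v - cinner u v) \<longlongrightarrow> 0) F"
    by (rule Lim_null_comparison[rotated])
      (simp add: norm_cinner_le flip: cinner_minus_left)
  then show ?thesis
    by (simp add: LIM_zero_cancel)
qed

lemma tendsto_cinner_right: "(f \<longlongrightarrow> u) F \<Longrightarrow> ((\<lambda>n. cinner v (f n)) \<longlongrightarrow> cinner v u) F"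
  using tendsto_cnj[OF tendsto_cinner_left[of f u F v]] by (simp flip: cinner_commute)

lemma tendsto_scaleC: "(f \<longlongrightarrow> u) F \<Longrightarrow> ((\<lambda>n. c *\<^sub>C f n) \<longlongrightarrow> c *\<^sub>C u) F"
proof -
  assume "(f \<longlongrightarrow> u) F"
  then have "((\<lambda>n. cmod c * norm (f n - u)) \<longlongrightarrow> 0) F"
    by (intro tendsto_mult_right_zero tendsto_norm_zero) (simp add: LIM_zero)
  then have "((\<lambda>n. c *\<^sub>C f n - c *\<^sub>C u) \<longlongrightarrow> 0) F"
    by (rule Lim_null_comparison[rotated])
      (simp add: norm_scaleC flip: L2.scale_right_diff_distrib)
  then show ?thesis
    by (simp add: LIM_zero_cancel)
qed

text \<open>With \<open>\<parallel>u\<^sub>n\<^sub>+\<^sub>1 - u\<^sub>n\<parallel> \<le> 4\<^sup>-\<^sup>n\<close>, the weighted squares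
  \<open>4\<^sup>n |u\<^sub>n\<^sub>+\<^sub>1 - u\<^sub>n|\<^sup>2\<close> have a finite sum of integrals, so they are bounded at almost every
  point, and there the increments decay geometrically.\<close>

lemma L2_rapidly_Cauchy_AE_convergent:
  fixes u :: "nat \<Rightarrow> 'a::euclidean_space L2"
  assumes "\<And>n. norm (u (Suc n) - u n) \<le> (1/4) ^ n"
  shows "AE x in lebesgue. convergent (\<lambda>n. rep_L2 (u n) x)"
proof -
  let ?d = "\<lambda>n x. ennreal (4 ^ n * (cmod (rep_L2 (u (Suc n)) x - rep_L2 (u n) x))\<^sup>2)"
  have meas[measurable]: "?d n \<in> borel_measurable lebesgue" for n
    by measurable
  have "(\<integral>\<^sup>+x. ?d n x \<partial>lebesgue) \<le> ennreal ((1/4) ^ n)" for n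
  proof -
    have "(\<integral>\<^sup>+x. ?d n x \<partial>lebesgue)
        = (\<integral>\<^sup>+x. ennreal (4 ^ n) * ennreal ((cmod (rep_L2 (u (Suc n) - u n) x))\<^sup>2) \<partial>lebesgue)"
      by (intro nn_integral_cong_AE eventually_mono[OF rep_minus_L2[of "u (Suc n)" "u n"]])
        (simp add: ennreal_mult)
    also have "\<dots> = ennreal (4 ^ n * (norm (u (Suc n) - u n))\<^sup>2)"
      by (simp add: nn_integral_cmult nn_integral_L2 ennreal_mult)
    also have "\<dots> \<le> ennreal (4 ^ n * ((1/4) ^ n)\<^sup>2)"
      by (intro ennreal_leI mult_left_mono power_mono assms) auto
    also have "4 ^ n * ((1/4) ^ n)\<^sup>2 = (1/4 :: real) ^ n"
      by (simp add: power2_eq_square power_divide)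
    finally show ?thesis .
  qed
  then have "(\<Sum>n. \<integral>\<^sup>+x. ?d n x \<partial>lebesgue) \<le> (\<Sum>n. ennreal ((1/4) ^ n))"
    by (intro suminf_le) auto
  also have "\<dots> = ennreal (\<Sum>n. (1/4) ^ n)"
    by (intro suminf_ennreal2) (auto intro: summable_geometric)
  also have "\<dots> < \<infinity>"
    by simp
  finally have "(\<integral>\<^sup>+x. (\<Sum>n. ?d n x) \<partial>lebesgue) < \<infinity>"
    by (subst nn_integral_suminf) auto
  then have "AE x in lebesgue. (\<Sum>n. ?d n x) \<noteq> \<infinity>"
    by (intro nn_integral_PInf_AE) auto
  then show ?thesis
  proof (rule eventually_mono)
    fix x
    let ?e = "\<lambda>n. cmod (rep_L2 (u (Suc n)) x - rep_L2 (u n) x)"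
    assume fin: "(\<Sum>n. ?d n x) \<noteq> \<infinity>"
    have "summable (\<lambda>n. 4 ^ n * (?e n)\<^sup>2)"
      by (rule summable_suminf_not_top) (use fin in \<open>auto simp: infinity_ennreal_def\<close>)
    then have "bounded (range (\<lambda>n. 4 ^ n * (?e n)\<^sup>2))"
      by (rule convergent_imp_bounded[OF summable_LIMSEQ_zero])
    then obtain B where "\<And>n. norm (4 ^ n * (?e n)\<^sup>2) \<le> B"
      by (auto simp: bounded_iff)
    then have bound: "4 ^ n * (?e n)\<^sup>2 \<le> B" for n
      by (metis abs_ge_self order_trans real_norm_def)
    have B: "0 \<le> B"
      by (rule order_trans[OF _ bound[of 0]]) simp
    have four: "((2::real) ^ n)\<^sup>2 = 4 ^ n" for n
      by (simp add: power2_eq_square flip: power_mult_distrib)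
    have "(2 ^ n * ?e n)\<^sup>2 \<le> (sqrt B)\<^sup>2" for n
      using B bound[of n] by (simp add: power_mult_distrib four)
    then have "2 ^ n * ?e n \<le> sqrt B" for n
      by (rule power2_le_imp_le) (use B in simp)
    then have "?e n \<le> sqrt B * (1/2) ^ n" for n
      by (simp add: field_simps power_divide)
    moreover have "summable (\<lambda>n. sqrt B * (1/2) ^ n)"
      by (intro summable_mult summable_geometric) simp
    ultimately have "summable (\<lambda>n. rep_L2 (u (Suc n)) x - rep_L2 (u n) x)"
      by (auto intro: summable_comparison_test'[of "\<lambda>n. sqrt B * (1/2) ^ n" 0])
    then have "convergent (\<lambda>n. \<Sum>i<n. rep_L2 (u (Suc i)) x - rep_L2 (u i) x)"
      by (simp add: summable_iff_convergent)
    then show "convergent (\<lambda>n. rep_L2 (u n) x)"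
      by (simp only: sum_lessThan_telescope[of "\<lambda>n. rep_L2 (u n) x"] convergent_diff_const_right_iff)
  qed
qed

text \<open>The almost everywhere limit of a rapidly convergent subsequence is the limit of the
  whole sequence, by Fatou's lemma.\<close>

instance L2 :: (euclidean_space) complete_space
proof
  fix U :: "nat \<Rightarrow> 'a L2"
  assume U: "Cauchy U"
  have "\<exists>r. \<forall>n. (\<forall>i\<ge>r n. \<forall>j\<ge>r n. norm (U i - U j) \<le> (1/4) ^ n) \<and> r n < r (Suc n)"
  proof (rule dependent_nat_choice)
    show "\<exists>r. \<forall>i\<ge>r. \<forall>j\<ge>r. norm (U i - U j) \<le> (1/4) ^ 0"
      using CauchyD[OF U, of 1] by (auto intro: less_imp_le)
    fix r n
    obtain M where "\<forall>i\<ge>M. \<forall>j\<ge>M. norm (U i - U j) < (1/4) ^ Suc n"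
      using CauchyD[OF U, of "(1/4) ^ Suc n"] by auto
    then show "\<exists>r'. (\<forall>i\<ge>r'. \<forall>j\<ge>r'. norm (U i - U j) \<le> (1/4) ^ Suc n) \<and> r < r'"
      by (intro exI[of _ "max M (Suc r)"]) (auto intro: less_imp_le)
  qed
  then obtain r where r: "\<And>n i j. r n \<le> i \<Longrightarrow> r n \<le> j \<Longrightarrow> norm (U i - U j) \<le> (1/4) ^ n"
    and "\<And>n. r n < r (Suc n)"
    by blast
  then have mono: "strict_mono r"
    by (simp add: strict_mono_Suc_iff)
  define V where "V = U \<circ> r"
  have V: "AE x in lebesgue. convergent (\<lambda>n. rep_L2 (V n) x)"
    by (rule L2_rapidly_Cauchy_AE_convergent)
      (use mono in \<open>auto simp: V_def strict_mono_Suc_iff less_imp_le intro!: r\<close>)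
  define f where "f x = lim (\<lambda>n. rep_L2 (V n) x)" for x
  have f_meas[measurable]: "f \<in> borel_measurable lebesgue"
    unfolding f_def by measurable
  have est: "(\<integral>\<^sup>+x. ennreal ((cmod (rep_L2 (V k) x - f x))\<^sup>2) \<partial>lebesgue) \<le> ennreal (((1/4) ^ n)\<^sup>2)"
    if "n \<le> k" for k n
  proof -
    have "(\<integral>\<^sup>+x. ennreal ((cmod (rep_L2 (V k) x - f x))\<^sup>2) \<partial>lebesgue)
        = (\<integral>\<^sup>+x. liminf (\<lambda>m. ennreal ((cmod (rep_L2 (V k) x - rep_L2 (V m) x))\<^sup>2)) \<partial>lebesgue)"
    proof (intro nn_integral_cong_AE eventually_mono[OF V])
      fix x assume "convergent (\<lambda>n. rep_L2 (V n) x)"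
      then have "(\<lambda>m. ennreal ((cmod (rep_L2 (V k) x - rep_L2 (V m) x))\<^sup>2))
          \<longlonglongrightarrow> ennreal ((cmod (rep_L2 (V k) x - f x))\<^sup>2)"
        unfolding f_def convergent_LIMSEQ_iff by (intro tendsto_intros) auto
      then show "ennreal ((cmod (rep_L2 (V k) x - f x))\<^sup>2)
          = liminf (\<lambda>m. ennreal ((cmod (rep_L2 (V k) x - rep_L2 (V m) x))\<^sup>2))"
        by (rule lim_imp_Liminf[symmetric, rotated]) simp
    qed
    also have "\<dots> \<le> liminf (\<lambda>m. \<integral>\<^sup>+x. ennreal ((cmod (rep_L2 (V k) x - rep_L2 (V m) x))\<^sup>2) \<partial>lebesgue)"
      by (rule nn_integral_liminf) measurable
    also have "\<dots> = liminf (\<lambda>m. ennreal ((norm (V k - V m))\<^sup>2))"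
      unfolding nn_integral_L2[symmetric]
    proof (intro arg_cong[where f=liminf] ext nn_integral_cong_AE)
      fix m
      show "AE x in lebesgue. ennreal ((cmod (rep_L2 (V k) x - rep_L2 (V m) x))\<^sup>2)
          = ennreal ((cmod (rep_L2 (V k - V m) x))\<^sup>2)"
        using rep_minus_L2[of "V k" "V m"] by eventually_elim simp
    qed
    also have "\<dots> \<le> liminf (\<lambda>m. ennreal (((1/4) ^ n)\<^sup>2))"
    proof (intro Liminf_mono eventually_sequentiallyI[of n] ennreal_leI power_mono)
      fix m assume "n \<le> m"
      then show "norm (V k - V m) \<le> (1/4) ^ n"
        using that mono by (auto simp: V_def strict_mono_less_eq intro!: r)
    qed auto
    finally show ?thesis
      by (simp add: Liminf_const)
  qed
  have sq: "square_integrable (\<lambda>x. rep_L2 (V n) x - f x)" for n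
    unfolding square_integrable_def
    using est[of n n] by (auto simp: integrable_iff_bounded intro: le_less_trans)
  then have "square_integrable f"
    using square_integrable_add[OF square_integrable_rep_L2[of "V 0"] square_integrable_uminus[OF sq[of 0]]]
    by simp
  define L where "L = abs_L2 f"
  have L: "AE x in lebesgue. rep_L2 L x = f x"
    unfolding L_def by (rule rep_abs_L2) fact
  have "norm (V k - L) \<le> (1/4) ^ k" for k
  proof -
    have "ennreal ((norm (V k - L))\<^sup>2) = (\<integral>\<^sup>+x. ennreal ((cmod (rep_L2 (V k) x - f x))\<^sup>2) \<partial>lebesgue)"
      unfolding nn_integral_L2[symmetric]
      by (intro nn_integral_cong_AE) (use L rep_minus_L2[of "V k" L] in eventually_elim, simp)
    also have "\<dots> \<le> ennreal (((1/4) ^ k)\<^sup>2)"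
      by (rule est) simp
    finally have "(norm (V k - L))\<^sup>2 \<le> ((1/4) ^ k)\<^sup>2"
      by (subst (asm) ennreal_le_iff) auto
    then show ?thesis
      by (rule power2_le_imp_le) simp
  qed
  then have "(\<lambda>k. V k - L) \<longlonglongrightarrow> 0"
    by (rule Lim_null_comparison[OF always_eventually[OF allI]]) (auto intro: LIMSEQ_realpow_zero)
  then have "V \<longlonglongrightarrow> L"
    by (rule LIM_zero_cancel)
  then have "U \<longlonglongrightarrow> L"
    unfolding V_def by (rule Cauchy_converges_subseq[OF U mono])
  then show "convergent U"
    by (auto simp: convergent_def)
qed

text \<open>The squares \<open>|u\<^sub>n - v|\<^sup>2\<close> converge to zero in the mean.\<close>

lemma L2_tendsto_AE_subseq:
  fixes u :: "nat \<Rightarrow> 'a::euclidean_space L2"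
  assumes "u \<longlonglongrightarrow> v"
  obtains r where "strict_mono r" "AE x in lebesgue. (\<lambda>n. rep_L2 (u (r n)) x) \<longlonglongrightarrow> rep_L2 v x"
proof -
  have "(\<lambda>n. (norm (u n - v))\<^sup>2) \<longlonglongrightarrow> 0"
    using assms by (auto intro!: tendsto_null_power tendsto_norm_zero simp: LIM_zero)
  then have "(\<lambda>n. \<integral>x. norm ((cmod (rep_L2 (u n - v) x))\<^sup>2) \<partial>lebesgue) \<longlonglongrightarrow> 0"
    by (simp add: norm_L2_square)
  from tendsto_L1_AE_subseq[OF square_integrableD(2)[OF square_integrable_rep_L2] this]
  obtain r where r: "strict_mono r"
    "AE x in lebesgue. (\<lambda>n. (cmod (rep_L2 (u (r n) - v) x))\<^sup>2) \<longlonglongrightarrow> 0"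
    by blast
  have "AE x in lebesgue. \<forall>n. rep_L2 (u (r n) - v) x = rep_L2 (u (r n)) x - rep_L2 v x"
    by (simp add: AE_all_countable rep_minus_L2)
  with r(2) have "AE x in lebesgue. (\<lambda>n. rep_L2 (u (r n)) x) \<longlonglongrightarrow> rep_L2 v x"
  proof eventually_elim
    case (elim x)
    then have "(\<lambda>n. sqrt ((cmod (rep_L2 (u (r n)) x - rep_L2 v x))\<^sup>2)) \<longlonglongrightarrow> sqrt 0"
      by (intro tendsto_real_sqrt) simp
    then have "(\<lambda>n. cmod (rep_L2 (u (r n)) x - rep_L2 v x)) \<longlonglongrightarrow> 0"
      by simp
    then show ?case
      by (rule LIM_zero_cancel[OF tendsto_norm_zero_cancel])
  qed
  with r(1) show ?thesis
    by (rule that)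
qed


section \<open>Closed coercive forms and the Riesz representation\<close>

lemma L2_subspace_closure:
  assumes "L2.subspace Q"
  shows "L2.subspace (closure Q)"
proof (rule L2.subspaceI)
  show "0 \<in> closure Q"
    using L2.subspace_0[OF assms] closure_subset by blast
  show "x + y \<in> closure Q" if x: "x \<in> closure Q" and y: "y \<in> closure Q" for x y
  proof -
    obtain a where "\<And>n. a n \<in> Q" "a \<longlonglongrightarrow> x"
      using x unfolding closure_sequential by blast
    moreover obtain b where "\<And>n. b n \<in> Q" "b \<longlonglongrightarrow> y"
      using y unfolding closure_sequential by blast
    ultimately show ?thesis
      unfolding closure_sequential
      by (intro exI[of _ "\<lambda>n. a n + b n"]) (auto intro: tendsto_add L2.subspace_add[OF assms])
  qed
  show "c *\<^sub>C x \<in> closure Q" if x: "x \<in> closure Q" for c x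
  proof -
    obtain a where "\<And>n. a n \<in> Q" "a \<longlonglongrightarrow> x"
      using x unfolding closure_sequential by blast
    then show ?thesis
      unfolding closure_sequential
      by (intro exI[of _ "\<lambda>n. c *\<^sub>C a n"]) (auto intro: tendsto_scaleC L2.subspace_scale[OF assms])
  qed
qed

text \<open>The discriminant of a nonnegative quadratic polynomial in a complex variable; the test
  point \<open>t = - d / (b + 1)\<close> avoids the case distinction \<open>b = 0\<close>.\<close>

lemma complex_quadratic_nonneg_imp_discriminant:
  assumes "\<And>t. 0 \<le> e + 2 * Re (cnj t * d) + (cmod t)\<^sup>2 * b" "0 \<le> b"
  shows "(cmod d)\<^sup>2 \<le> (b + 1) * e"
proof -
  define s where "s = 1 / (b + 1)"
  have s: "0 < s" "s * b \<le> 1" "s * (b + 1) = 1"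
    using assms(2) by (auto simp: s_def field_simps)
  have "Re (cnj (- s *\<^sub>R d) * d) = - s * (cmod d)\<^sup>2"
    unfolding cmod_power2 by (simp add: power2_eq_square algebra_simps)
  then have "0 \<le> e - 2 * s * (cmod d)\<^sup>2 + (s * cmod d)\<^sup>2 * b"
    using assms(1)[of "- s *\<^sub>R d"] s(1) by simp
  moreover have "(s * cmod d)\<^sup>2 * b = (s * b) * (s * (cmod d)\<^sup>2)"
    by (simp add: power2_eq_square)
  moreover have "(s * b) * (s * (cmod d)\<^sup>2) \<le> 1 * (s * (cmod d)\<^sup>2)"
    using s by (intro mult_right_mono) auto
  ultimately have "s * (cmod d)\<^sup>2 \<le> e"
    by linarith
  then have "(b + 1) * (s * (cmod d)\<^sup>2) \<le> (b + 1) * e"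
    using assms(2) by (intro mult_left_mono) auto
  then show ?thesis
    using s(3) by (simp add: mult.assoc[symmetric] mult.commute)
qed

locale hermitian_form =
  fixes Q :: "'a::euclidean_space L2 set" and h :: "'a L2 \<Rightarrow> 'a L2 \<Rightarrow> complex"
  assumes subspace: "L2.subspace Q"
    and add_left: "u \<in> Q \<Longrightarrow> v \<in> Q \<Longrightarrow> w \<in> Q \<Longrightarrow> h (u + v) w = h u w + h v w"
    and scale_left: "u \<in> Q \<Longrightarrow> v \<in> Q \<Longrightarrow> h (c *\<^sub>C u) v = c * h u v"
    and commute: "u \<in> Q \<Longrightarrow> v \<in> Q \<Longrightarrow> h u v = cnj (h v u)"
begin

lemmas mem_add = L2.subspace_add[OF subspace]
  and mem_diff = L2.subspace_diff[OF subspace]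
  and mem_scale = L2.subspace_scale[OF subspace]

lemma add_right: "u \<in> Q \<Longrightarrow> v \<in> Q \<Longrightarrow> w \<in> Q \<Longrightarrow> h w (u + v) = h w u + h w v"
  using add_left commute mem_add by (metis complex_cnj_add)

lemma scale_right: "u \<in> Q \<Longrightarrow> v \<in> Q \<Longrightarrow> h v (c *\<^sub>C u) = cnj c * h v u"
  using scale_left commute mem_scale by (metis complex_cnj_mult)

lemma diff_left: "u \<in> Q \<Longrightarrow> v \<in> Q \<Longrightarrow> w \<in> Q \<Longrightarrow> h (u - v) w = h u w - h v w"
  using add_left[of "u - v" v w] mem_diff[of u v] by simp

lemma diff_right: "u \<in> Q \<Longrightarrow> v \<in> Q \<Longrightarrow> w \<in> Q \<Longrightarrow> h w (u - v) = h w u - h w v"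
  using add_right[of "u - v" v w] mem_diff[of u v] by simp

lemma Re_commute: "u \<in> Q \<Longrightarrow> v \<in> Q \<Longrightarrow> Re (h u v) = Re (h v u)"
  using commute[of u v] by simp

lemma quadratic_expansion:
  assumes "u \<in> Q" "v \<in> Q"
  shows "Re (h (u + t *\<^sub>C v) (u + t *\<^sub>C v))
    = Re (h u u) + 2 * Re (cnj t * h u v) + (cmod t)\<^sup>2 * Re (h v v)"
proof -
  have tv: "t *\<^sub>C v \<in> Q"
    using assms mem_scale by auto
  have "h (t *\<^sub>C v) (t *\<^sub>C v) = complex_of_real ((cmod t)\<^sup>2) * h v v"
    using assms tv by (simp add: scale_left scale_right of_real_cmod_square)
  moreover have "h (u + t *\<^sub>C v) (u + t *\<^sub>C v)
      = h u u + h u (t *\<^sub>C v) + h (t *\<^sub>C v) u + h (t *\<^sub>C v) (t *\<^sub>C v)"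
    using assms tv mem_add by (simp add: add_left add_right)
  ultimately show ?thesis
    using Re_commute[OF assms(1) tv] assms by (simp add: scale_right)
qed

lemma parallelogram:
  assumes "u \<in> Q" "v \<in> Q"
  shows "Re (h (u - v) (u - v)) = 2 * Re (h u u) + 2 * Re (h v v)
    - 4 * Re (h ((1/2) *\<^sub>C (u + v)) ((1/2) *\<^sub>C (u + v)))"
  using assms mem_add[of u v] mem_scale[of "u + v" "1/2"] mem_diff[of u v]
  by (simp add: scale_left scale_right add_left add_right diff_left diff_right) (simp add: field_simps)

end

text \<open>Closedness: a sequence that converges in \<open>L\<^sup>2\<close> and is Cauchy in the form norm converges
  in the form norm.\<close>

locale closed_coercive_form = hermitian_form +
  assumes coercive: "u \<in> Q \<Longrightarrow> (norm u)\<^sup>2 \<le> Re (h u u)"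
    and closed: "\<lbrakk>\<And>n. U n \<in> Q; U \<longlonglongrightarrow> l;
        \<And>e. 0 < e \<Longrightarrow> \<exists>N. \<forall>m\<ge>N. \<forall>n\<ge>N. Re (h (U m - U n) (U m - U n)) < e\<rbrakk>
      \<Longrightarrow> l \<in> Q \<and> (\<lambda>n. Re (h (U n - l) (U n - l))) \<longlonglongrightarrow> 0"
begin

text \<open>Minimize \<open>J(u) = h(u, u) - 2 Re \<langle>f, u\<rangle>\<close>. By the parallelogram law minimizing sequences are
  Cauchy in the form norm, and the first variation of \<open>J\<close> tends to zero along them.\<close>

lemma Riesz_representation: "\<exists>u\<in>Q. \<forall>v\<in>Q. h u v = cinner f v"
proof -
  define J where "J u = Re (h u u) - 2 * Re (cinner f u)" for u
  have lower: "- (norm f)\<^sup>2 \<le> J u" if "u \<in> Q" for u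
  proof -
    have "Re (cinner f u) \<le> norm f * norm u"
      using norm_cinner_le[of f u] complex_Re_le_cmod[of "cinner f u"] by linarith
    moreover have "0 \<le> (norm u - norm f)\<^sup>2"
      by simp
    ultimately show ?thesis
      using coercive[OF that] by (simp add: J_def power2_diff mult.commute)
  qed
  define m where "m = Inf (J ` Q)"
  have bdd: "bdd_below (J ` Q)"
    using lower by (auto intro!: bdd_belowI)
  have m: "m \<le> J u" if "u \<in> Q" for u
    unfolding m_def using that bdd by (intro cInf_lower) auto
  have "\<exists>u\<in>Q. J u < m + inverse (Suc n)" for n
  proof -
    have "Inf (J ` Q) < m + inverse (Suc n)"
      by (simp add: m_def)
    then show ?thesis
      using cInf_lessD[of "J ` Q"] L2.subspace_0[OF subspace] by blast
  qed
  then obtain U where U: "\<And>n. U n \<in> Q" "\<And>n. J (U n) < m + inverse (Suc n)"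
    by metis
  have dist_form: "Re (h (U k - U n) (U k - U n)) < 2 * inverse (Suc k) + 2 * inverse (Suc n)" for k n
  proof -
    let ?w = "(1/2) *\<^sub>C (U k + U n)"
    have "?w \<in> Q"
      using U mem_add mem_scale by blast
    moreover have "Re (h (U k - U n) (U k - U n)) = 2 * J (U k) + 2 * J (U n) - 4 * J ?w"
      using parallelogram[OF U(1) U(1), of k n]
      by (simp add: J_def cinner_scaleC_right cinner_add_right) (simp add: field_simps)
    ultimately show ?thesis
      using U(2)[of k] U(2)[of n] m[of ?w] by linarith
  qed
  have Cauchy_form: "\<exists>N. \<forall>k\<ge>N. \<forall>n\<ge>N. Re (h (U k - U n) (U k - U n)) < e" if "0 < e" for e
  proof -
    obtain N where N: "inverse (Suc N) < e / 4"
      using reals_Archimedean[of "e / 4"] \<open>0 < e\<close> by auto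
    show ?thesis
    proof (intro exI allI impI)
      fix k n assume "N \<le> k" "N \<le> n"
      then have "inverse (Suc k) \<le> inverse (real (Suc N))" "inverse (Suc n) \<le> inverse (real (Suc N))"
        by (auto intro!: le_imp_inverse_le)
      then show "Re (h (U k - U n) (U k - U n)) < e"
        using dist_form[of k n] N by linarith
    qed
  qed
  have "Cauchy U"
  proof (rule CauchyI)
    fix e :: real assume "0 < e"
    then obtain N where N: "\<And>k n. N \<le> k \<Longrightarrow> N \<le> n \<Longrightarrow> Re (h (U k - U n) (U k - U n)) < e\<^sup>2"
      using Cauchy_form[of "e\<^sup>2"] by auto
    have "norm (U k - U n) < e" if "N \<le> k" "N \<le> n" for k n
      using coercive[OF mem_diff[OF U(1) U(1)], of k n] N[OF that] \<open>0 < e\<close>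
      by (intro power2_less_imp_less[of _ e]) linarith+
    then show "\<exists>M. \<forall>k\<ge>M. \<forall>n\<ge>M. norm (U k - U n) < e"
      by blast
  qed
  then obtain l where "U \<longlonglongrightarrow> l"
    using Cauchy_convergent convergent_def by blast
  then have l: "l \<in> Q" "(\<lambda>n. Re (h (U n - l) (U n - l))) \<longlonglongrightarrow> 0"
    using closed[OF U(1) _ Cauchy_form] by auto
  have "h l v = cinner f v" if v: "v \<in> Q" for v
  proof -
    have hv: "0 \<le> Re (h v v)"
      using coercive[OF v] zero_le_power2[of "norm v"] by linarith
    let ?d = "\<lambda>n. h (U n) v - cinner f v"
    have "(cmod (?d n))\<^sup>2 \<le> (Re (h v v) + 1) * inverse (Suc n)" for n
    proof (rule complex_quadratic_nonneg_imp_discriminant)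
      fix t
      have "U n + t *\<^sub>C v \<in> Q"
        using U v mem_add mem_scale by blast
      then have "m \<le> J (U n + t *\<^sub>C v)"
        by (rule m)
      also have "J (U n + t *\<^sub>C v)
          = J (U n) + 2 * Re (cnj t * ?d n) + (cmod t)\<^sup>2 * Re (h v v)"
        unfolding J_def quadratic_expansion[OF U(1) v]
        by (simp add: cinner_add_right cinner_scaleC_right algebra_simps)
      finally show "0 \<le> inverse (Suc n) + 2 * Re (cnj t * ?d n) + (cmod t)\<^sup>2 * Re (h v v)"
        using U(2)[of n] by linarith
    qed (fact hv)
    then have "(\<lambda>n. (cmod (?d n))\<^sup>2) \<longlonglongrightarrow> 0"
      by (intro tendsto_sandwich[OF _ _ tendsto_const tendsto_mult_right_zero[OF LIMSEQ_inverse_real_of_nat]])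
        (auto intro!: always_eventually)
    then have d: "?d \<longlonglongrightarrow> 0"
      by (simp add: tendsto_norm_zero_iff)
    have "(cmod (h (U n - l) v))\<^sup>2 \<le> (Re (h v v) + 1) * Re (h (U n - l) (U n - l))" for n
    proof (rule complex_quadratic_nonneg_imp_discriminant)
      fix t
      have w: "U n - l \<in> Q"
        using U l mem_diff by blast
      then have "U n - l + t *\<^sub>C v \<in> Q"
        using v mem_add mem_scale by blast
      then have "0 \<le> Re (h (U n - l + t *\<^sub>C v) (U n - l + t *\<^sub>C v))"
        using coercive zero_le_power2 order_trans by blast
      then show "0 \<le> Re (h (U n - l) (U n - l)) + 2 * Re (cnj t * h (U n - l) v) + (cmod t)\<^sup>2 * Re (h v v)"
        unfolding quadratic_expansion[OF w v] .
    qed (fact hv)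
    then have "(\<lambda>n. (cmod (h (U n - l) v))\<^sup>2) \<longlonglongrightarrow> 0"
      by (intro tendsto_sandwich[OF _ _ tendsto_const tendsto_mult_right_zero[OF l(2)]])
        (auto intro!: always_eventually)
    then have "(\<lambda>n. h (U n - l) v) \<longlonglongrightarrow> 0"
      by (simp add: tendsto_norm_zero_iff)
    with d have "(\<lambda>n. ?d n - h (U n - l) v) \<longlonglongrightarrow> 0 - 0"
      by (intro tendsto_diff)
    then have "(\<lambda>n. h l v - cinner f v) \<longlonglongrightarrow> 0"
      using U l v by (simp add: diff_left)
    then show ?thesis
      by (simp add: tendsto_const_iff)
  qed
  with l(1) show ?thesis
    by blast
qed

end

lemma orthogonal_projection:
  assumes "L2.subspace S" "closed S"
  shows "\<exists>p\<in>S. \<forall>v\<in>S. cinner (f - p) v = 0"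
proof -
  interpret closed_coercive_form S cinner
  proof
    fix U :: "nat \<Rightarrow> 'a L2" and l
    assume "\<And>n. U n \<in> S" and lim: "U \<longlonglongrightarrow> l"
    then have "l \<in> S"
      using assms(2) closed_sequentially by blast
    moreover have "(\<lambda>n. (norm (U n - l))\<^sup>2) \<longlonglongrightarrow> 0"
      using lim by (auto intro!: tendsto_null_power tendsto_norm_zero simp: LIM_zero)
    ultimately show "l \<in> S \<and> (\<lambda>n. Re (cinner (U n - l) (U n - l))) \<longlonglongrightarrow> 0"
      by (simp add: cinner_self_norm)
  qed (use assms(1) cinner_commute in \<open>auto simp: cinner_add_left cinner_scaleC_left cinner_self_norm\<close>)
  from Riesz_representation[of f] obtain p where "p \<in> S" "\<And>v. v \<in> S \<Longrightarrow> cinner p v = cinner f v"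
    by blast
  then show ?thesis
    by (intro bexI[of _ p]) (auto simp: cinner_minus_left)
qed

section \<open>Operators with finitely many dimensions below every level\<close>

text \<open>Passing to the kernel of one of the functionals costs at most one dimension.\<close>

lemma L2_subspace_finite_separation_imp_finite_dim:
  assumes "finite B" "L2.subspace N"
    and "\<And>u. u \<in> N \<Longrightarrow> (\<And>w. w \<in> B \<Longrightarrow> cinner u w = 0) \<Longrightarrow> u = 0"
  shows "\<exists>F. finite F \<and> N \<subseteq> L2.span F"
  using assms
proof (induction B arbitrary: N rule: finite_induct)
  case empty
  then show ?case
    by (intro exI[of _ "{}"]) auto
next
  case (insert w B)
  let ?N = "{u \<in> N. cinner u w = 0}"
  have "L2.subspace ?N"
    using insert.prems(1)
    by (auto simp: L2.subspace_def cinner_add_left cinner_scaleC_left)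
  moreover have "u = 0" if "u \<in> ?N" "\<And>w. w \<in> B \<Longrightarrow> cinner u w = 0" for u
    using insert.prems(2)[of u] that by auto
  ultimately obtain F where F: "finite F" "?N \<subseteq> L2.span F"
    using insert.IH[of ?N] by blast
  show ?case
  proof (cases "?N = N")
    case True
    then show ?thesis
      using F by auto
  next
    case False
    then obtain y where y: "y \<in> N" "cinner y w \<noteq> 0"
      by auto
    have "u \<in> L2.span (insert y F)" if "u \<in> N" for u
    proof -
      let ?c = "cinner u w / cinner y w"
      have "u - ?c *\<^sub>C y \<in> ?N"
        using that y insert.prems(1)
        by (auto simp: cinner_minus_left cinner_scaleC_left intro!: L2.subspace_diff L2.subspace_scale)
      then show ?thesis
        using F(2) L2.span_breakdown_eq[of u y F] by blast
    qed
    then show ?thesis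
      using F(1) by (intro exI[of _ "insert y F"]) auto
  qed
qed

text \<open>Bolzano--Weierstrass, one coordinate after the other.\<close>

lemma bounded_imp_subseq_cinner_convergent:
  fixes u :: "nat \<Rightarrow> 'a::euclidean_space L2"
  assumes "finite B" "\<And>n. norm (u n) \<le> b"
  shows "\<exists>r::nat \<Rightarrow> nat. strict_mono r \<and> (\<forall>w\<in>B. convergent (\<lambda>n. cinner (u (r n)) w))"
  using assms(1)
proof induction
  case empty
  show ?case
    by (intro exI[of _ id]) (auto simp: strict_mono_def)
next
  case (insert w B)
  then obtain r where r: "strict_mono (r::nat \<Rightarrow> nat)" "\<And>w. w \<in> B \<Longrightarrow> convergent (\<lambda>n. cinner (u (r n)) w)"
    by blast
  have "norm (cinner (u (r n)) w) \<le> b * norm w" for n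
    using norm_cinner_le[of "u (r n)" w] mult_right_mono[OF assms(2)[of "r n"], of "norm w"] by simp
  then have "bounded (range (\<lambda>n. cinner (u (r n)) w))"
    by (auto simp: bounded_iff)
  then obtain l s where s: "strict_mono s" "((\<lambda>n. cinner (u (r n)) w) \<circ> s) \<longlonglongrightarrow> l"
    using bounded_imp_convergent_subsequence by blast
  have "convergent (\<lambda>n. cinner (u ((r \<circ> s) n)) w')" if "w' \<in> insert w B" for w'
  proof (cases "w' = w")
    case True
    then show ?thesis
      using s(2) by (auto simp: convergent_def o_def)
  next
    case False
    then show ?thesis
      using convergent_subseq_convergent[OF r(2)[of w'] s(1)] that by (simp add: o_def)
  qed
  then show ?case
    using strict_mono_o[OF r(1) s(1)] by blast
qed

text \<open>\<open>T\<close> is the graph of a symmetric operator in \<open>K\<close> for which \<open>T + c\<close> is onto with contractive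
  inverse. The last assumption says that, up to finitely many dimensions, \<open>T\<close> exceeds every level
  \<open>M\<close>; it carries all of the compactness.\<close>

locale discrete_operator =
  fixes K :: "'a::euclidean_space L2 set" and T :: "('a L2 \<times> 'a L2) set" and c :: real
  assumes K: "L2.subspace K" "closed K"
    and graph_mem: "(u, g) \<in> T \<Longrightarrow> u \<in> K \<and> g \<in> K"
    and graph_diff: "(u, g) \<in> T \<Longrightarrow> (v, k) \<in> T \<Longrightarrow> (u - v, g - k) \<in> T"
    and graph_scale: "(u, g) \<in> T \<Longrightarrow> (z *\<^sub>C u, z *\<^sub>C g) \<in> T"
    and symmetric: "(u, g) \<in> T \<Longrightarrow> (v, k) \<in> T \<Longrightarrow> cinner g v = cinner u k"
    and onto: "f \<in> K \<Longrightarrow> \<exists>u. (u, f - complex_of_real c *\<^sub>C u) \<in> T"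
    and contractive_inverse: "(u, g) \<in> T \<Longrightarrow> norm u \<le> norm (g + complex_of_real c *\<^sub>C u)"
    and finite_below: "\<exists>B C. finite B \<and>
      (\<forall>(u, g)\<in>T. M * (norm u)\<^sup>2 \<le> Re (cinner g u) + C * (\<Sum>w\<in>B. (cmod (cinner u w))\<^sup>2))"
begin

abbreviation "cc \<equiv> complex_of_real c"

lemma graph_zero: "(0, 0) \<in> T"
  using onto[of 0] graph_diff L2.subspace_0[OF K(1)] by fastforce

lemma graph_add: "(u, g) \<in> T \<Longrightarrow> (v, k) \<in> T \<Longrightarrow> (u + v, g + k) \<in> T"
  using graph_diff[of u g "0 - v" "0 - k"] graph_diff[OF graph_zero] by simp

lemma graph_closed:
  assumes "\<And>n. (U n, G n) \<in> T" "U \<longlonglongrightarrow> u" "G \<longlonglongrightarrow> g"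
  shows "(u, g) \<in> T"
proof -
  have uK: "u \<in> K" "g \<in> K"
    using assms graph_mem closed_sequentially[OF K(2)] by blast+
  then have "g + cc *\<^sub>C u \<in> K"
    using K(1) by (intro L2.subspace_add L2.subspace_scale)
  then obtain v where v: "(v, g + cc *\<^sub>C u - cc *\<^sub>C v) \<in> T"
    using onto by blast
  have bound: "norm (U n - v) \<le> norm ((G n - g) + cc *\<^sub>C (U n - u))" for n
    using contractive_inverse[OF graph_diff[OF assms(1) v], of n]
    by (simp add: L2.scale_right_diff_distrib algebra_simps)
  have "(\<lambda>n. norm ((G n - g) + cc *\<^sub>C (U n - u))) \<longlonglongrightarrow> norm ((g - g) + cc *\<^sub>C (u - u))"
    using assms by (intro tendsto_intros tendsto_scaleC)
  then have "(\<lambda>n. norm ((G n - g) + cc *\<^sub>C (U n - u))) \<longlonglongrightarrow> 0"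
    by simp
  then have "(\<lambda>n. U n - v) \<longlonglongrightarrow> 0"
    by (rule Lim_null_comparison[OF always_eventually[OF allI[OF bound]]])
  then have "v = u"
    using LIMSEQ_unique[OF LIM_zero_cancel assms(2)] by blast
  with v show ?thesis
    by simp
qed

text \<open>A sequence of approximate eigenvectors is made to converge on the finitely many exceptional
  directions; the lower bound at a level above \<open>Re z\<close> then makes it Cauchy.\<close>

lemma approximate_eigenvectors_converge:
  assumes T: "\<And>n. (U n, G n) \<in> T" and unit: "\<And>n. norm (U n) = 1"
    and lim: "(\<lambda>n. G n - z *\<^sub>C U n) \<longlonglongrightarrow> 0"
  shows "\<exists>r l. strict_mono (r::nat \<Rightarrow> nat) \<and> (\<lambda>n. U (r n)) \<longlonglongrightarrow> l \<and> norm l = 1 \<and> (l, z *\<^sub>C l) \<in> T"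
proof -
  obtain B C where B: "finite B"
    "\<And>u g. (u, g) \<in> T \<Longrightarrow> (Re z + 1) * (norm u)\<^sup>2 \<le> Re (cinner g u) + C * (\<Sum>w\<in>B. (cmod (cinner u w))\<^sup>2)"
    using finite_below[of "Re z + 1"] by blast
  obtain r where r: "strict_mono (r::nat \<Rightarrow> nat)" "\<And>w. w \<in> B \<Longrightarrow> convergent (\<lambda>n. cinner (U (r n)) w)"
    using bounded_imp_subseq_cinner_convergent[OF B(1), of U 1] unit by auto
  then obtain s where s: "\<And>w. w \<in> B \<Longrightarrow> (\<lambda>n. cinner (U (r n)) w) \<longlonglongrightarrow> s w"
    unfolding convergent_def by metis
  define e where "e n = G (r n) - z *\<^sub>C U (r n)" for n
  have e: "e \<longlonglongrightarrow> 0"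
    using LIMSEQ_subseq_LIMSEQ[OF lim r(1)] by (simp add: e_def[abs_def] o_def)
  \<comment> \<open>A bound for \<open>\<parallel>U (r m) - U (r n)\<parallel>\<^sup>2\<close> that tends to zero as \<open>m\<close> and \<open>n\<close> tend to infinity.\<close>
  define b where "b m n = 2 * norm (e m - e n)
    + C * (\<Sum>w\<in>B. (cmod (cinner (U (r m)) w - cinner (U (r n)) w))\<^sup>2)" for m n
  have bound: "(norm (U (r m) - U (r n)))\<^sup>2 \<le> b m n" for m n
  proof -
    let ?d = "U (r m) - U (r n)"
    have "Re (cinner (G (r m) - G (r n)) ?d) = Re z * (norm ?d)\<^sup>2 + Re (cinner (e m - e n) ?d)"
    proof -
      have "G (r m) - G (r n) = z *\<^sub>C ?d + (e m - e n)"
        by (simp add: e_def L2.scale_right_diff_distrib)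
      then show ?thesis
        by (simp only: cinner_add_left cinner_scaleC_left cinner_self_norm) simp
    qed
    moreover have "Re (cinner (e m - e n) ?d) \<le> 2 * norm (e m - e n)"
    proof -
      have "Re (cinner (e m - e n) ?d) \<le> norm (e m - e n) * norm ?d"
        using norm_cinner_le[of "e m - e n" ?d] complex_Re_le_cmod[of "cinner (e m - e n) ?d"] by linarith
      also have "\<dots> \<le> norm (e m - e n) * 2"
        using norm_triangle_ineq4[of "U (r m)" "U (r n)"] unit by (intro mult_left_mono) auto
      finally show ?thesis
        by simp
    qed
    ultimately show ?thesis
      using B(2)[OF graph_diff[OF T T], of "r m" "r n"]
      by (simp add: b_def cinner_minus_left algebra_simps)
  qed
  have "((\<lambda>p. b (fst p) (snd p)) \<longlongrightarrow> 2 * norm (0 - 0 :: 'a L2) + C * (\<Sum>w\<in>B. (cmod (s w - s w))\<^sup>2))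
      (sequentially \<times>\<^sub>F sequentially)"
    unfolding b_def
    by (intro tendsto_intros tendsto_diff
        filterlim_compose[OF e filterlim_fst] filterlim_compose[OF e filterlim_snd]
        filterlim_compose[OF s filterlim_fst] filterlim_compose[OF s filterlim_snd])
  then have b: "((\<lambda>p. b (fst p) (snd p)) \<longlongrightarrow> 0) (sequentially \<times>\<^sub>F sequentially)"
    by simp
  have "Cauchy (\<lambda>n. U (r n))"
  proof (rule CauchyI)
    fix \<epsilon> :: real assume "0 < \<epsilon>"
    then have "\<forall>\<^sub>F p in sequentially \<times>\<^sub>F sequentially. b (fst p) (snd p) < \<epsilon>\<^sup>2"
      using order_tendstoD(2)[OF b, of "\<epsilon>\<^sup>2"] by simp
    then obtain N where N: "\<And>m n. N \<le> m \<Longrightarrow> N \<le> n \<Longrightarrow> b m n < \<epsilon>\<^sup>2"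
      unfolding eventually_prod_sequentially by auto
    have "norm (U (r m) - U (r n)) < \<epsilon>" if "N \<le> m" "N \<le> n" for m n
      using bound[of m n] N[OF that] \<open>0 < \<epsilon>\<close> by (intro power2_less_imp_less[of _ \<epsilon>]) linarith+
    then show "\<exists>M. \<forall>m\<ge>M. \<forall>n\<ge>M. norm (U (r m) - U (r n)) < \<epsilon>"
      by blast
  qed
  then obtain l where l: "(\<lambda>n. U (r n)) \<longlonglongrightarrow> l"
    using Cauchy_convergent convergent_def by blast
  have "(\<lambda>n. norm (U (r n))) \<longlonglongrightarrow> norm l"
    by (intro tendsto_norm l)
  then have "norm l = 1"
    by (simp add: unit LIMSEQ_const_iff)
  moreover have "(\<lambda>n. G (r n)) \<longlonglongrightarrow> z *\<^sub>C l"
    using tendsto_add[OF e tendsto_scaleC[OF l, of z]] by (simp add: e_def)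
  then have "(l, z *\<^sub>C l) \<in> T"
    by (rule graph_closed[OF T l])
  ultimately show ?thesis
    using r(1) l by blast
qed

lemma eigenvectors_orthogonal:
  assumes "(u, z *\<^sub>C u) \<in> T" "(v, x *\<^sub>C v) \<in> T" "z \<noteq> cnj x"
  shows "cinner u v = 0"
  using symmetric[OF assms(1,2)] assms(3) by (simp add: cinner_scaleC_left cinner_scaleC_right)

lemma eigenvalue_real:
  assumes "(u, z *\<^sub>C u) \<in> T" "u \<noteq> 0"
  shows "cnj z = z"
  using eigenvectors_orthogonal[OF assms(1,1)] assms(2) by (metis cinner_self_eq_0_iff)

lemma not_eigenvalue_imp_bounded_below:
  assumes "\<And>u. (u, z *\<^sub>C u) \<in> T \<Longrightarrow> u = 0"
  shows "\<exists>C. \<forall>(u, g)\<in>T. norm u \<le> C * norm (g - z *\<^sub>C u)"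
proof (rule ccontr)
  assume "\<not> ?thesis"
  then have "\<forall>n::nat. \<exists>p\<in>T. real (Suc n) * norm (snd p - z *\<^sub>C fst p) < norm (fst p)"
    by (force simp: not_le split: prod.splits)
  then obtain P where P: "\<And>n. P n \<in> T" "\<And>n::nat. real (Suc n) * norm (snd (P n) - z *\<^sub>C fst (P n)) < norm (fst (P n))"
    by metis
  define a where "a n = complex_of_real (inverse (norm (fst (P n))))" for n
  have pos: "0 < norm (fst (P n))" for n
    by (rule le_less_trans[OF _ P(2)]) simp
  have "(a n *\<^sub>C fst (P n), a n *\<^sub>C snd (P n)) \<in> T" for n
    using P(1)[of n] by (intro graph_scale) simp
  moreover have "norm (a n *\<^sub>C fst (P n)) = 1" for n
    using pos[of n] by (simp add: norm_scaleC a_def norm_inverse)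
  moreover have "(\<lambda>n. a n *\<^sub>C snd (P n) - z *\<^sub>C a n *\<^sub>C fst (P n)) \<longlonglongrightarrow> 0"
  proof (rule Lim_null_comparison[OF always_eventually[OF allI] LIMSEQ_inverse_real_of_nat])
    fix n
    have "norm (a n *\<^sub>C snd (P n) - z *\<^sub>C a n *\<^sub>C fst (P n))
        = norm (a n *\<^sub>C (snd (P n) - z *\<^sub>C fst (P n)))"
      by (simp add: L2.scale_right_diff_distrib mult.commute)
    also have "\<dots> = inverse (norm (fst (P n))) * norm (snd (P n) - z *\<^sub>C fst (P n))"
      by (simp add: norm_scaleC a_def norm_inverse)
    also have "\<dots> \<le> inverse (real (Suc n))"
      using P(2)[of n] pos[of n] by (simp add: field_simps)
    finally show "norm (a n *\<^sub>C snd (P n) - z *\<^sub>C a n *\<^sub>C fst (P n)) \<le> inverse (real (Suc n))" .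
  qed
  ultimately obtain l where "norm l = 1" "(l, z *\<^sub>C l) \<in> T"
    using approximate_eigenvectors_converge[of "\<lambda>n. a n *\<^sub>C fst (P n)" "\<lambda>n. a n *\<^sub>C snd (P n)" z] by blast
  with assms show False
    by fastforce
qed

text \<open>The range of \<open>T - z\<close> is closed by the lower bound. A vector orthogonal to it is, through the
  selfadjoint inverse of \<open>T + c\<close>, an eigenvector for \<open>cnj z\<close>.\<close>

lemma not_eigenvalue_imp_onto:
  assumes noev: "\<And>u. (u, z *\<^sub>C u) \<in> T \<Longrightarrow> u = 0" and "f \<in> K"
  shows "\<exists>u. (u, f + z *\<^sub>C u) \<in> T"
proof -
  obtain C where C: "\<And>u g. (u, g) \<in> T \<Longrightarrow> norm u \<le> C * norm (g - z *\<^sub>C u)"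
    using not_eigenvalue_imp_bounded_below[OF noev] by blast
  define R where "R = {f. \<exists>u. (u, f + z *\<^sub>C u) \<in> T}"
  have "R \<subseteq> K"
  proof
    fix g assume "g \<in> R"
    then obtain u where "(u, g + z *\<^sub>C u) \<in> T"
      by (auto simp: R_def)
    then have "(g + z *\<^sub>C u) - z *\<^sub>C u \<in> K"
      using graph_mem K(1) by (intro L2.subspace_diff L2.subspace_scale) auto
    then show "g \<in> K"
      by simp
  qed
  have "L2.subspace R"
  proof (rule L2.subspaceI)
    show "0 \<in> R"
      using graph_zero by (auto simp: R_def intro: exI[of _ 0])
    fix x y b assume "x \<in> R"
    then obtain u where u: "(u, x + z *\<^sub>C u) \<in> T"
      by (auto simp: R_def)
    from graph_scale[OF u, of b] show "b *\<^sub>C x \<in> R"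
      unfolding R_def by (auto intro!: exI[of _ "b *\<^sub>C u"] simp: L2.scale_right_distrib mult.commute)
    assume "y \<in> R"
    then obtain v where v: "(v, y + z *\<^sub>C v) \<in> T"
      by (auto simp: R_def)
    from graph_add[OF u v] show "x + y \<in> R"
      unfolding R_def by (auto intro!: exI[of _ "u + v"] simp: L2.scale_right_distrib algebra_simps)
  qed
  moreover have "closed R"
    unfolding closed_sequential_limits
  proof (intro allI impI, elim conjE)
    fix F :: "nat \<Rightarrow> 'a L2" and g
    assume "\<forall>n. F n \<in> R" and F: "F \<longlonglongrightarrow> g"
    then obtain U where U: "\<And>n. (U n, F n + z *\<^sub>C U n) \<in> T"
      unfolding R_def by auto metis
    have diff: "norm (U m - U n) \<le> C * norm (F m - F n)" for m n
      using C[OF graph_diff[OF U U], of m n] by (simp add: L2.scale_right_diff_distrib algebra_simps)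
    have "Cauchy U"
    proof (rule CauchyI)
      fix e :: real assume "0 < e"
      then obtain N where N: "\<And>m n. N \<le> m \<Longrightarrow> N \<le> n \<Longrightarrow> norm (F m - F n) < e / (\<bar>C\<bar> + 1)"
        using CauchyD[OF LIMSEQ_imp_Cauchy[OF F], of "e / (\<bar>C\<bar> + 1)"] by auto
      have "norm (U m - U n) < e" if "N \<le> m" "N \<le> n" for m n
      proof -
        have "C * norm (F m - F n) \<le> \<bar>C\<bar> * norm (F m - F n)"
          by (intro mult_right_mono) auto
        also have "\<dots> \<le> (\<bar>C\<bar> + 1) * norm (F m - F n)"
          by (intro mult_right_mono) auto
        also have "\<dots> < (\<bar>C\<bar> + 1) * (e / (\<bar>C\<bar> + 1))"
          using N[OF that] by (intro mult_strict_left_mono) auto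
        finally show ?thesis
          using diff[of m n] by simp
      qed
      then show "\<exists>M. \<forall>m\<ge>M. \<forall>n\<ge>M. norm (U m - U n) < e"
        by blast
    qed
    then obtain u where u: "U \<longlonglongrightarrow> u"
      using Cauchy_convergent convergent_def by blast
    have "(u, g + z *\<^sub>C u) \<in> T"
      by (rule graph_closed[OF U u]) (intro tendsto_add F tendsto_scaleC u)
    then show "g \<in> R"
      by (auto simp: R_def)
  qed
  ultimately obtain p where p: "p \<in> R" "\<And>v. v \<in> R \<Longrightarrow> cinner (f - p) v = 0"
    using orthogonal_projection by metis
  define y where "y = f - p"
  have "y \<in> K"
    unfolding y_def using p \<open>R \<subseteq> K\<close> \<open>f \<in> K\<close> K(1) by (intro L2.subspace_diff) auto
  then obtain y' where y': "(y', y - cc *\<^sub>C y') \<in> T"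
    using onto by blast
  \<comment> \<open>Test \<open>y\<close> against \<open>(T - z) u = g - (c + z) u\<close>, where \<open>(T + c) u = g\<close>.\<close>
  have orth: "cinner g (y - cnj (cc + z) *\<^sub>C y') = 0" if g: "g \<in> K" for g
  proof -
    obtain u where u: "(u, g - cc *\<^sub>C u) \<in> T"
      using onto[OF g] by blast
    then have "g - (cc + z) *\<^sub>C u \<in> R"
      unfolding R_def by (auto intro!: exI[of _ u] simp: L2.scale_left_distrib algebra_simps)
    then have "cinner y (g - (cc + z) *\<^sub>C u) = 0"
      using p(2) by (simp add: y_def)
    then have "cinner (g - (cc + z) *\<^sub>C u) y = 0"
      by (subst cinner_commute) simp
    moreover have "cinner g y' = cinner u y"
      using symmetric[OF u y']
      by (simp add: cinner_minus_left cinner_minus_right cinner_scaleC_left cinner_scaleC_right)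
    ultimately show ?thesis
      by (simp add: cinner_minus_left cinner_minus_right cinner_scaleC_left cinner_scaleC_right)
  qed
  have "y' \<in> K"
    using graph_mem[OF y'] by simp
  then have "y - cnj (cc + z) *\<^sub>C y' \<in> K"
    using \<open>y \<in> K\<close> K(1) by (intro L2.subspace_diff L2.subspace_scale)
  from orth[OF this] have y: "y = cnj (cc + z) *\<^sub>C y'"
    by (simp add: cinner_self_eq_0_iff)
  then have ev: "(y', cnj z *\<^sub>C y') \<in> T"
    using y' by (simp add: L2.scale_left_distrib)
  have "y' = 0"
  proof (rule ccontr)
    assume "y' \<noteq> 0"
    then have "cnj z = z"
      using eigenvalue_real[OF ev] by simp
    with ev noev \<open>y' \<noteq> 0\<close> show False
      by simp
  qed
  then have "f = p"
    using y by (simp add: y_def)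
  with p(1) show ?thesis
    by (simp add: R_def)
qed

lemma spectrum_eigenvalue:
  assumes "z \<in> spectrum K T"
  shows "\<exists>u. (u, z *\<^sub>C u) \<in> T \<and> u \<noteq> 0"
proof (rule ccontr)
  assume "\<not> ?thesis"
  then have noev: "\<And>u. (u, z *\<^sub>C u) \<in> T \<Longrightarrow> u = 0"
    by blast
  have "\<exists>!u. (u, f + z *\<^sub>C u) \<in> T" if f: "f \<in> K" for f
  proof (rule ex_ex1I)
    show "\<exists>u. (u, f + z *\<^sub>C u) \<in> T"
      by (rule not_eigenvalue_imp_onto[OF noev f])
    fix u v assume "(u, f + z *\<^sub>C u) \<in> T" "(v, f + z *\<^sub>C v) \<in> T"
    from noev[of "u - v"] graph_diff[OF this] show "u = v"
      by (simp add: L2.scale_right_diff_distrib)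
  qed
  with not_eigenvalue_imp_bounded_below[OF noev] assms show False
    by (auto simp: spectrum_def resolvent_set_def)
qed

lemma spectrum_isolated:
  assumes "z \<in> spectrum K T"
  shows "z isolated_in spectrum K T"
proof -
  have "\<not> z islimpt spectrum K T"
  proof
    assume "z islimpt spectrum K T"
    then obtain x where x: "\<And>n::nat. x n \<in> spectrum K T - {z}" "x \<longlonglongrightarrow> z"
      unfolding islimpt_sequential by blast
    have "\<exists>u. (u, x n *\<^sub>C u) \<in> T \<and> norm u = 1" for n
    proof -
      obtain u where u: "(u, x n *\<^sub>C u) \<in> T" "u \<noteq> 0"
        using spectrum_eigenvalue x(1) by blast
      let ?a = "complex_of_real (inverse (norm u))"
      have "(?a *\<^sub>C u, x n *\<^sub>C ?a *\<^sub>C u) \<in> T"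
        using graph_scale[OF u(1), of ?a] by (simp add: mult.commute)
      moreover have "norm (?a *\<^sub>C u) = 1"
        using u(2) by (simp add: norm_scaleC norm_inverse)
      ultimately show ?thesis
        by blast
    qed
    then obtain U where U: "\<And>n. (U n, x n *\<^sub>C U n) \<in> T" "\<And>n. norm (U n) = 1"
      by metis
    have "(\<lambda>n. x n *\<^sub>C U n - z *\<^sub>C U n) \<longlonglongrightarrow> 0"
    proof (rule Lim_null_comparison[OF always_eventually[OF allI]])
      show "norm (x n *\<^sub>C U n - z *\<^sub>C U n) \<le> cmod (x n - z)" for n
        by (simp add: norm_scaleC U(2) flip: L2.scale_left_diff_distrib)
      show "(\<lambda>n. cmod (x n - z)) \<longlonglongrightarrow> 0"
        using x(2) by (intro tendsto_norm_zero LIM_zero)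
    qed
    then obtain r l where l: "(\<lambda>n. U (r n)) \<longlonglongrightarrow> l" "norm l = 1" "(l, z *\<^sub>C l) \<in> T"
      using approximate_eigenvectors_converge[where U = U and G = "\<lambda>n. x n *\<^sub>C U n" and z = z, OF U] by blast
    have "cnj z = z"
      using eigenvalue_real[OF l(3)] l(2) by (metis norm_zero zero_neq_one)
    then have "cinner (U n) l = 0" for n
      using eigenvectors_orthogonal[OF U(1) l(3), of n] x(1)[of n] by auto
    then have "cinner l l = 0"
      using tendsto_cinner_left[OF l(1), of l] by (simp add: LIMSEQ_const_iff)
    then show False
      using l(2) by (simp add: cinner_self_eq_0_iff)
  qed
  with assms show ?thesis
    by (simp add: isolated_in_islimpt_iff)
qed

text \<open>At a level above \<open>Re z\<close>, an eigenvector is determined by its components along the finitely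
  many exceptional directions.\<close>

lemma eigenspace_finite_dim: "\<exists>F. finite F \<and> eigenspace T z \<subseteq> L2.span F"
proof -
  obtain B C where B: "finite B"
    "\<And>u g. (u, g) \<in> T \<Longrightarrow> (Re z + 1) * (norm u)\<^sup>2 \<le> Re (cinner g u) + C * (\<Sum>w\<in>B. (cmod (cinner u w))\<^sup>2)"
    using finite_below[of "Re z + 1"] by blast
  show ?thesis
  proof (rule L2_subspace_finite_separation_imp_finite_dim[OF B(1)])
    show "L2.subspace (eigenspace T z)"
      unfolding eigenspace_def
    proof (rule L2.subspaceI; (simp only: mem_Collect_eq)?)
      show "(0, z *\<^sub>C 0) \<in> T"
        using graph_zero by simp
      show "(x + y, z *\<^sub>C (x + y)) \<in> T" if "(x, z *\<^sub>C x) \<in> T" "(y, z *\<^sub>C y) \<in> T" for x y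
        using graph_add[OF that] by (simp add: L2.scale_right_distrib)
      show "(b *\<^sub>C x, z *\<^sub>C b *\<^sub>C x) \<in> T" if "(x, z *\<^sub>C x) \<in> T" for x b
        using graph_scale[OF that, of b] by (simp add: mult.commute)
    qed
    fix u assume "u \<in> eigenspace T z" "\<And>w. w \<in> B \<Longrightarrow> cinner u w = 0"
    then have "(Re z + 1) * (norm u)\<^sup>2 \<le> Re z * (norm u)\<^sup>2"
      using B(2)[of u "z *\<^sub>C u"] by (simp add: eigenspace_def cinner_scaleC_left cinner_self_norm)
    then show "u = 0"
      by (simp add: algebra_simps)
  qed
qed

theorem essential_spectrum_empty: "essential_spectrum K T = {}"
proof -
  have "z \<in> discrete_spectrum K T" if "z \<in> spectrum K T" for z
    unfolding discrete_spectrum_def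
    using spectrum_isolated[OF that] spectrum_eigenvalue[OF that] eigenspace_finite_dim[of z]
    by (auto simp: eigenspace_def)
  then show ?thesis
    by (auto simp: essential_spectrum_def)
qed

end


section \<open>Smooth functions\<close>

text \<open>Membership in a class of differentiable functions that is closed under partial derivatives
  is all that smoothness requires.\<close>

lemma Ck_coinduct:
  assumes "S f"
    and "\<And>f. S f \<Longrightarrow> f differentiable_on UNIV"
    and "\<And>f i. S f \<Longrightarrow> i \<in> Basis \<Longrightarrow> S (\<lambda>x. frechet_derivative f (at x) i)"
  shows "Ck k f"
  using assms(1)
proof (induction k arbitrary: f)
  case 0
  then show ?case
    using assms(2) by (simp add: differentiable_imp_continuous_on)
next
  case (Suc k)
  then show ?case
    using assms(2,3) by simp
qed

text \<open>The functions \<open>p(1/t) exp(-1/t)\<close>, extended by zero to \<open>t \<le> 0\<close>; this class is closed under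
  differentiation.\<close>

definition flat :: "real poly \<Rightarrow> real \<Rightarrow> real" where
  "flat p t = (if 0 < t then poly p (1 / t) * exp (- (1 / t)) else 0)"

lemma flat_tendsto_0: "(flat p \<longlongrightarrow> 0) (at 0)"
proof -
  have "((\<lambda>s::real. \<Sum>i\<le>degree p. coeff p i * (s ^ i / exp s)) \<longlongrightarrow> (\<Sum>i\<le>degree p. coeff p i * 0)) at_top"
    by (intro tendsto_intros tendsto_power_div_exp_0)
  then have "((\<lambda>s::real. poly p s * exp (- s)) \<longlongrightarrow> 0) at_top"
    by (simp add: poly_altdef exp_minus divide_inverse sum_distrib_right mult.assoc)
  then have "((\<lambda>t. poly p (inverse t) * exp (- inverse t)) \<longlongrightarrow> 0) (at_right 0)"
    by (rule filterlim_compose[OF _ filterlim_inverse_at_top_right])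
  then have "(flat p \<longlongrightarrow> 0) (at_right 0)"
    by (rule Lim_transform_eventually)
      (auto simp: flat_def inverse_eq_divide eventually_at_right_less intro: eventually_at_rightI[of 0 1])
  moreover have "(flat p \<longlongrightarrow> 0) (at_left 0)"
    by (rule Lim_transform_eventually[OF tendsto_const])
      (auto simp: flat_def eventually_at_left_field intro: exI[of _ "-1"])
  ultimately show ?thesis
    by (simp add: filterlim_at_split)
qed

text \<open>For \<open>t > 0\<close> and \<open>s = 1/t\<close> the derivative is \<open>s\<^sup>2 (p(s) - p'(s)) exp(-s)\<close>. The difference quotient
  at \<open>0\<close> is again a flat function, for the polynomial \<open>s p(s)\<close>.\<close>

lemma flat_has_derivative:
  "(flat p has_real_derivative flat ([:0, 0, 1:] * (p - pderiv p)) t) (at t)"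
proof (cases t "0::real" rule: linorder_cases)
  case less
  then have "((\<lambda>_. 0) has_real_derivative flat ([:0, 0, 1:] * (p - pderiv p)) t) (at t)"
    by (simp add: flat_def)
  then show ?thesis
    by (rule has_field_derivative_transform_within_open[where S = "{..<0}"])
      (use less in \<open>auto simp: flat_def\<close>)
next
  case equal
  have "((\<lambda>h. (flat p (0 + h) - flat p 0) / h) \<longlongrightarrow> 0) (at 0)"
    by (rule Lim_transform_eventually[OF flat_tendsto_0[of "pCons 0 p"]])
      (auto simp: flat_def)
  then show ?thesis
    using equal by (simp add: DERIV_def flat_def)
next
  case greater
  have "((\<lambda>t. poly p (1 / t) * exp (- (1 / t)))
      has_real_derivative flat ([:0, 0, 1:] * (p - pderiv p)) t) (at t)"
    using greater
    by (auto intro!: derivative_eq_intros poly_DERIV[THEN DERIV_chain2]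
        simp: flat_def power2_eq_square field_simps)
  then show ?thesis
    by (rule has_field_derivative_transform_within_open[where S = "{0<..}"])
      (use greater in \<open>auto simp: flat_def\<close>)
qed

text \<open>The algebra generated by the flat functions of affine coordinates: it contains bump functions
  and is closed under partial derivatives.\<close>

inductive flat_algebra :: "('a::euclidean_space \<Rightarrow> complex) \<Rightarrow> bool" where
  const: "flat_algebra (\<lambda>x. c)"
| flat: "flat_algebra (\<lambda>x. complex_of_real (flat p (a * (x \<bullet> b) + c)))"
| add: "flat_algebra f \<Longrightarrow> flat_algebra g \<Longrightarrow> flat_algebra (\<lambda>x. f x + g x)"
| mult: "flat_algebra f \<Longrightarrow> flat_algebra g \<Longrightarrow> flat_algebra (\<lambda>x. f x * g x)"

lemma flat_algebra_derivative:
  assumes "flat_algebra f"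
  shows "\<exists>f'. (\<forall>x. (f has_derivative f' x) (at x)) \<and> (\<forall>i. flat_algebra (\<lambda>x. f' x i))"
  using assms
proof induction
  case (const c)
  show ?case
    by (intro exI[of _ "\<lambda>x h. 0"]) (auto intro: flat_algebra.const)
next
  case (flat p a b c)
  let ?q = "[:0, 0, 1:] * (p - pderiv p)"
  have "((\<lambda>x. complex_of_real (flat p (a * (x \<bullet> b) + c))) has_derivative
      (\<lambda>h. complex_of_real (flat ?q (a * (x \<bullet> b) + c)) * complex_of_real (a * (h \<bullet> b)))) (at x)" for x
  proof -
    have "((\<lambda>x. a * (x \<bullet> b) + c) has_derivative (\<lambda>h. a * (h \<bullet> b))) (at x)"
      by (auto intro!: derivative_eq_intros)
    from has_derivative_compose[OF this flat_has_derivative[of p, unfolded has_field_derivative_def]]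
    have "((\<lambda>x. flat p (a * (x \<bullet> b) + c)) has_derivative
        (\<lambda>h. flat ?q (a * (x \<bullet> b) + c) * (a * (h \<bullet> b)))) (at x)" .
    from has_derivative_of_real[OF this] show ?thesis
      by simp
  qed
  moreover have "flat_algebra (\<lambda>x. complex_of_real (flat ?q (a * (x \<bullet> b) + c)) * complex_of_real (a * (i \<bullet> b)))" for i
    by (intro flat_algebra.intros)
  ultimately show ?case
    by (intro exI[of _ "\<lambda>x h. complex_of_real (flat ?q (a * (x \<bullet> b) + c)) * complex_of_real (a * (h \<bullet> b))"]) blast
next
  case (add f g)
  then obtain f' g' where "\<And>x. (f has_derivative f' x) (at x)" "\<And>i. flat_algebra (\<lambda>x. f' x i)"
    "\<And>x. (g has_derivative g' x) (at x)" "\<And>i. flat_algebra (\<lambda>x. g' x i)"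
    by blast
  then show ?case
    by (intro exI[of _ "\<lambda>x h. f' x h + g' x h"] conjI allI has_derivative_add flat_algebra.add) auto
next
  case (mult f g)
  then obtain f' g' where "\<And>x. (f has_derivative f' x) (at x)" "\<And>i. flat_algebra (\<lambda>x. f' x i)"
    "\<And>x. (g has_derivative g' x) (at x)" "\<And>i. flat_algebra (\<lambda>x. g' x i)"
    by blast
  with mult show ?case
    by (intro exI[of _ "\<lambda>x h. f x * g' x h + f' x h * g x"] conjI allI has_derivative_mult
        flat_algebra.intros) auto
qed

lemma flat_algebra_Ck:
  assumes "flat_algebra f"
  shows "Ck k f"
proof (rule Ck_coinduct[where S = flat_algebra])
  fix f :: "'a \<Rightarrow> complex" assume "flat_algebra f"
  then obtain f' where f': "\<And>x. (f has_derivative f' x) (at x)" "\<And>i. flat_algebra (\<lambda>x. f' x i)"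
    using flat_algebra_derivative by blast
  then show "f differentiable_on UNIV"
    unfolding differentiable_on_def differentiable_def by blast
  have "frechet_derivative f (at x) = f' x" for x
    using frechet_derivative_at[OF f'(1)] by simp
  then show "flat_algebra (\<lambda>x. frechet_derivative f (at x) i)" for i
    using f'(2) by simp
qed fact

lemma flat_algebra_prod:
  assumes "finite I" "\<And>i. i \<in> I \<Longrightarrow> flat_algebra (f i)"
  shows "flat_algebra (\<lambda>x. \<Prod>i\<in>I. f i x)"
  using assms by (induction I) (auto intro: flat_algebra.const flat_algebra.mult)

section \<open>Test functions\<close>

text \<open>Since \<open>exp(-1/t)\<close> increases from \<open>0\<close> to \<open>1\<close>, these functions increase to the indicator of
  the box as \<open>n\<close> grows.\<close>

definition box_bump :: "'a::euclidean_space \<Rightarrow> 'a \<Rightarrow> nat \<Rightarrow> 'a \<Rightarrow> complex" where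
  "box_bump a b n x = (\<Prod>i\<in>Basis. complex_of_real (flat 1 (real n * (x \<bullet> i) + - (real n * (a \<bullet> i))))
     * complex_of_real (flat 1 (- real n * (x \<bullet> i) + real n * (b \<bullet> i))))"

lemma flat_1_bounds: "0 \<le> flat 1 t" "flat 1 t \<le> 1"
  by (auto simp: flat_def)

lemma flat_1_tendsto:
  assumes "0 < t"
  shows "(\<lambda>n. flat 1 (real n * t)) \<longlonglongrightarrow> 1"
proof -
  have "(\<lambda>n. exp (- (inverse t * inverse (real n)))) \<longlonglongrightarrow> exp (- (inverse t * 0))"
    by (intro tendsto_intros lim_inverse_n)
  then have "(\<lambda>n. exp (- (inverse t * inverse (real n)))) \<longlonglongrightarrow> 1"
    by simp
  then show ?thesis
    by (rule Lim_transform_eventually)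
      (use assms in \<open>auto simp: flat_def field_simps intro!: eventually_sequentiallyI[of 1]\<close>)
qed

lemma box_bump_outside:
  assumes "x \<notin> box a b"
  shows "box_bump a b n x = 0"
proof -
  obtain i where "i \<in> Basis" "x \<bullet> i \<le> a \<bullet> i \<or> b \<bullet> i \<le> x \<bullet> i"
    using assms by (auto simp: mem_box not_less)
  then have "real n * (x \<bullet> i) + - (real n * (a \<bullet> i)) \<le> 0 \<or> - real n * (x \<bullet> i) + real n * (b \<bullet> i) \<le> 0"
    by (auto simp: mult_left_mono)
  then show ?thesis
    unfolding box_bump_def
    by (intro prod_zero bexI[of _ i]) (auto simp: flat_def \<open>i \<in> Basis\<close>)
qed

lemma norm_box_bump_le: "cmod (box_bump a b n x) \<le> indicator (box a b) x"
proof (cases "x \<in> box a b")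
  case True
  have "cmod (box_bump a b n x) \<le> (\<Prod>i\<in>(Basis :: 'a set). 1)"
    unfolding box_bump_def prod_norm[symmetric] norm_mult
    by (intro prod_mono) (auto simp: flat_1_bounds intro!: mult_le_one)
  with True show ?thesis
    by simp
qed (simp add: box_bump_outside)

lemma box_bump_tendsto: "(\<lambda>n. box_bump a b n x) \<longlonglongrightarrow> indicator (box a b) x"
proof (cases "x \<in> box a b")
  case True
  have "(\<lambda>n. box_bump a b n x) \<longlonglongrightarrow> (\<Prod>i\<in>(Basis :: 'a set). complex_of_real 1 * complex_of_real 1)"
    unfolding box_bump_def
  proof (intro tendsto_prod tendsto_mult tendsto_of_real)
    fix i :: 'a assume "i \<in> Basis"
    then have "0 < x \<bullet> i - a \<bullet> i" "0 < b \<bullet> i - x \<bullet> i"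
      using True by (auto simp: mem_box)
    from this[THEN flat_1_tendsto]
    show "(\<lambda>n. flat 1 (real n * (x \<bullet> i) + - (real n * (a \<bullet> i)))) \<longlonglongrightarrow> 1"
      "(\<lambda>n. flat 1 (- real n * (x \<bullet> i) + real n * (b \<bullet> i))) \<longlonglongrightarrow> 1"
      by (simp_all add: algebra_simps)
  qed
  with True show ?thesis
    by simp
qed (simp add: box_bump_outside)

lemma test_function_box_bump: "test_function (box_bump a b n)"
  unfolding test_function_def
proof (intro conjI allI)
  show "Ck k (box_bump a b n)" for k
    unfolding box_bump_def[abs_def]
    by (intro flat_algebra_Ck flat_algebra_prod flat_algebra.mult flat_algebra.flat) simp
  have "{x. box_bump a b n x \<noteq> 0} \<subseteq> cbox a b"
    using box_bump_outside[of _ a b n] box_subset_cbox by blast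
  then have "bounded {x. box_bump a b n x \<noteq> 0}"
    by (rule bounded_subset[OF bounded_cbox])
  then show "compact (closure {x. box_bump a b n x \<noteq> 0})"
    by simp
qed

lemma Ck_Suc_has_derivative:
  "Ck (Suc k) f \<Longrightarrow> (f has_derivative frechet_derivative f (at x)) (at x)"
  by (simp add: differentiable_on_def frechet_derivative_works[symmetric])

lemma Ck_SucI:
  assumes "\<And>x. (f has_derivative f' x) (at x)" "\<And>i. i \<in> Basis \<Longrightarrow> Ck k (\<lambda>x. f' x i)"
  shows "Ck (Suc k) f"
  using assms frechet_derivative_at[OF assms(1)]
  by (auto simp: differentiable_on_def intro: differentiableI)

lemma Ck_add: "Ck k f \<Longrightarrow> Ck k g \<Longrightarrow> Ck k (\<lambda>x. f x + g x)"
proof (induction k arbitrary: f g)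
  case (Suc k)
  show ?case
    by (rule Ck_SucI[OF has_derivative_add[OF Suc.prems[THEN Ck_Suc_has_derivative]]])
      (use Suc in simp)
qed (simp add: continuous_on_add)

lemma Ck_cmult: "Ck k f \<Longrightarrow> Ck k (\<lambda>x. c * f x)"
proof (induction k arbitrary: f)
  case (Suc k)
  show ?case
    by (rule Ck_SucI[OF has_derivative_mult_right[OF Suc.prems[THEN Ck_Suc_has_derivative]]])
      (use Suc in simp)
qed (simp add: continuous_on_mult_left)

lemma Ck_shift: "Ck k f \<Longrightarrow> Ck k (\<lambda>x. f (x + a))"
proof (induction k arbitrary: f)
  case (Suc k)
  have "((\<lambda>x. f (x + a)) has_derivative frechet_derivative f (at (x + a))) (at x)" for x
  proof (rule has_derivative_compose[where g = f and f = "\<lambda>x. x + a"])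
    show "((\<lambda>x. x + a) has_derivative (\<lambda>h. h)) (at x)"
      by (auto intro!: derivative_eq_intros)
    show "(f has_derivative frechet_derivative f (at (x + a))) (at (x + a))"
      by (rule Ck_Suc_has_derivative[OF Suc.prems])
  qed
  then show ?case
  proof (rule Ck_SucI)
    show "Ck k (\<lambda>x. frechet_derivative f (at (x + a)) i)" if "i \<in> Basis" for i
      using Suc.IH[of "\<lambda>x. frechet_derivative f (at x) i"] Suc.prems that by simp
  qed
next
  case 0
  then have "continuous_on UNIV f"
    by simp
  then have "continuous_on UNIV (\<lambda>x. f (x + a))"
    by (rule continuous_on_compose2) (auto intro!: continuous_intros)
  then show ?case
    by simp
qed

lemma frechet_derivative_basis_expansion:
  fixes f :: "'a::euclidean_space \<Rightarrow> 'b::real_normed_vector"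
  assumes "f differentiable at x"
  shows "frechet_derivative f (at x) i = (\<Sum>b\<in>Basis. (i \<bullet> b) *\<^sub>R frechet_derivative f (at x) b)"
proof -
  interpret linear "frechet_derivative f (at x)"
    by (rule linear_frechet_derivative[OF assms])
  have "frechet_derivative f (at x) (\<Sum>b\<in>Basis. (i \<bullet> b) *\<^sub>R b)
      = (\<Sum>b\<in>Basis. (i \<bullet> b) *\<^sub>R frechet_derivative f (at x) b)"
    by (simp add: sum scale)
  then show ?thesis
    by (simp add: euclidean_representation)
qed

lemma test_functionD:
  assumes "test_function \<phi>"
  shows "bounded {x. \<phi> x \<noteq> 0}" "continuous_on UNIV \<phi>" "\<phi> differentiable at x"
    and "continuous_on UNIV (\<lambda>x. frechet_derivative \<phi> (at x) i)"
proof -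
  have C: "Ck k \<phi>" for k
    using assms by (simp add: test_function_def)
  show "bounded {x. \<phi> x \<noteq> 0}"
    using assms compact_imp_bounded bounded_subset closure_subset unfolding test_function_def by metis
  show "continuous_on UNIV \<phi>"
    using C[of 0] by simp
  show d: "\<phi> differentiable at x" for x
    using C[of "Suc 0"] by (simp add: differentiable_on_def)
  have "frechet_derivative \<phi> (at x) i = (\<Sum>b\<in>Basis. (i \<bullet> b) *\<^sub>R frechet_derivative \<phi> (at x) b)" for x
    by (rule frechet_derivative_basis_expansion[OF d])
  moreover have "continuous_on UNIV (\<lambda>x. \<Sum>b\<in>Basis. (i \<bullet> b) *\<^sub>R frechet_derivative \<phi> (at x) b)"
    using C[of "Suc 0"] by (intro continuous_intros) simp
  ultimately show "continuous_on UNIV (\<lambda>x. frechet_derivative \<phi> (at x) i)"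
    by simp
qed

lemma test_function_add:
  assumes "test_function \<phi>" "test_function \<psi>"
  shows "test_function (\<lambda>x. \<phi> x + \<psi> x)"
proof -
  have "bounded ({x. \<phi> x \<noteq> 0} \<union> {x. \<psi> x \<noteq> 0})"
    by (simp add: test_functionD(1)[OF assms(1)] test_functionD(1)[OF assms(2)])
  then have "bounded {x. \<phi> x + \<psi> x \<noteq> 0}"
    by (rule bounded_subset) auto
  with assms show ?thesis
    by (simp add: test_function_def Ck_add)
qed

lemma test_function_cmult:
  assumes "test_function \<phi>"
  shows "test_function (\<lambda>x. c * \<phi> x)"
proof -
  have "bounded {x. c * \<phi> x \<noteq> 0}"
    by (rule bounded_subset[OF test_functionD(1)[OF assms]]) auto
  with assms show ?thesis
    by (simp add: test_function_def Ck_cmult)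
qed

lemma test_function_shift:
  assumes "test_function \<phi>"
  shows "test_function (\<lambda>x. \<phi> (x + a))"
proof -
  have "{x. \<phi> (x + a) \<noteq> 0} = (\<lambda>x. x - a) ` {x. \<phi> x \<noteq> 0}"
    by (auto simp: image_iff intro: exI[of _ "_ + a"]) (metis add_diff_cancel)
  then have "bounded {x. \<phi> (x + a) \<noteq> 0}"
    using bounded_translation_minus[OF test_functionD(1)[OF assms]] by simp
  with assms show ?thesis
    by (simp add: test_function_def Ck_shift)
qed

lemma continuous_bounded_support_bounds:
  fixes f :: "'a::euclidean_space \<Rightarrow> complex"
  assumes "continuous_on UNIV f" "bounded {x. f x \<noteq> 0}"
  shows "\<exists>a B. 0 \<le> B \<and> (\<forall>x. cmod (f x) \<le> B * indicator (cbox (-a) a) x)"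
proof -
  obtain a where a: "{x. f x \<noteq> 0} \<subseteq> cbox (-a) a"
    using bounded_subset_cbox_symmetric[OF assms(2)] by blast
  have "compact (f ` cbox (-a) a)"
    using assms(1) by (intro compact_continuous_image) (auto intro: continuous_on_subset)
  then obtain B where "0 < B" "\<And>x. x \<in> cbox (-a) a \<Longrightarrow> cmod (f x) \<le> B"
    using compact_imp_bounded bounded_pos by (metis imageI)
  with a show ?thesis
    by (intro exI[of _ a] exI[of _ B]) (auto simp: indicator_def)
qed

lemma square_integrable_continuous_bounded_support:
  assumes "continuous_on UNIV f" "bounded {x. f x \<noteq> 0}"
  shows "square_integrable f"
proof -
  obtain a B where B: "0 \<le> B" "\<And>x. cmod (f x) \<le> B * indicator (cbox (-a) a) x"
    using continuous_bounded_support_bounds[OF assms] by blast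
  have "f \<in> borel_measurable lborel"
    using borel_measurable_continuous_onI[OF assms(1)] by simp
  then have m[measurable]: "f \<in> borel_measurable lebesgue"
    by (rule measurable_completion)
  have "integrable lebesgue (\<lambda>x. (cmod (f x))\<^sup>2)"
  proof (rule Bochner_Integration.integrable_bound)
    show "integrable lebesgue (\<lambda>x. B\<^sup>2 * indicator (cbox (-a) a) x :: real)"
      by (intro integrable_mult_right) (auto simp: emeasure_lborel_cbox_eq)
    have "(cmod (f x))\<^sup>2 \<le> B\<^sup>2 * indicator (cbox (-a) a) x" for x
      using power_mono[OF B(2)[of x], of 2] by (auto simp: indicator_def power_mult_distrib split: if_splits)
    then show "AE x in lebesgue. norm ((cmod (f x))\<^sup>2) \<le> norm (B\<^sup>2 * indicator (cbox (-a) a) x :: real)"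
      by simp
  qed measurable
  with m show ?thesis
    by (simp add: square_integrable_def)
qed

lemma test_function_derivative_support:
  "{x. frechet_derivative \<phi> (at x) i \<noteq> 0} \<subseteq> closure {x. \<phi> x \<noteq> 0}"
proof
  fix x assume x: "x \<in> {x. frechet_derivative \<phi> (at x) i \<noteq> 0}"
  show "x \<in> closure {x. \<phi> x \<noteq> 0}"
  proof (rule ccontr)
    assume "x \<notin> closure {x. \<phi> x \<noteq> 0}"
    then have "((\<lambda>_. 0) has_derivative (\<lambda>_. 0)) (at x)" "x \<in> - closure {x. \<phi> x \<noteq> 0}"
      by auto
    then have d: "(\<phi> has_derivative (\<lambda>_. 0)) (at x)"
      by (rule has_derivative_transform_within_open[OF _ open_Compl[OF closed_closure]])
        (use closure_subset[of "{x. \<phi> x \<noteq> 0}"] in auto)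
    then show False
      using x frechet_derivative_at[OF d, symmetric] by simp
  qed
qed

lemma test_function_square_integrable:
  assumes "test_function \<phi>"
  shows "square_integrable \<phi>" "square_integrable (\<lambda>x. frechet_derivative \<phi> (at x) i)"
proof -
  show "square_integrable \<phi>"
    by (intro square_integrable_continuous_bounded_support test_functionD assms)
  have "bounded (closure {x. \<phi> x \<noteq> 0})"
    using assms by (simp add: test_function_def compact_imp_bounded)
  then show "square_integrable (\<lambda>x. frechet_derivative \<phi> (at x) i)"
    by (intro square_integrable_continuous_bounded_support[OF test_functionD(4)[OF assms]]
        bounded_subset[OF _ test_function_derivative_support])
qed

section \<open>The fundamental lemma of the calculus of variations\<close>

lemma L2_borel_representative:
  obtains f where "f \<in> borel_measurable borel" "AE x in lebesgue. rep_L2 u x = f x"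
proof -
  have "(\<lambda>x. Re (rep_L2 u x)) \<in> borel_measurable lebesgue" "(\<lambda>x. Im (rep_L2 u x)) \<in> borel_measurable lebesgue"
    by measurable
  from this[THEN completion_ex_borel_measurable_real]
  obtain p q where m: "p \<in> borel_measurable borel" "q \<in> borel_measurable borel"
    and "AE x in lborel. Re (rep_L2 u x) = p x" "AE x in lborel. Im (rep_L2 u x) = q x"
    by auto
  then have "AE x in lebesgue. Re (rep_L2 u x) = p x" "AE x in lebesgue. Im (rep_L2 u x) = q x"
    by (auto intro: AE_completion)
  then have "AE x in lebesgue. rep_L2 u x = Complex (p x) (q x)"
    by eventually_elim (simp add: complex_eq_iff)
  moreover have "(\<lambda>x. Complex (p x) (q x)) = (\<lambda>x. complex_of_real (p x) + \<i> * complex_of_real (q x))"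
    by (simp add: fun_eq_iff complex_eq_iff)
  then have "(\<lambda>x. Complex (p x) (q x)) \<in> borel_measurable borel"
    using m by simp
  ultimately show ?thesis
    using that by blast
qed

text \<open>The boxes form an intersection stable generator of the Borel sets.\<close>

lemma integral_boxes_zero_imp_AE_zero:
  fixes f :: "'a::euclidean_space \<Rightarrow> complex"
  assumes f: "integrable lborel f" and "integral\<^sup>L lborel f = 0"
    and box: "\<And>a b. set_lebesgue_integral lborel (box a b) f = 0"
  shows "AE x in lborel. f x = 0"
proof (rule sigma_finite_measure.density_zero[OF sigma_finite_lborel f])
  fix A :: "'a set" assume "A \<in> sets lborel"
  then have A: "A \<in> sigma_sets UNIV (range (\<lambda>(a, b). box a b))"
    by (simp add: borel_eq_box)
  have "Int_stable (range (\<lambda>(a, b). box a b :: 'a set))"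
    by (auto simp: Int_stable_def box_Int_box)
  moreover have "range (\<lambda>(a, b). box a b :: 'a set) \<subseteq> Pow UNIV"
    by simp
  moreover note A
  ultimately show "set_lebesgue_integral lborel A f = 0"
  proof (induction rule: sigma_sets_induct_disjoint)
    case (basic A)
    then show ?case
      using box by auto
  next
    case (compl A)
    then have [measurable]: "A \<in> sets borel"
      by (simp add: borel_eq_box)
    have "integral\<^sup>L lborel f = set_lebesgue_integral lborel A f + set_lebesgue_integral lborel (UNIV - A) f"
      using f by (subst set_integral_Un[symmetric])
        (auto simp: set_integrable_def integrable_mult_indicator set_lebesgue_integral_def)
    with compl assms(2) show ?case
      by simp
  next
    case (union A)
    then have [measurable]: "A i \<in> sets borel" for i
      by (auto simp: borel_eq_box)
    have "set_lebesgue_integral lborel (\<Union>i. A i) f = (\<Sum>i. set_lebesgue_integral lborel (A i) f)"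
      using union f
      by (intro lebesgue_integral_countable_add)
        (auto simp: set_integrable_def integrable_mult_indicator disjoint_family_on_def)
    with union show ?case
      by simp
  qed (auto simp: set_lebesgue_integral_def)
qed

text \<open>Test against \<open>box_bump\<close>, whose limits are the indicators of boxes.\<close>

theorem fundamental_lemma_L2:
  fixes u :: "'a::euclidean_space L2"
  assumes u: "\<And>\<phi>. test_function \<phi> \<Longrightarrow> (LINT x|lebesgue. rep_L2 u x * \<phi> x) = 0"
  shows "u = 0"
proof -
  obtain f where m[measurable]: "f \<in> borel_measurable borel" and f: "AE x in lebesgue. rep_L2 u x = f x"
    by (rule L2_borel_representative)
  have int: "integrable lborel (\<lambda>x. norm (f x) * indicator (cbox a b) x :: real)" for a b
  proof -
    have "integrable lebesgue (\<lambda>x. (cmod (rep_L2 u x))\<^sup>2)"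
      by (intro square_integrableD square_integrable_rep_L2)
    moreover have "integrable lebesgue (\<lambda>x. (cmod (rep_L2 u x))\<^sup>2) = integrable lebesgue (\<lambda>x. (cmod (f x))\<^sup>2)"
    proof (rule integrable_cong_AE)
      show "(\<lambda>x. (cmod (f x))\<^sup>2) \<in> borel_measurable lebesgue"
        by (rule measurable_completion) simp
    qed (use f in \<open>measurable; eventually_elim; simp\<close>)+
    ultimately have "integrable lborel (\<lambda>x. (cmod (f x))\<^sup>2)"
      by (simp add: integrable_completion)
    then have "integrable lborel (\<lambda>x. (cmod (f x))\<^sup>2 + indicator (cbox a b) x :: real)"
      by (intro Bochner_Integration.integrable_add) (auto simp: emeasure_lborel_cbox_eq)
    then show ?thesis
    proof (rule Bochner_Integration.integrable_bound)
      have "t \<le> t\<^sup>2 + 1" for t :: real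
        using zero_le_power2[of "t - 1/2"] by (simp add: power2_eq_square algebra_simps)
      then show "AE x in lborel. norm (norm (f x) * indicator (cbox a b) x :: real)
          \<le> norm ((cmod (f x))\<^sup>2 + indicator (cbox a b) x :: real)"
        by (auto simp: indicator_def)
    qed measurable
  qed
  have int': "integrable lborel (\<lambda>x. indicator (box a b) x *\<^sub>R f x)" for a b
    by (rule Bochner_Integration.integrable_bound[OF int[of a b]])
      (use box_subset_cbox[of a b] in \<open>auto simp: indicator_def\<close>)
  have box: "integral\<^sup>L lborel (\<lambda>x. indicator (box a b) x *\<^sub>R f x) = 0" for a b
  proof -
    have "(\<lambda>n. integral\<^sup>L lborel (\<lambda>x. f x * box_bump a b n x)) \<longlonglongrightarrow> integral\<^sup>L lborel (\<lambda>x. f x * indicator (box a b) x)"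
    proof (rule integral_dominated_convergence[OF _ _ int[of a b]])
      show "AE x in lborel. (\<lambda>n. f x * box_bump a b n x) \<longlonglongrightarrow> f x * indicator (box a b) x"
        by (intro always_eventually allI tendsto_mult tendsto_const box_bump_tendsto)
      have [measurable]: "box_bump a b n \<in> borel_measurable borel" for n
        by (intro borel_measurable_continuous_onI test_functionD test_function_box_bump)
      show "(\<lambda>x. f x * box_bump a b n x) \<in> borel_measurable lborel" for n
        by measurable
      have "norm (box_bump a b n x) \<le> indicator (cbox a b) x" for n x
        using norm_box_bump_le[of a b n x] box_subset_cbox[of a b]
        by (cases "x \<in> box a b") (auto simp: box_bump_outside)
      then show "AE x in lborel. norm (f x * box_bump a b n x) \<le> norm (f x) * indicator (cbox a b) x" for n
        by (intro always_eventually allI) (simp add: norm_mult mult_left_mono)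
    qed measurable
    moreover have "integral\<^sup>L lborel (\<lambda>x. f x * box_bump a b n x) = 0" for n
    proof -
      have [measurable]: "box_bump a b n \<in> borel_measurable borel"
        by (intro borel_measurable_continuous_onI test_functionD test_function_box_bump)
      have "integral\<^sup>L lborel (\<lambda>x. f x * box_bump a b n x) = (LINT x|lebesgue. f x * box_bump a b n x)"
        by (rule integral_completion[symmetric]) measurable
      also have "\<dots> = (LINT x|lebesgue. rep_L2 u x * box_bump a b n x)"
      proof (rule integral_cong_AE)
        show "(\<lambda>x. f x * box_bump a b n x) \<in> borel_measurable lebesgue"
          by (rule measurable_completion) measurable
        have "box_bump a b n \<in> borel_measurable lebesgue"
          by (rule measurable_completion) measurable
        then show "(\<lambda>x. rep_L2 u x * box_bump a b n x) \<in> borel_measurable lebesgue"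
          by measurable
        show "AE x in lebesgue. f x * box_bump a b n x = rep_L2 u x * box_bump a b n x"
          using f by eventually_elim simp
      qed
      also have "\<dots> = 0"
        by (rule u[OF test_function_box_bump])
      finally show ?thesis .
    qed
    ultimately have "integral\<^sup>L lborel (\<lambda>x. f x * indicator (box a b) x) = 0"
      by (simp add: LIMSEQ_const_iff)
    moreover have "(\<lambda>x. indicator (box a b) x *\<^sub>R f x) = (\<lambda>x. f x * indicator (box a b) x)"
      by (auto simp: fun_eq_iff indicator_def)
    ultimately show ?thesis
      by simp
  qed
  have "AE x in lborel. indicator (box (- (real n *\<^sub>R One)) (real n *\<^sub>R One)) x *\<^sub>R f x = 0" for n :: nat
  proof (rule integral_boxes_zero_imp_AE_zero[OF int' box])
    fix a b :: 'a
    obtain c d where "box a b \<inter> box (- (real n *\<^sub>R One)) (real n *\<^sub>R One) = box c d"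
      by (rule that) (rule box_Int_box)
    then show "set_lebesgue_integral lborel (box a b)
        (\<lambda>x. indicator (box (- (real n *\<^sub>R One)) (real n *\<^sub>R One)) x *\<^sub>R f x) = 0"
      using box[of c d] unfolding set_lebesgue_integral_def
      by (simp add: indicator_inter_arith[symmetric] mult.commute)
  qed
  then have "AE x in lborel. \<forall>n::nat. indicator (box (- (real n *\<^sub>R One)) (real n *\<^sub>R One)) x *\<^sub>R f x = 0"
    unfolding AE_all_countable by blast
  then have "AE x in lborel. f x = 0"
  proof eventually_elim
    case (elim x)
    obtain n where "x \<in> box (- (real n *\<^sub>R One)) (real n *\<^sub>R One)"
      using UN_box_eq_UNIV[where 'a = 'a] by blast
    with elim show ?case
      by (auto simp: indicator_def split: if_splits)
  qed
  then have "AE x in lebesgue. f x = 0"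
    by (rule AE_completion)
  with f rep_zero_L2 show ?thesis
    unfolding L2_eq_iff by eventually_elim simp
qed


section \<open>Weak derivatives\<close>

text \<open>The antilinear embedding of square integrable functions that turns the bilinear pairing
  \<open>\<integral> u \<phi>\<close> into the scalar product.\<close>

definition conj_L2 :: "('a::euclidean_space \<Rightarrow> complex) \<Rightarrow> 'a L2" where
  "conj_L2 \<phi> = abs_L2 (\<lambda>x. cnj (\<phi> x))"

lemma rep_conj_L2: "square_integrable \<phi> \<Longrightarrow> AE x in lebesgue. rep_L2 (conj_L2 \<phi>) x = cnj (\<phi> x)"
  unfolding conj_L2_def by (intro rep_abs_L2 square_integrable_cnj)

lemma cinner_conj_L2:
  assumes "square_integrable \<phi>"
  shows "cinner u (conj_L2 \<phi>) = (LINT x|lebesgue. rep_L2 u x * \<phi> x)"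
  unfolding cinner_def
proof (rule integral_cong_AE)
  show "(\<lambda>x. rep_L2 u x * \<phi> x) \<in> borel_measurable lebesgue"
    using square_integrableD(1)[OF assms] by measurable
  show "AE x in lebesgue. rep_L2 u x * cnj (rep_L2 (conj_L2 \<phi>) x) = rep_L2 u x * \<phi> x"
    using rep_conj_L2[OF assms] by eventually_elim simp
qed measurable

text \<open>In this form, weak derivatives are compatible with limits by continuity of the scalar product.\<close>

lemma has_weak_deriv_iff:
  "has_weak_deriv u i g \<longleftrightarrow> (\<forall>\<phi>. test_function \<phi> \<longrightarrow>
     cinner u (conj_L2 (\<lambda>x. frechet_derivative \<phi> (at x) i)) = - cinner g (conj_L2 \<phi>))"
  unfolding has_weak_deriv_def by (simp add: cinner_conj_L2 test_function_square_integrable)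

lemma has_weak_deriv_unique:
  assumes "has_weak_deriv u i g" "has_weak_deriv u i k"
  shows "g = k"
proof -
  have "cinner (g - k) (conj_L2 \<phi>) = 0" if "test_function \<phi>" for \<phi>
    using assms that by (simp add: has_weak_deriv_iff cinner_minus_left)
  then have "g - k = 0"
    by (intro fundamental_lemma_L2) (simp add: cinner_conj_L2 test_function_square_integrable)
  then show ?thesis
    by simp
qed

lemma weak_deriv_eqI: "has_weak_deriv u i g \<Longrightarrow> weak_deriv u i = g"
  unfolding weak_deriv_def using has_weak_deriv_unique by blast

lemma has_weak_deriv_weak_deriv:
  assumes "u \<in> W12" "i \<in> Basis"
  shows "has_weak_deriv u i (weak_deriv u i)"
  using assms weak_deriv_eqI unfolding W12_def by fastforce

lemma has_weak_deriv_add: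
  "has_weak_deriv u i g \<Longrightarrow> has_weak_deriv v i k \<Longrightarrow> has_weak_deriv (u + v) i (g + k)"
  by (simp add: has_weak_deriv_iff cinner_add_left)

lemma has_weak_deriv_scaleC: "has_weak_deriv u i g \<Longrightarrow> has_weak_deriv (c *\<^sub>C u) i (c *\<^sub>C g)"
  by (simp add: has_weak_deriv_iff cinner_scaleC_left)

lemma has_weak_deriv_diff:
  "has_weak_deriv u i g \<Longrightarrow> has_weak_deriv v i k \<Longrightarrow> has_weak_deriv (u - v) i (g - k)"
  by (simp add: has_weak_deriv_iff cinner_minus_left)

lemma has_weak_deriv_zero: "has_weak_deriv 0 i 0"
  by (simp add: has_weak_deriv_iff)

lemma has_weak_deriv_tendsto:
  assumes "\<And>n. has_weak_deriv (U n) i (G n)" "U \<longlonglongrightarrow> u" "G \<longlonglongrightarrow> g"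
  shows "has_weak_deriv u i g"
  unfolding has_weak_deriv_iff
proof (intro allI impI)
  fix \<phi> :: "'a \<Rightarrow> complex" assume \<phi>: "test_function \<phi>"
  have "(\<lambda>n. cinner (U n) (conj_L2 (\<lambda>x. frechet_derivative \<phi> (at x) i))) \<longlonglongrightarrow> - cinner g (conj_L2 \<phi>)"
    using assms(1) \<phi> unfolding has_weak_deriv_iff
    by (simp add: tendsto_minus[OF tendsto_cinner_left[OF assms(3)]])
  from LIMSEQ_unique[OF tendsto_cinner_left[OF assms(2)] this]
  show "cinner u (conj_L2 (\<lambda>x. frechet_derivative \<phi> (at x) i)) = - cinner g (conj_L2 \<phi>)" .
qed

lemma W12_subspace: "L2.subspace W12"
  unfolding W12_def
  by (rule L2.subspaceI)
    (use has_weak_deriv_zero has_weak_deriv_add has_weak_deriv_scaleC in \<open>blast | fastforce\<close>)+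

lemma weak_deriv_add:
  "u \<in> W12 \<Longrightarrow> v \<in> W12 \<Longrightarrow> i \<in> Basis \<Longrightarrow> weak_deriv (u + v) i = weak_deriv u i + weak_deriv v i"
  by (intro weak_deriv_eqI has_weak_deriv_add has_weak_deriv_weak_deriv)

lemma weak_deriv_diff:
  "u \<in> W12 \<Longrightarrow> v \<in> W12 \<Longrightarrow> i \<in> Basis \<Longrightarrow> weak_deriv (u - v) i = weak_deriv u i - weak_deriv v i"
  by (intro weak_deriv_eqI has_weak_deriv_diff has_weak_deriv_weak_deriv)

lemma weak_deriv_scaleC:
  "u \<in> W12 \<Longrightarrow> i \<in> Basis \<Longrightarrow> weak_deriv (c *\<^sub>C u) i = c *\<^sub>C weak_deriv u i"
  by (intro weak_deriv_eqI has_weak_deriv_scaleC has_weak_deriv_weak_deriv)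

lemma cinner_sum_left: "cinner (\<Sum>i\<in>I. f i) v = (\<Sum>i\<in>I. cinner (f i) v)"
  by (induction I rule: infinite_finite_induct) (auto simp: cinner_add_left)

lemma cinner_scaleR_left: "cinner (r *\<^sub>R u) v = r * cinner u v"
  by (simp add: scaleR_L2_def cinner_scaleC_left)

lemma has_weak_deriv_direction:
  assumes "u \<in> W12"
  shows "has_weak_deriv u z (\<Sum>b\<in>Basis. (z \<bullet> b) *\<^sub>R weak_deriv u b)"
  unfolding has_weak_deriv_iff
proof (intro allI impI)
  fix \<phi> :: "'a \<Rightarrow> complex" assume \<phi>: "test_function \<phi>"
  note sq = test_function_square_integrable[OF \<phi>]
  have "cinner u (conj_L2 (\<lambda>x. frechet_derivative \<phi> (at x) z))
      = (LINT x|lebesgue. rep_L2 u x * frechet_derivative \<phi> (at x) z)"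
    by (rule cinner_conj_L2[OF sq(2)])
  also have "\<dots> = integral\<^sup>L lebesgue (\<lambda>x. \<Sum>b\<in>Basis. (z \<bullet> b) *\<^sub>R (rep_L2 u x * frechet_derivative \<phi> (at x) b))"
    by (subst frechet_derivative_basis_expansion[OF test_functionD(3)[OF \<phi>]]) (simp add: sum_distrib_left)
  also have "\<dots> = (\<Sum>b\<in>Basis. (z \<bullet> b) *\<^sub>R cinner u (conj_L2 (\<lambda>x. frechet_derivative \<phi> (at x) b)))"
    by (subst Bochner_Integration.integral_sum)
      (auto simp: cinner_conj_L2 sq
        intro!: integrable_scaleR_right integrable_square_integrable_mult square_integrable_rep_L2)
  also have "\<dots> = - cinner (\<Sum>b\<in>Basis. (z \<bullet> b) *\<^sub>R weak_deriv u b) (conj_L2 \<phi>)"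
    using has_weak_deriv_weak_deriv[OF assms] \<phi>
    by (simp add: has_weak_deriv_iff cinner_sum_left cinner_scaleR_left scaleR_conv_of_real sum_negf)
  finally show "cinner u (conj_L2 (\<lambda>x. frechet_derivative \<phi> (at x) z))
      = - cinner (\<Sum>b\<in>Basis. (z \<bullet> b) *\<^sub>R weak_deriv u b) (conj_L2 \<phi>)" .
qed

section \<open>Translations\<close>

lemma norm_conj_L2:
  assumes "square_integrable \<phi>"
  shows "(norm (conj_L2 \<phi>))\<^sup>2 = (LINT x|lebesgue. (cmod (\<phi> x))\<^sup>2)"
  unfolding norm_L2_square
proof (rule integral_cong_AE)
  show "(\<lambda>x. (cmod (\<phi> x))\<^sup>2) \<in> borel_measurable lebesgue"
    using square_integrableD(1)[OF assms] by measurable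
  show "AE x in lebesgue. (cmod (rep_L2 (conj_L2 \<phi>) x))\<^sup>2 = (cmod (\<phi> x))\<^sup>2"
    using rep_conj_L2[OF assms] by eventually_elim simp
qed measurable

lemma conj_L2_add:
  assumes "square_integrable \<phi>" "square_integrable \<psi>"
  shows "conj_L2 (\<lambda>x. \<phi> x + \<psi> x) = conj_L2 \<phi> + conj_L2 \<psi>"
  unfolding L2_eq_iff
  using rep_conj_L2[OF square_integrable_add[OF assms]] rep_conj_L2[OF assms(1)] rep_conj_L2[OF assms(2)]
    rep_plus_L2[of "conj_L2 \<phi>" "conj_L2 \<psi>"]
  by eventually_elim simp

lemma conj_L2_cmult:
  assumes "square_integrable \<phi>"
  shows "conj_L2 (\<lambda>x. cnj c * \<phi> x) = c *\<^sub>C conj_L2 \<phi>"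
  unfolding L2_eq_iff
  using rep_conj_L2[OF square_integrable_cmult[OF assms, of "cnj c"]] rep_conj_L2[OF assms]
    rep_scaleC[of c "conj_L2 \<phi>"]
  by eventually_elim simp

text \<open>A vector orthogonal to all test functions vanishes by the fundamental lemma.\<close>

lemma test_functions_dense: "closure (conj_L2 ` Collect test_function) = (UNIV :: 'a::euclidean_space L2 set)"
proof -
  let ?S = "conj_L2 ` Collect test_function :: 'a L2 set"
  have "test_function (\<lambda>x. 0 :: complex)"
    using test_function_cmult[OF test_function_box_bump[of 0 0 0], of 0] by simp
  then have "0 \<in> ?S"
    using conj_L2_cmult[of "\<lambda>_. 0" 0] by (force simp: square_integrable_def)
  then have "L2.subspace ?S"
    by (intro L2.subspaceI)
      (auto simp: test_function_square_integrable conj_L2_add[symmetric] conj_L2_cmult[symmetric]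
        intro!: imageI test_function_add test_function_cmult)
  then have S: "L2.subspace (closure ?S)" "closed (closure ?S)"
    by (auto intro: L2_subspace_closure)
  have "f \<in> closure ?S" for f
  proof -
    from orthogonal_projection[OF S, of f]
    obtain p where p: "p \<in> closure ?S" "\<forall>v\<in>closure ?S. cinner (f - p) v = 0"
      by (rule bexE)
    have "cinner (f - p) (conj_L2 \<phi>) = 0" if "test_function \<phi>" for \<phi>
      using that by (intro bspec[OF p(2)] subsetD[OF closure_subset]) simp
    then have "f - p = 0"
      by (intro fundamental_lemma_L2) (simp add: cinner_conj_L2 test_function_square_integrable)
    with p(1) show ?thesis
      by simp
  qed
  then show ?thesis
    by blast
qed

lemma norm_le_by_test_functions:
  assumes "0 \<le> M" "\<And>\<phi>. test_function \<phi> \<Longrightarrow> cmod (cinner w (conj_L2 \<phi>)) \<le> M * norm (conj_L2 \<phi>)"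
  shows "norm w \<le> M"
proof -
  have "w \<in> closure (conj_L2 ` Collect test_function)"
    by (simp add: test_functions_dense)
  then obtain v where v: "\<And>n. v n \<in> conj_L2 ` Collect test_function" "v \<longlonglongrightarrow> w"
    unfolding closure_sequential by blast
  have "cmod (cinner w w) \<le> M * norm w"
  proof (rule LIMSEQ_le)
    show "(\<lambda>n. cmod (cinner w (v n))) \<longlonglongrightarrow> cmod (cinner w w)"
      by (intro tendsto_norm tendsto_cinner_right v)
    show "(\<lambda>n. M * norm (v n)) \<longlonglongrightarrow> M * norm w"
      by (intro tendsto_intros v)
    have "cmod (cinner w (v n)) \<le> M * norm (v n)" for n
      using v(1)[of n] assms(2) by auto
    then show "\<exists>N. \<forall>n\<ge>N. cmod (cinner w (v n)) \<le> M * norm (v n)"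
      by blast
  qed
  then have "norm w * norm w \<le> M * norm w"
    by (simp add: cinner_self_norm power2_eq_square norm_mult)
  with assms(1) show ?thesis
    by (cases "norm w = 0") auto
qed

lemma lebesgue_shift:
  "(\<lambda>x. x + z) \<in> lebesgue \<rightarrow>\<^sub>M lebesgue"
  "distr lebesgue lebesgue (\<lambda>x. x + z) = (lebesgue :: 'a::euclidean_space measure)"
proof -
  have *: "(\<lambda>x. z + (\<Sum>j\<in>Basis. (1 * (x \<bullet> j)) *\<^sub>R j)) = (\<lambda>x :: 'a. x + z)"
    by (auto simp: euclidean_representation)
  show "(\<lambda>x :: 'a. x + z) \<in> lebesgue \<rightarrow>\<^sub>M lebesgue"
    using lebesgue_affine_measurable[of "\<lambda>_ :: 'a. 1" z] unfolding * by simp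
  show "distr lebesgue lebesgue (\<lambda>x. x + z) = (lebesgue :: 'a measure)"
    using lebesgue_affine_euclidean[of "\<lambda>_ :: 'a. 1" z] unfolding * by (simp add: density_1)
qed

lemma integral_lebesgue_shift:
  fixes f :: "'a::euclidean_space \<Rightarrow> 'b::{banach, second_countable_topology}"
  assumes "f \<in> borel_measurable lebesgue"
  shows "(LINT x|lebesgue. f (x + z)) = integral\<^sup>L lebesgue f"
  using integral_distr[OF lebesgue_shift(1) assms, of z] by (simp add: lebesgue_shift(2))

lemma square_integrable_shift:
  assumes "square_integrable f"
  shows "square_integrable (\<lambda>x. f (x + z))"
  unfolding square_integrable_def
proof
  show "(\<lambda>x. f (x + z)) \<in> borel_measurable lebesgue"
    by (rule measurable_compose[OF lebesgue_shift(1) square_integrableD(1)[OF assms]])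
  have "integrable (distr lebesgue lebesgue (\<lambda>x. x + z)) (\<lambda>x. (cmod (f x))\<^sup>2)"
    using assms by (simp add: lebesgue_shift(2) square_integrable_def)
  then show "integrable lebesgue (\<lambda>x. (cmod (f (x + z)))\<^sup>2)"
    by (rule integrable_distr[OF lebesgue_shift(1)])
qed

lemma has_vector_derivative_iff_quotient:
  fixes f :: "real \<Rightarrow> 'b::real_normed_vector"
  shows "(f has_vector_derivative d) (at t) \<longleftrightarrow> ((\<lambda>h. (f (t + h) - f t) /\<^sub>R h) \<longlongrightarrow> d) (at 0)"
proof -
  have "norm (f (t + h) - f t - h *\<^sub>R d) / norm h = norm ((f (t + h) - f t) /\<^sub>R h - d)" if "h \<noteq> 0" for h
  proof -
    have "(f (t + h) - f t) /\<^sub>R h - d = (f (t + h) - f t - h *\<^sub>R d) /\<^sub>R h"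
      using that by (simp add: scaleR_diff_right)
    then show ?thesis
      by (simp add: divide_inverse mult.commute)
  qed
  then have "((\<lambda>h. norm (f (t + h) - f t - h *\<^sub>R d) / norm h) \<longlongrightarrow> 0) (at 0)
      \<longleftrightarrow> ((\<lambda>h. norm ((f (t + h) - f t) /\<^sub>R h - d)) \<longlongrightarrow> 0) (at 0)"
    by (intro Lim_cong_within) auto
  also have "\<dots> \<longleftrightarrow> ((\<lambda>h. (f (t + h) - f t) /\<^sub>R h - d) \<longlongrightarrow> 0) (at 0)"
    by (rule tendsto_norm_zero_iff)
  also have "\<dots> \<longleftrightarrow> ((\<lambda>h. (f (t + h) - f t) /\<^sub>R h) \<longlongrightarrow> d) (at 0)"
    by (rule LIM_zero_iff)
  finally show ?thesis
    by (simp add: has_vector_derivative_def has_derivative_at bounded_linear_scaleR_left)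
qed

lemma vector_derivative_bound:
  fixes f :: "real \<Rightarrow> 'b::real_normed_vector"
  assumes "\<And>t. (f has_vector_derivative f' t) (at t)" "\<And>t. norm (f' t) \<le> B"
  shows "norm (f t - f s) \<le> B * \<bar>t - s\<bar>"
proof -
  have "norm (f t - f s) \<le> B * norm (t - s)"
  proof (rule differentiable_bound[where S = UNIV and f' = "\<lambda>t h. h *\<^sub>R f' t"])
    show "(f has_derivative (\<lambda>h. h *\<^sub>R f' x)) (at x within UNIV)" for x
      using assms(1)[of x] by (simp add: has_vector_derivative_def)
    show "onorm (\<lambda>h. h *\<^sub>R f' x) \<le> B" for x
      by (rule onorm_le) (use mult_left_mono[OF assms(2)[of x] abs_ge_zero] in \<open>simp add: mult.commute\<close>)
  qed auto
  then show ?thesis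
    by simp
qed

lemma test_function_line_derivative:
  assumes "test_function \<phi>"
  shows "((\<lambda>s. \<phi> (y - s *\<^sub>R z)) has_vector_derivative - frechet_derivative \<phi> (at (y - s *\<^sub>R z)) z) (at s)"
proof -
  let ?D = "frechet_derivative \<phi> (at (y - s *\<^sub>R z))"
  have \<phi>: "(\<phi> has_derivative ?D) (at (y - s *\<^sub>R z))"
    using test_functionD(3)[OF assms] by (simp add: frechet_derivative_works[symmetric])
  have "((\<lambda>s. \<phi> (y - s *\<^sub>R z)) has_derivative (\<lambda>h. ?D (- (h *\<^sub>R z)))) (at s)"
    by (rule has_derivative_compose[where f = "\<lambda>s. y - s *\<^sub>R z" and g = \<phi> and g' = ?D, OF _ \<phi>]) (auto intro!: derivative_eq_intros)
  moreover have "?D (- (h *\<^sub>R z)) = h *\<^sub>R (- ?D z)" for h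
    using has_derivative_bounded_linear[OF \<phi>]
    by (simp add: linear_simps)
  ultimately show ?thesis
    by (simp add: has_vector_derivative_def)
qed

text \<open>Differentiation under the integral. The difference quotients are dominated because they
  are bounded by the supremum of the directional derivative and vanish off a fixed ball.\<close>

lemma integral_test_function_line_derivative:
  assumes \<phi>: "test_function \<phi>"
  shows "((\<lambda>s. (LINT x|lebesgue. rep_L2 u x * \<phi> (x - s *\<^sub>R z))) has_vector_derivative
    - (LINT x|lebesgue. rep_L2 u x * frechet_derivative \<phi> (at (x - s *\<^sub>R z)) z)) (at s)"
  unfolding has_vector_derivative_iff_quotient tendsto_at_iff_sequentially
proof (intro allI impI)
  fix h :: "nat \<Rightarrow> real" assume h0: "\<forall>n. h n \<in> UNIV - {0}" and h: "h \<longlonglongrightarrow> 0"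
  let ?D = "\<lambda>x. frechet_derivative \<phi> (at x) z"
  define q where "q n x = (\<phi> (x - (s + h n) *\<^sub>R z) - \<phi> (x - s *\<^sub>R z)) /\<^sub>R h n" for n x
  obtain R where R: "\<And>x. \<phi> x \<noteq> 0 \<Longrightarrow> norm x \<le> R"
    using test_functionD(1)[OF \<phi>] by (auto simp: bounded_iff)
  obtain H where H: "\<And>n. \<bar>h n\<bar> \<le> H"
    using convergent_imp_bounded[OF h] by (auto simp: bounded_iff)
  obtain B where B: "0 \<le> B" "\<And>x. cmod (?D x) \<le> B"
  proof -
    have "bounded {x. ?D x \<noteq> 0}"
      by (rule bounded_subset[OF _ test_function_derivative_support])
        (use \<phi> in \<open>simp add: test_function_def compact_imp_bounded\<close>)
    then obtain a C where C: "0 \<le> C" "\<And>x. cmod (?D x) \<le> C * indicator (cbox (-a) a) x"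
      using continuous_bounded_support_bounds[OF test_functionD(4)[OF \<phi>]] by blast
    have "cmod (?D x) \<le> C" for x
      by (rule order_trans[OF C(2)]) (simp add: C(1) indicator_def)
    with C(1) show ?thesis
      by (rule that)
  qed
  define S where "S = cball (0 :: 'a) (R + (\<bar>s\<bar> + H) * norm z)"
  have q_bound: "cmod (q n x) \<le> B * indicator S x" for n x
  proof (cases "x \<in> S")
    case True
    have "cmod (\<phi> (x - (s + h n) *\<^sub>R z) - \<phi> (x - s *\<^sub>R z)) \<le> B * \<bar>(s + h n) - s\<bar>"
      by (rule vector_derivative_bound[OF test_function_line_derivative[OF \<phi>]]) (simp add: B)
    then have "inverse \<bar>h n\<bar> * cmod (\<phi> (x - (s + h n) *\<^sub>R z) - \<phi> (x - s *\<^sub>R z))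
        \<le> inverse \<bar>h n\<bar> * (B * \<bar>(s + h n) - s\<bar>)"
      by (rule mult_left_mono) simp
    also have "\<dots> = B"
      using h0 by simp
    finally have "cmod (q n x) \<le> B"
      by (simp add: q_def abs_inverse)
    with True show ?thesis
      by simp
  next
    case False
    have "\<phi> (x - t *\<^sub>R z) = 0" if "\<bar>t\<bar> \<le> \<bar>s\<bar> + H" for t
    proof (rule ccontr)
      assume "\<phi> (x - t *\<^sub>R z) \<noteq> 0"
      then have "norm (x - t *\<^sub>R z) \<le> R"
        by (rule R)
      moreover have "norm x \<le> norm (x - t *\<^sub>R z) + norm (t *\<^sub>R z)"
        using norm_triangle_ineq[of "x - t *\<^sub>R z" "t *\<^sub>R z"] by simp
      moreover have "norm (t *\<^sub>R z) \<le> (\<bar>s\<bar> + H) * norm z"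
        using that by (simp add: mult_right_mono)
      ultimately show False
        using False by (simp add: S_def)
    qed
    from this[of "s + h n"] this[of s] show ?thesis
      using H[of n] False by (simp add: q_def)
  qed
  have sq: "square_integrable (\<lambda>x. \<phi> (x - t *\<^sub>R z))" for t
    using square_integrable_shift[OF test_function_square_integrable(1)[OF \<phi>], of "- t *\<^sub>R z"] by simp
  have [measurable]: "(\<lambda>x. \<phi> (x - t *\<^sub>R z)) \<in> borel_measurable lebesgue" for t
    by (rule square_integrableD(1)[OF sq])
  have int: "integrable lebesgue (\<lambda>x. rep_L2 u x * \<phi> (x - t *\<^sub>R z))" for t
    by (intro integrable_square_integrable_mult square_integrable_rep_L2 sq)
  have "(\<lambda>n. (LINT x|lebesgue. rep_L2 u x * q n x))
      \<longlonglongrightarrow> (LINT x|lebesgue. rep_L2 u x * - ?D (x - s *\<^sub>R z))"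
  proof (rule integral_dominated_convergence[where w = "\<lambda>x. cmod (rep_L2 u x) * (B * indicator S x)"])
    have "square_integrable (\<lambda>x. complex_of_real (B * indicator S x))"
    proof -
      have S: "S \<in> lmeasurable"
        by (simp add: S_def)
      then have [measurable]: "S \<in> sets lebesgue"
        by (rule fmeasurableD)
      have "integrable lebesgue (indicator S :: 'a \<Rightarrow> real)"
        using fmeasurableD2[OF S] by (intro integrable_real_indicator) (auto simp: less_top)
      then have "integrable lebesgue (\<lambda>x. B\<^sup>2 * indicator S x :: real)"
        by simp
      moreover have "(\<lambda>x. (cmod (complex_of_real (B * indicator S x)))\<^sup>2) = (\<lambda>x. B\<^sup>2 * indicator S x)"
        by (auto simp: fun_eq_iff indicator_def)
      ultimately show ?thesis
        unfolding square_integrable_def by simp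
    qed
    from integrable_norm[OF integrable_square_integrable_mult[OF square_integrable_rep_L2[of u] this]]
    show "integrable lebesgue (\<lambda>x. cmod (rep_L2 u x) * (B * indicator S x))"
      using B(1) by (simp add: norm_mult)
    show "(\<lambda>x. rep_L2 u x * q n x) \<in> borel_measurable lebesgue" for n
      unfolding q_def by measurable
    have "(\<lambda>x. ?D (x - s *\<^sub>R z)) \<in> borel_measurable lebesgue"
      using square_integrable_shift[OF test_function_square_integrable(2)[OF \<phi>, of z], of "- s *\<^sub>R z"]
      by (simp add: square_integrable_def)
    then show "(\<lambda>x. rep_L2 u x * - ?D (x - s *\<^sub>R z)) \<in> borel_measurable lebesgue"
      by measurable
    show "AE x in lebesgue. norm (rep_L2 u x * q n x) \<le> cmod (rep_L2 u x) * (B * indicator S x)" for n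
      by (intro always_eventually allI) (simp add: norm_mult mult_left_mono q_bound)
    have "(\<lambda>n. q n x) \<longlonglongrightarrow> - ?D (x - s *\<^sub>R z)" for x
      using test_function_line_derivative[OF \<phi>, of x z s] h0 h
      unfolding has_vector_derivative_iff_quotient tendsto_at_iff_sequentially
      by (auto simp: q_def o_def)
    then show "AE x in lebesgue. (\<lambda>n. rep_L2 u x * q n x) \<longlonglongrightarrow> rep_L2 u x * - ?D (x - s *\<^sub>R z)"
      by (intro always_eventually allI tendsto_mult tendsto_const)
  qed
  moreover have "(LINT x|lebesgue. rep_L2 u x * q n x)
      = ((LINT x|lebesgue. rep_L2 u x * \<phi> (x - (s + h n) *\<^sub>R z))
         - (LINT x|lebesgue. rep_L2 u x * \<phi> (x - s *\<^sub>R z))) /\<^sub>R h n" for n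
  proof -
    have "(\<lambda>x. rep_L2 u x * q n x)
        = (\<lambda>x. (rep_L2 u x * \<phi> (x - (s + h n) *\<^sub>R z) - rep_L2 u x * \<phi> (x - s *\<^sub>R z)) /\<^sub>R h n)"
      by (simp add: q_def fun_eq_iff right_diff_distrib)
    then show ?thesis
      by (simp add: Bochner_Integration.integral_diff[OF int int])
  qed
  ultimately show "((\<lambda>h. ((LINT x|lebesgue. rep_L2 u x * \<phi> (x - (s + h) *\<^sub>R z))
         - (LINT x|lebesgue. rep_L2 u x * \<phi> (x - s *\<^sub>R z))) /\<^sub>R h) \<circ> h)
      \<longlonglongrightarrow> - (LINT x|lebesgue. rep_L2 u x * ?D (x - s *\<^sub>R z))"
    by (simp add: o_def)
qed

definition shift_L2 :: "'a::euclidean_space \<Rightarrow> 'a L2 \<Rightarrow> 'a L2" where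
  "shift_L2 z u = abs_L2 (\<lambda>x. rep_L2 u (x + z))"

lemma rep_shift_L2: "AE x in lebesgue. rep_L2 (shift_L2 z u) x = rep_L2 u (x + z)"
  unfolding shift_L2_def by (intro rep_abs_L2 square_integrable_shift square_integrable_rep_L2)

text \<open>By duality with test functions: \<open>F(s) = \<integral> u(x) \<phi>(x - s z) dx\<close> has the derivative
  \<open>\<integral> g(x) \<phi>(x - s z) dx\<close>, since translates of test functions are test functions.\<close>

theorem norm_shift_L2_diff_le:
  assumes "has_weak_deriv u z g"
  shows "norm (shift_L2 z u - u) \<le> norm g"
proof (rule norm_le_by_test_functions)
  fix \<phi> :: "'a \<Rightarrow> complex" assume \<phi>: "test_function \<phi>"
  note sq = test_function_square_integrable(1)[OF \<phi>]
  define F where "F s = (LINT x|lebesgue. rep_L2 u x * \<phi> (x - s *\<^sub>R z))" for s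
  define F' where "F' s = (LINT x|lebesgue. rep_L2 g x * \<phi> (x - s *\<^sub>R z))" for s
  have sh: "test_function (\<lambda>x. \<phi> (x - s *\<^sub>R z))" for s
    using test_function_shift[OF \<phi>, of "- s *\<^sub>R z"] by simp
  have D_shift: "frechet_derivative (\<lambda>x. \<phi> (x - s *\<^sub>R z)) (at x) = frechet_derivative \<phi> (at (x - s *\<^sub>R z))" for s x
  proof (rule frechet_derivative_at[symmetric], rule has_derivative_compose[where g = \<phi> and g' = "frechet_derivative \<phi> (at (x - s *\<^sub>R z))" and f' = "\<lambda>h. h"])
    show "((\<lambda>x. x - s *\<^sub>R z) has_derivative (\<lambda>h. h)) (at x)"
      by (auto intro!: derivative_eq_intros)
    show "(\<phi> has_derivative frechet_derivative \<phi> (at (x - s *\<^sub>R z))) (at (x - s *\<^sub>R z))"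
      using test_functionD(3)[OF \<phi>] by (simp add: frechet_derivative_works[symmetric])
  qed
  have "- (LINT x|lebesgue. rep_L2 u x * frechet_derivative \<phi> (at (x - s *\<^sub>R z)) z) = F' s" for s
    using assms[unfolded has_weak_deriv_def, rule_format, OF sh[of s]] unfolding D_shift F'_def by simp
  then have "(F has_vector_derivative F' s) (at s)" for s
    using integral_test_function_line_derivative[OF \<phi>, of u z s] by (simp add: F_def[abs_def])
  moreover have "cmod (F' s) \<le> norm g * norm (conj_L2 \<phi>)" for s
  proof -
    have "(norm (conj_L2 (\<lambda>x. \<phi> (x - s *\<^sub>R z))))\<^sup>2 = (norm (conj_L2 \<phi>))\<^sup>2"
      using integral_lebesgue_shift[of "\<lambda>x. (cmod (\<phi> x))\<^sup>2" "- s *\<^sub>R z"] square_integrableD(1)[OF sq]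
      by (simp add: norm_conj_L2 sq test_function_square_integrable(1)[OF sh])
    then have "norm (conj_L2 (\<lambda>x. \<phi> (x - s *\<^sub>R z))) = norm (conj_L2 \<phi>)"
      by simp
    then show ?thesis
      using norm_cinner_le[of g "conj_L2 (\<lambda>x. \<phi> (x - s *\<^sub>R z))"]
      by (simp add: F'_def cinner_conj_L2 test_function_square_integrable(1)[OF sh])
  qed
  ultimately have "cmod (F 1 - F 0) \<le> norm g * norm (conj_L2 \<phi>) * \<bar>1 - 0\<bar>"
    by (rule vector_derivative_bound)
  moreover have "cinner (shift_L2 z u) (conj_L2 \<phi>) = F 1"
  proof -
    have m: "(\<lambda>x. rep_L2 u x * \<phi> (x - z)) \<in> borel_measurable lebesgue"
      using square_integrableD(1)[OF square_integrable_shift[OF sq, of "- z"]] by simp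
    have "cinner (shift_L2 z u) (conj_L2 \<phi>) = (LINT x|lebesgue. rep_L2 u (x + z) * \<phi> x)"
      unfolding cinner_conj_L2[OF sq]
    proof (rule integral_cong_AE)
      show "(\<lambda>x. rep_L2 u (x + z) * \<phi> x) \<in> borel_measurable lebesgue"
        using square_integrableD(1)[OF square_integrable_shift[OF square_integrable_rep_L2]] square_integrableD(1)[OF sq]
        by (intro borel_measurable_times)
      show "AE x in lebesgue. rep_L2 (shift_L2 z u) x * \<phi> x = rep_L2 u (x + z) * \<phi> x"
        using rep_shift_L2[of z u] by eventually_elim simp
    qed (use square_integrableD(1)[OF sq] in measurable)
    also have "\<dots> = F 1"
      using integral_lebesgue_shift[OF m, of z] by (simp add: F_def)
    finally show ?thesis .
  qed
  moreover have "cinner u (conj_L2 \<phi>) = F 0"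
    by (simp add: F_def cinner_conj_L2[OF sq])
  ultimately show "cmod (cinner (shift_L2 z u - u) (conj_L2 \<phi>)) \<le> norm g * norm (conj_L2 \<phi>)"
    by (simp add: cinner_minus_left)
qed simp


section \<open>A Poincare inequality on a grid\<close>

text \<open>The half-open cube that contains \<open>x\<close>, in the grid of cubes of side \<open>h\<close> with corners in
  \<open>h \<int>\<^sup>d\<close>.\<close>

definition cell :: "real \<Rightarrow> 'a::euclidean_space \<Rightarrow> 'a set" where
  "cell h x = {y. \<forall>b\<in>Basis. \<lfloor>x \<bullet> b / h\<rfloor> = \<lfloor>y \<bullet> b / h\<rfloor>}"

lemma mem_cell_commute: "y \<in> cell h x \<longleftrightarrow> x \<in> cell h y"
  by (auto simp: cell_def)

lemma cell_eq: "y \<in> cell h x \<Longrightarrow> cell h y = cell h x"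
  by (auto simp: cell_def)

lemma measurable_mem_cell [measurable]:
  "Measurable.pred (borel \<Otimes>\<^sub>M borel) (\<lambda>p :: 'a::euclidean_space \<times> 'a. snd p \<in> cell h (fst p))"
  unfolding cell_def by simp measurable

lemma cell_borel [measurable]: "cell h x \<in> sets borel"
proof -
  have "{y \<in> space borel. y \<in> cell h x} \<in> sets borel"
    unfolding cell_def by simp measurable
  then show ?thesis
    by simp
qed

lemma mem_cell_imp_close:
  assumes "0 < h" "y \<in> cell h x" "b \<in> Basis"
  shows "\<bar>y \<bullet> b - x \<bullet> b\<bar> < h"
proof -
  have "\<lfloor>x \<bullet> b / h\<rfloor> = \<lfloor>y \<bullet> b / h\<rfloor>"
    using assms by (auto simp: cell_def)
  then have "\<bar>y \<bullet> b / h - x \<bullet> b / h\<bar> < 1"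
    by linarith
  then have "\<bar>y \<bullet> b - x \<bullet> b\<bar> / h < 1"
    using assms(1) by (simp add: diff_divide_distrib[symmetric] abs_div_pos[symmetric])
  then show ?thesis
    using assms(1) by (simp add: divide_less_eq)
qed

lemma emeasure_cell:
  assumes "0 < h"
  shows "emeasure lborel (cell h (x :: 'a::euclidean_space)) = ennreal (h ^ DIM('a))"
proof -
  define a where "a = (\<Sum>b\<in>Basis. (h * of_int \<lfloor>x \<bullet> b / h\<rfloor>) *\<^sub>R b)"
  have a: "a \<bullet> b = h * of_int \<lfloor>x \<bullet> b / h\<rfloor>" if "b \<in> Basis" for b
    using that by (simp add: a_def inner_sum_left inner_Basis if_distrib sum.If_cases cong: if_cong)
  have iff: "y \<in> cell h x \<longleftrightarrow> (\<forall>b\<in>Basis. a \<bullet> b \<le> y \<bullet> b \<and> y \<bullet> b < a \<bullet> b + h)" for y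
  proof -
    have "\<lfloor>x \<bullet> b / h\<rfloor> = \<lfloor>y \<bullet> b / h\<rfloor> \<longleftrightarrow> a \<bullet> b \<le> y \<bullet> b \<and> y \<bullet> b < a \<bullet> b + h" if "b \<in> Basis" for b
    proof -
      have "\<lfloor>x \<bullet> b / h\<rfloor> = \<lfloor>y \<bullet> b / h\<rfloor>
          \<longleftrightarrow> of_int \<lfloor>x \<bullet> b / h\<rfloor> \<le> y \<bullet> b / h \<and> y \<bullet> b / h < of_int \<lfloor>x \<bullet> b / h\<rfloor> + 1"
        by linarith
      also have "\<dots> \<longleftrightarrow> a \<bullet> b \<le> y \<bullet> b \<and> y \<bullet> b < a \<bullet> b + h"
        using assms by (simp add: a[OF that] field_simps)
      finally show ?thesis .
    qed
    then show ?thesis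
      by (simp add: cell_def)
  qed
  have vol: "emeasure lborel (box a (a + h *\<^sub>R One)) = ennreal (h ^ DIM('a))"
    "emeasure lborel (cbox a (a + h *\<^sub>R One)) = ennreal (h ^ DIM('a))"
    using assms by (simp_all add: emeasure_lborel_box_eq emeasure_lborel_cbox_eq inner_add_left)
  have "box a (a + h *\<^sub>R One) \<subseteq> cell h x" "cell h x \<subseteq> cbox a (a + h *\<^sub>R One)"
    by (auto simp: iff mem_box inner_add_left less_imp_le)
  from emeasure_mono[OF this(1), of lborel] emeasure_mono[OF this(2), of lborel] show ?thesis
    unfolding vol by simp
qed

lemma finite_cells:
  assumes "0 < h" "bounded S"
  shows "finite (cell h ` S)"
proof -
  obtain R where R: "\<And>x. x \<in> S \<Longrightarrow> norm x \<le> R"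
    using assms(2) by (auto simp: bounded_iff)
  define N where "N = \<lceil>R / h\<rceil>"
  let ?F = "PiE (Basis :: 'a set) (\<lambda>_. {- N - 1..N + 1})"
  have "cell h ` S \<subseteq> (\<lambda>f. {y. \<forall>b\<in>Basis. f b = \<lfloor>y \<bullet> b / h\<rfloor>}) ` ?F"
  proof (rule image_subsetI)
    fix x assume "x \<in> S"
    have "\<lfloor>x \<bullet> b / h\<rfloor> \<in> {- N - 1..N + 1}" if "b \<in> Basis" for b
    proof -
      have "\<bar>x \<bullet> b\<bar> \<le> R"
        using Basis_le_norm[OF that, of x] R[OF \<open>x \<in> S\<close>] by linarith
      then have "x \<bullet> b / h \<le> R / h" "- R / h \<le> x \<bullet> b / h"
        using assms(1) by (intro divide_right_mono; simp)+
      moreover have "R / h \<le> of_int N"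
        by (simp add: N_def)
      ultimately have "x \<bullet> b / h \<le> of_int N" "- of_int N \<le> x \<bullet> b / h"
        by simp_all
      then show ?thesis
        unfolding atLeastAtMost_iff by linarith
    qed
    then have "restrict (\<lambda>b. \<lfloor>x \<bullet> b / h\<rfloor>) Basis \<in> ?F"
      by auto
    moreover have "cell h x = {y. \<forall>b\<in>Basis. restrict (\<lambda>b. \<lfloor>x \<bullet> b / h\<rfloor>) Basis b = \<lfloor>y \<bullet> b / h\<rfloor>}"
      by (simp add: cell_def)
    ultimately show "cell h x \<in> (\<lambda>f. {y. \<forall>b\<in>Basis. f b = \<lfloor>y \<bullet> b / h\<rfloor>}) ` ?F"
      by blast
  qed
  then show ?thesis
    by (rule finite_subset) (intro finite_imageI finite_PiE; simp)
qed

abbreviation gradient_energy :: "'a::euclidean_space L2 \<Rightarrow> real" where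
  "gradient_energy u \<equiv> (\<Sum>b\<in>Basis. (norm (weak_deriv u b))\<^sup>2)"

lemma norm_direction_derivative_le:
  assumes "\<And>b. b \<in> Basis \<Longrightarrow> \<bar>z \<bullet> b\<bar> \<le> h" "0 \<le> h"
  shows "(norm (\<Sum>b\<in>Basis. (z \<bullet> b) *\<^sub>R weak_deriv u b))\<^sup>2
    \<le> real DIM('a) * h\<^sup>2 * gradient_energy (u :: 'a::euclidean_space L2)"
proof -
  have "norm (\<Sum>b\<in>Basis. (z \<bullet> b) *\<^sub>R weak_deriv u b) \<le> (\<Sum>b\<in>Basis. h * norm (weak_deriv u b))"
    by (rule sum_norm_le) (simp add: assms mult_right_mono)
  then have "(norm (\<Sum>b\<in>Basis. (z \<bullet> b) *\<^sub>R weak_deriv u b))\<^sup>2 \<le> (\<Sum>b\<in>Basis. h * norm (weak_deriv u b))\<^sup>2"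
    by (intro power_mono) auto
  also have "\<dots> \<le> real DIM('a) * (\<Sum>b\<in>Basis. (h * norm (weak_deriv u b))\<^sup>2)"
    using sum_squared_le_sum_of_squares[of "\<lambda>b. h * norm (weak_deriv u b)" "Basis :: 'a set"]
    by (simp add: mult.commute)
  also have "\<dots> = real DIM('a) * h\<^sup>2 * gradient_energy u"
    by (simp add: power_mult_distrib sum_distrib_left mult.assoc)
  finally show ?thesis .
qed

lemma nn_integral_lborel_shift:
  fixes f :: "'a::euclidean_space \<Rightarrow> ennreal"
  assumes "f \<in> borel_measurable borel"
  shows "(\<integral>\<^sup>+y. f (x + y) \<partial>lborel) = (\<integral>\<^sup>+y. f y \<partial>lborel)"
proof -
  have "(\<integral>\<^sup>+y. f y \<partial>lborel) = (\<integral>\<^sup>+y. f y \<partial>distr lborel borel ((+) x))"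
    by (simp add: lborel_distr_plus)
  also have "\<dots> = (\<integral>\<^sup>+y. f (x + y) \<partial>lborel)"
    using assms by (subst nn_integral_distr) auto
  finally show ?thesis
    by simp
qed

lemma nn_integral_shift_diff_le:
  assumes f[measurable]: "f \<in> borel_measurable borel" and uf: "AE x in lebesgue. rep_L2 u x = f x"
    and u: "u \<in> W12"
  shows "(\<integral>\<^sup>+x. ennreal ((cmod (f x - f (x + z)))\<^sup>2) \<partial>lborel)
    \<le> ennreal ((norm (\<Sum>b\<in>Basis. (z \<bullet> b) *\<^sub>R weak_deriv u b))\<^sup>2)"
proof -
  have "AE x in distr lebesgue lebesgue (\<lambda>x. x + z). rep_L2 u x = f x"
    unfolding lebesgue_shift(2) by (rule uf)
  then have shifted: "AE x in lebesgue. rep_L2 u (x + z) = f (x + z)"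
    by (rule AE_distrD[OF lebesgue_shift(1)])
  have "(\<integral>\<^sup>+x. ennreal ((cmod (f x - f (x + z)))\<^sup>2) \<partial>lborel)
      = (\<integral>\<^sup>+x. ennreal ((cmod (f x - f (x + z)))\<^sup>2) \<partial>lebesgue)"
    by (simp add: nn_integral_completion)
  also have "\<dots> = (\<integral>\<^sup>+x. ennreal ((cmod (rep_L2 (shift_L2 z u - u) x))\<^sup>2) \<partial>lebesgue)"
  proof (rule nn_integral_cong_AE)
    show "AE x in lebesgue. ennreal ((cmod (f x - f (x + z)))\<^sup>2)
        = ennreal ((cmod (rep_L2 (shift_L2 z u - u) x))\<^sup>2)"
      using uf shifted rep_shift_L2[of z u] rep_minus_L2[of "shift_L2 z u" u]
      by eventually_elim (simp add: norm_minus_commute)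
  qed
  also have "\<dots> = ennreal ((norm (shift_L2 z u - u))\<^sup>2)"
    by (rule nn_integral_L2)
  also have "\<dots> \<le> ennreal ((norm (\<Sum>b\<in>Basis. (z \<bullet> b) *\<^sub>R weak_deriv u b))\<^sup>2)"
    by (intro ennreal_leI power_mono norm_shift_L2_diff_le has_weak_deriv_direction u) simp
  finally show ?thesis .
qed

text \<open>Two points of a cell differ by a vector in \<open>[-h, h]\<^sup>d\<close>, so that the integral over pairs
  is controlled by translations.\<close>

lemma nn_integral_cell_differences_le:
  fixes u :: "'a::euclidean_space L2"
  assumes f[measurable]: "f \<in> borel_measurable borel" and uf: "AE x in lebesgue. rep_L2 u x = f x"
    and u: "u \<in> W12" and h: "0 < h"
  shows "(\<integral>\<^sup>+x. (\<integral>\<^sup>+y. indicator (cell h x) y * ennreal ((cmod (f x - f y))\<^sup>2) \<partial>lborel) \<partial>lborel)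
    \<le> ennreal ((2 * h) ^ DIM('a) * (real DIM('a) * h\<^sup>2 * gradient_energy u))"
proof -
  let ?Q = "cbox (- (h *\<^sub>R One)) (h *\<^sub>R One) :: 'a set"
  let ?c = "real DIM('a) * h\<^sup>2 * gradient_energy u"
  have "(\<integral>\<^sup>+x. (\<integral>\<^sup>+y. indicator (cell h x) y * ennreal ((cmod (f x - f y))\<^sup>2) \<partial>lborel) \<partial>lborel)
      \<le> (\<integral>\<^sup>+x. (\<integral>\<^sup>+z. indicator ?Q z * ennreal ((cmod (f x - f (x + z)))\<^sup>2) \<partial>lborel) \<partial>lborel)"
  proof (rule nn_integral_mono)
    fix x
    have "(\<integral>\<^sup>+y. indicator (cell h x) y * ennreal ((cmod (f x - f y))\<^sup>2) \<partial>lborel)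
        = (\<integral>\<^sup>+z. indicator (cell h x) (x + z) * ennreal ((cmod (f x - f (x + z)))\<^sup>2) \<partial>lborel)"
      by (rule nn_integral_lborel_shift[symmetric]) measurable
    also have "\<dots> \<le> (\<integral>\<^sup>+z. indicator ?Q z * ennreal ((cmod (f x - f (x + z)))\<^sup>2) \<partial>lborel)"
    proof (intro nn_integral_mono mult_right_mono)
      fix z
      have "z \<in> ?Q" if "x + z \<in> cell h x"
        using mem_cell_imp_close[OF h that] by (force simp: mem_box inner_add_left abs_less_iff less_imp_le)
      then show "indicator (cell h x) (x + z) \<le> (indicator ?Q z :: ennreal)"
        by (simp add: indicator_def)
    qed simp
    finally show "(\<integral>\<^sup>+y. indicator (cell h x) y * ennreal ((cmod (f x - f y))\<^sup>2) \<partial>lborel)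
        \<le> (\<integral>\<^sup>+z. indicator ?Q z * ennreal ((cmod (f x - f (x + z)))\<^sup>2) \<partial>lborel)" .
  qed
  also have "\<dots> = (\<integral>\<^sup>+z. (\<integral>\<^sup>+x. indicator ?Q z * ennreal ((cmod (f x - f (x + z)))\<^sup>2) \<partial>lborel) \<partial>lborel)"
    by (rule lborel_pair.Fubini'[symmetric]) measurable
  also have "\<dots> = (\<integral>\<^sup>+z. indicator ?Q z * (\<integral>\<^sup>+x. ennreal ((cmod (f x - f (x + z)))\<^sup>2) \<partial>lborel) \<partial>lborel)"
    by (intro nn_integral_cong nn_integral_cmult) measurable
  also have "\<dots> \<le> (\<integral>\<^sup>+z. ennreal ?c * indicator ?Q z \<partial>lborel)"
  proof (rule nn_integral_mono)
    fix z
    show "indicator ?Q z * (\<integral>\<^sup>+x. ennreal ((cmod (f x - f (x + z)))\<^sup>2) \<partial>lborel) \<le> ennreal ?c * indicator ?Q z"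
    proof (cases "z \<in> ?Q")
      case True
      then have "\<bar>z \<bullet> b\<bar> \<le> h" if "b \<in> Basis" for b
        using that by (auto simp: mem_box abs_le_iff)
      then have "ennreal ((norm (\<Sum>b\<in>Basis. (z \<bullet> b) *\<^sub>R weak_deriv u b))\<^sup>2) \<le> ennreal ?c"
        using h by (intro ennreal_leI norm_direction_derivative_le) auto
      with nn_integral_shift_diff_le[OF f uf u, of z] True show ?thesis
        by (simp add: order_trans)
    qed simp
  qed
  also have "\<dots> = ennreal ?c * ennreal ((2 * h) ^ DIM('a))"
  proof -
    have "emeasure lborel ?Q = ennreal (\<Prod>b\<in>(Basis :: 'a set). (h *\<^sub>R One - - (h *\<^sub>R One)) \<bullet> b)"
      by (subst emeasure_lborel_cbox) (use h in auto)
    also have "(\<Prod>b\<in>(Basis :: 'a set). (h *\<^sub>R One - - (h *\<^sub>R One)) \<bullet> b) = (\<Prod>b\<in>(Basis :: 'a set). 2 * h)"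
      by (intro prod.cong) (auto simp: inner_add_left)
    finally show ?thesis
      by (simp add: nn_integral_cmult_indicator)
  qed
  also have "\<dots> = ennreal ((2 * h) ^ DIM('a) * ?c)"
    using h by (simp add: ennreal_mult[symmetric] sum_nonneg mult.commute)
  finally show ?thesis .
qed

text \<open>In a cell, the value at \<open>x\<close> is controlled by the differences to \<open>x\<close> and the mean value. The
  positive term \<open>\<integral> |f|\<^sup>2\<close> of the expanded square is dropped.\<close>

lemma cell_mean_value_bound:
  fixes f :: "'a::euclidean_space \<Rightarrow> complex"
  assumes f[measurable]: "f \<in> borel_measurable borel" and sq: "integrable lborel (\<lambda>x. (cmod (f x))\<^sup>2)"
    and h: "0 < h"
  shows "ennreal (h ^ DIM('a) * (cmod (f x))\<^sup>2)
    \<le> 2 * (\<integral>\<^sup>+y. indicator (cell h x) y * ennreal ((cmod (f x - f y))\<^sup>2) \<partial>lborel)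
      + ennreal (4 / h ^ DIM('a) * (cmod (integral\<^sup>L lborel (\<lambda>y. indicator (cell h x) y *\<^sub>R f y)))\<^sup>2)"
proof -
  let ?C = "cell h x" and ?v = "h ^ DIM('a)"
  define I where "I = integral\<^sup>L lborel (\<lambda>y. indicator ?C y *\<^sub>R f y)"
  define A where "A = integral\<^sup>L lborel (\<lambda>y. indicator ?C y * (cmod (f y))\<^sup>2)"
  have ind: "integrable lborel (indicator ?C :: 'a \<Rightarrow> real)" "integral\<^sup>L lborel (indicator ?C :: 'a \<Rightarrow> real) = ?v"
    using emeasure_cell[OF h, of x] h by (auto simp: measure_def)
  have int_sq: "integrable lborel (\<lambda>y. indicator ?C y * (cmod (f y))\<^sup>2)"
    by (rule Bochner_Integration.integrable_bound[OF sq]) (auto simp: indicator_def)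
  have int_f: "integrable lborel (\<lambda>y. indicator ?C y *\<^sub>R f y)"
  proof (rule Bochner_Integration.integrable_bound)
    show "integrable lborel (\<lambda>y. indicator ?C y + indicator ?C y * (cmod (f y))\<^sup>2)"
      by (intro Bochner_Integration.integrable_add ind int_sq)
    have "t \<le> t\<^sup>2 + 1" for t :: real
      using zero_le_power2[of "t - 1/2"] by (simp add: power2_eq_square algebra_simps)
    then show "AE y in lborel. norm (indicator ?C y *\<^sub>R f y) \<le> norm (indicator ?C y + indicator ?C y * (cmod (f y))\<^sup>2)"
      by (intro always_eventually allI) (auto simp: indicator_def add.commute)
  qed measurable
  define r where "r y = Re (cnj (f x) * (indicator ?C y *\<^sub>R f y))" for y
  have expand: "indicator ?C y * (cmod (f x - f y))\<^sup>2
      = (cmod (f x))\<^sup>2 * indicator ?C y + indicator ?C y * (cmod (f y))\<^sup>2 - 2 * r y" for y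
    by (auto simp: r_def indicator_def cmod_power2 power2_diff algebra_simps)
  have int_mult: "integrable lborel (\<lambda>y. cnj (f x) * (indicator ?C y *\<^sub>R f y))"
    by (intro integrable_mult_right int_f)
  have int_r: "integrable lborel r"
    unfolding r_def[abs_def] by (rule integrable_Re[OF int_mult])
  have r: "integral\<^sup>L lborel r = Re (cnj (f x) * I)"
    unfolding r_def[abs_def] I_def integral_Re[OF int_mult] integral_mult_right_zero ..
  have int_diff: "integrable lborel (\<lambda>y. indicator ?C y * (cmod (f x - f y))\<^sup>2)"
    unfolding expand
    by (intro Bochner_Integration.integrable_diff Bochner_Integration.integrable_add integrable_mult_right
        ind int_sq int_r)
  have "integral\<^sup>L lborel (\<lambda>y. indicator ?C y * (cmod (f x - f y))\<^sup>2)
      = (cmod (f x))\<^sup>2 * ?v + A - 2 * Re (cnj (f x) * I)"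
    unfolding expand A_def r[symmetric] ind(2)[symmetric]
    using ind(1) int_sq int_r by simp
  moreover have "0 \<le> A"
    unfolding A_def by (intro Bochner_Integration.integral_nonneg) auto
  moreover have "2 * Re (cnj (f x) * I) \<le> ?v / 2 * (cmod (f x))\<^sup>2 + 2 / ?v * (cmod I)\<^sup>2"
  proof -
    have v: "0 < ?v"
      using h by simp
    have "Re (cnj (f x) * I) \<le> cmod (f x) * cmod I"
      using complex_Re_le_cmod[of "cnj (f x) * I"] by (simp add: norm_mult)
    moreover have "0 \<le> (?v * cmod (f x) - 2 * cmod I)\<^sup>2 / (2 * ?v)"
      using v by simp
    moreover have "(?v * cmod (f x) - 2 * cmod I)\<^sup>2 / (2 * ?v)
        = ?v / 2 * (cmod (f x))\<^sup>2 + 2 / ?v * (cmod I)\<^sup>2 - 2 * (cmod (f x) * cmod I)"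
      using h by (simp add: field_simps power2_eq_square)
    ultimately show ?thesis
      by linarith
  qed
  ultimately have "?v * (cmod (f x))\<^sup>2
      \<le> 2 * integral\<^sup>L lborel (\<lambda>y. indicator ?C y * (cmod (f x - f y))\<^sup>2) + 4 / ?v * (cmod I)\<^sup>2"
    by (simp add: algebra_simps)
  then have "ennreal (?v * (cmod (f x))\<^sup>2)
      \<le> ennreal (2 * integral\<^sup>L lborel (\<lambda>y. indicator ?C y * (cmod (f x - f y))\<^sup>2) + 4 / ?v * (cmod I)\<^sup>2)"
    by (rule ennreal_leI)
  also have "\<dots> = 2 * ennreal (integral\<^sup>L lborel (\<lambda>y. indicator ?C y * (cmod (f x - f y))\<^sup>2)) + ennreal (4 / ?v * (cmod I)\<^sup>2)"
    using h by (simp add: ennreal_plus ennreal_mult integral_nonneg_AE)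
  also have "ennreal (integral\<^sup>L lborel (\<lambda>y. indicator ?C y * (cmod (f x - f y))\<^sup>2))
      = (\<integral>\<^sup>+y. ennreal (indicator ?C y * (cmod (f x - f y))\<^sup>2) \<partial>lborel)"
    by (rule nn_integral_eq_integral[symmetric]) (use int_diff in auto)
  also have "\<dots> = (\<integral>\<^sup>+y. indicator ?C y * ennreal ((cmod (f x - f y))\<^sup>2) \<partial>lborel)"
    by (intro nn_integral_cong) (auto simp: indicator_def)
  finally show ?thesis
    by (simp add: I_def)
qed

text \<open>The inequality \<open>|f(x)|\<^sup>2 \<le> 2 |f(x) - f(y)|\<^sup>2 + 2 |f(y)|\<^sup>2\<close>, integrated over \<open>y\<close> in the cell
  of \<open>x\<close>.\<close>

lemma cell_trivial_bound:
  fixes f :: "'a::euclidean_space \<Rightarrow> complex"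
  assumes f[measurable]: "f \<in> borel_measurable borel" and h: "0 < h"
  shows "ennreal (h ^ DIM('a) * (cmod (f x))\<^sup>2)
    \<le> 2 * (\<integral>\<^sup>+y. indicator (cell h x) y * ennreal ((cmod (f x - f y))\<^sup>2) \<partial>lborel)
      + 2 * (\<integral>\<^sup>+y. indicator (cell h x) y * ennreal ((cmod (f y))\<^sup>2) \<partial>lborel)"
proof -
  have pw: "ennreal ((cmod (f x))\<^sup>2) \<le> 2 * ennreal ((cmod (f x - f y))\<^sup>2) + 2 * ennreal ((cmod (f y))\<^sup>2)" for y
  proof -
    have "cmod (f x) \<le> cmod (f x - f y) + cmod (f y)"
      using norm_triangle_ineq[of "f x - f y" "f y"] by simp
    then have "(cmod (f x))\<^sup>2 \<le> (cmod (f x - f y) + cmod (f y))\<^sup>2"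
      by (rule power_mono) simp
    also have "\<dots> \<le> 2 * (cmod (f x - f y))\<^sup>2 + 2 * (cmod (f y))\<^sup>2"
      using sum_squares_bound[of "cmod (f x - f y)" "cmod (f y)"] by (simp add: power2_sum)
    finally have "ennreal ((cmod (f x))\<^sup>2) \<le> ennreal (2 * (cmod (f x - f y))\<^sup>2 + 2 * (cmod (f y))\<^sup>2)"
      by (rule ennreal_leI)
    then show ?thesis
      by (simp add: ennreal_plus ennreal_mult)
  qed
  have "ennreal (h ^ DIM('a) * (cmod (f x))\<^sup>2) = (\<integral>\<^sup>+y. indicator (cell h x) y * ennreal ((cmod (f x))\<^sup>2) \<partial>lborel)"
    using h by (subst nn_integral_multc) (auto simp: emeasure_cell ennreal_mult)
  also have "\<dots> \<le> (\<integral>\<^sup>+y. 2 * (indicator (cell h x) y * ennreal ((cmod (f x - f y))\<^sup>2))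
      + 2 * (indicator (cell h x) y * ennreal ((cmod (f y))\<^sup>2)) \<partial>lborel)"
    using pw by (intro nn_integral_mono) (auto simp: indicator_def)
  also have "\<dots> = 2 * (\<integral>\<^sup>+y. indicator (cell h x) y * ennreal ((cmod (f x - f y))\<^sup>2) \<partial>lborel)
      + 2 * (\<integral>\<^sup>+y. indicator (cell h x) y * ennreal ((cmod (f y))\<^sup>2) \<partial>lborel)"
    by (simp add: nn_integral_add nn_integral_cmult)
  finally show ?thesis .
qed

lemma square_integrable_indicator:
  assumes "S \<in> sets borel" "emeasure lborel S < \<infinity>"
  shows "square_integrable (indicator S)"
proof -
  have [measurable]: "S \<in> sets lebesgue"
    using assms(1) by simp
  have "integrable lebesgue (indicator S :: 'a \<Rightarrow> real)"
    using assms by (intro integrable_real_indicator) auto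
  moreover have "(\<lambda>x. (cmod (indicator S x))\<^sup>2) = (indicator S :: 'a \<Rightarrow> real)"
    by (auto simp: indicator_def)
  ultimately show ?thesis
    by (simp add: square_integrable_def)
qed

text \<open>On the chosen cells the mean value bound is used, on \<open>E\<close> the trivial bound, whose second term
  is small after exchanging the integrals because \<open>E\<close> occupies a small part of each cell.\<close>

theorem L2_mass_cells_thin_set_le:
  fixes u :: "'a::euclidean_space L2"
  assumes u: "u \<in> W12" and h: "0 < h" and S: "finite \<S>" "\<S> \<subseteq> range (cell h)"
    and E[measurable]: "E \<in> sets borel" and \<epsilon>: "0 \<le> \<epsilon>"
    and thin: "\<And>y. emeasure lborel (E \<inter> cell h y) \<le> ennreal (\<epsilon> * h ^ DIM('a))"
  shows "(\<integral>\<^sup>+x. indicator (\<Union>\<S> \<union> E) x * ennreal ((cmod (rep_L2 u x))\<^sup>2) \<partial>lebesgue)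
    \<le> ennreal (2 * 2 ^ DIM('a) * real DIM('a) * h\<^sup>2 * gradient_energy u + 2 * \<epsilon> * (norm u)\<^sup>2
        + 4 / h ^ DIM('a) * (\<Sum>S\<in>\<S>. (cmod (cinner u (conj_L2 (indicator S))))\<^sup>2))"
proof -
  let ?v = "h ^ DIM('a)" and ?D = "gradient_energy u"
  obtain f where f[measurable]: "f \<in> borel_measurable borel" and uf: "AE x in lebesgue. rep_L2 u x = f x"
    by (rule L2_borel_representative)
  have v: "0 < ?v"
    using h by simp
  have Scell: "S = cell h x" if "S \<in> \<S>" "x \<in> S" for S x
    using S(2) that cell_eq by fastforce
  have Sm[measurable]: "S \<in> sets borel" and Sv: "emeasure lborel S = ennreal ?v" if "S \<in> \<S>" for S
    using S(2) that emeasure_cell[OF h] cell_borel by auto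
  have [measurable]: "\<Union>\<S> \<in> sets borel"
    using S(1) Sm by (intro sets.finite_Union) auto
  define k where "k x = (\<integral>\<^sup>+y. indicator (cell h x) y * ennreal ((cmod (f x - f y))\<^sup>2) \<partial>lborel)" for x
  have k[measurable]: "k \<in> borel_measurable borel"
    unfolding k_def by measurable
  define t where "t x = (\<integral>\<^sup>+y. indicator (cell h x) y * ennreal ((cmod (f y))\<^sup>2) \<partial>lborel)" for x
  have t[measurable]: "t \<in> borel_measurable borel"
    unfolding t_def by measurable
  define I where "I S = integral\<^sup>L lborel (\<lambda>y. indicator S y *\<^sub>R f y)" for S
  have norm_f: "(\<integral>\<^sup>+x. ennreal ((cmod (f x))\<^sup>2) \<partial>lborel) = ennreal ((norm u)\<^sup>2)"
  proof -
    have "(\<integral>\<^sup>+x. ennreal ((cmod (f x))\<^sup>2) \<partial>lborel) = (\<integral>\<^sup>+x. ennreal ((cmod (f x))\<^sup>2) \<partial>lebesgue)"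
      by (simp add: nn_integral_completion)
    also have "\<dots> = (\<integral>\<^sup>+x. ennreal ((cmod (rep_L2 u x))\<^sup>2) \<partial>lebesgue)"
      by (rule nn_integral_cong_AE) (use uf in eventually_elim, simp)
    finally show ?thesis
      by (simp add: nn_integral_L2)
  qed
  have sq: "integrable lborel (\<lambda>x. (cmod (f x))\<^sup>2)"
    by (rule integrableI_bounded) (simp_all add: norm_f)
  have I: "cinner u (conj_L2 (indicator S)) = I S" if "S \<in> \<S>" for S
  proof -
    note [measurable] = Sm[OF that]
    have "cinner u (conj_L2 (indicator S)) = (LINT x|lebesgue. rep_L2 u x * indicator S x)"
      by (intro cinner_conj_L2 square_integrable_indicator) (simp_all add: Sm Sv that)
    also have "\<dots> = (LINT x|lebesgue. indicator S x *\<^sub>R f x)"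
    proof (rule integral_cong_AE)
      have "S \<in> sets lebesgue"
        using Sm[OF that] by simp
      then show "(\<lambda>x. rep_L2 u x * indicator S x) \<in> borel_measurable lebesgue"
        by measurable
      show "(\<lambda>x. indicator S x *\<^sub>R f x) \<in> borel_measurable lebesgue"
        by (rule measurable_completion) measurable
      show "AE x in lebesgue. rep_L2 u x * indicator S x = indicator S x *\<^sub>R f x"
        using uf by eventually_elim (auto simp: indicator_def)
    qed
    also have "\<dots> = I S"
      unfolding I_def by (rule integral_completion) measurable
    finally show ?thesis .
  qed
  have pointwise: "indicator (\<Union>\<S> \<union> E) x * ennreal (?v * (cmod (f x))\<^sup>2)
      \<le> 2 * k x + (\<Sum>S\<in>\<S>. ennreal (4 / ?v * (cmod (I S))\<^sup>2) * indicator S x) + 2 * (indicator E x * t x)" for x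
  proof (cases "x \<in> \<Union>\<S>")
    case True
    then obtain S where "S \<in> \<S>" "x \<in> S"
      by blast
    then have "S = cell h x"
      by (rule Scell)
    have "ennreal (?v * (cmod (f x))\<^sup>2) \<le> 2 * k x + ennreal (4 / ?v * (cmod (I S))\<^sup>2) * indicator S x"
      using cell_mean_value_bound[OF f sq h, of x] \<open>x \<in> S\<close> by (simp add: k_def I_def \<open>S = cell h x\<close>)
    also have "\<dots> \<le> 2 * k x + (\<Sum>S\<in>\<S>. ennreal (4 / ?v * (cmod (I S))\<^sup>2) * indicator S x)"
      using \<open>S \<in> \<S>\<close> S(1) by (intro add_left_mono member_le_sum[of S]) auto
    finally show ?thesis
      using True by (simp add: add_increasing2)
  next
    case False
    show ?thesis
    proof (cases "x \<in> E")
      case True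
      have "ennreal (?v * (cmod (f x))\<^sup>2) \<le> 2 * k x + 2 * t x"
        using cell_trivial_bound[OF f h, of x] by (simp add: k_def t_def)
      also have "\<dots> \<le> 2 * k x + (\<Sum>S\<in>\<S>. ennreal (4 / ?v * (cmod (I S))\<^sup>2) * indicator S x) + 2 * t x"
        by (intro add_right_mono) (simp add: add_increasing2)
      finally show ?thesis
        using True by simp
    qed (use False in simp)
  qed
  have thin_part: "(\<integral>\<^sup>+x. indicator E x * t x \<partial>lborel) \<le> ennreal (?v * (\<epsilon> * (norm u)\<^sup>2))"
  proof -
    have "(\<integral>\<^sup>+x. indicator E x * t x \<partial>lborel)
        = (\<integral>\<^sup>+x. (\<integral>\<^sup>+y. indicator E x * (indicator (cell h x) y * ennreal ((cmod (f y))\<^sup>2)) \<partial>lborel) \<partial>lborel)"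
      unfolding t_def by (intro nn_integral_cong nn_integral_cmult[symmetric]) measurable
    also have "\<dots> = (\<integral>\<^sup>+y. (\<integral>\<^sup>+x. indicator E x * (indicator (cell h x) y * ennreal ((cmod (f y))\<^sup>2)) \<partial>lborel) \<partial>lborel)"
      by (rule lborel_pair.Fubini'[symmetric]) measurable
    also have "\<dots> = (\<integral>\<^sup>+y. ennreal ((cmod (f y))\<^sup>2) * emeasure lborel (E \<inter> cell h y) \<partial>lborel)"
    proof (rule nn_integral_cong)
      fix y
      have "(\<integral>\<^sup>+x. indicator E x * (indicator (cell h x) y * ennreal ((cmod (f y))\<^sup>2)) \<partial>lborel)
          = (\<integral>\<^sup>+x. ennreal ((cmod (f y))\<^sup>2) * indicator (E \<inter> cell h y) x \<partial>lborel)"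
        by (intro nn_integral_cong) (auto simp: indicator_def mem_cell_commute)
      also have "\<dots> = ennreal ((cmod (f y))\<^sup>2) * emeasure lborel (E \<inter> cell h y)"
        by (rule nn_integral_cmult_indicator) simp
      finally show "(\<integral>\<^sup>+x. indicator E x * (indicator (cell h x) y * ennreal ((cmod (f y))\<^sup>2)) \<partial>lborel)
          = ennreal ((cmod (f y))\<^sup>2) * emeasure lborel (E \<inter> cell h y)" .
    qed
    also have "\<dots> \<le> (\<integral>\<^sup>+y. ennreal ((cmod (f y))\<^sup>2) * ennreal (\<epsilon> * ?v) \<partial>lborel)"
      by (intro nn_integral_mono mult_left_mono thin) simp
    also have "\<dots> = ennreal ((norm u)\<^sup>2) * ennreal (\<epsilon> * ?v)"
      by (simp add: nn_integral_multc norm_f)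
    also have "\<dots> = ennreal (?v * (\<epsilon> * (norm u)\<^sup>2))"
      using \<epsilon> v by (simp add: ennreal_mult[symmetric] mult_ac)
    finally show ?thesis .
  qed
  have "ennreal ?v * (\<integral>\<^sup>+x. indicator (\<Union>\<S> \<union> E) x * ennreal ((cmod (f x))\<^sup>2) \<partial>lborel)
      = (\<integral>\<^sup>+x. indicator (\<Union>\<S> \<union> E) x * ennreal (?v * (cmod (f x))\<^sup>2) \<partial>lborel)"
    using v by (subst nn_integral_cmult[symmetric]) (auto intro!: nn_integral_cong simp: ennreal_mult mult_ac)
  also have "\<dots> \<le> (\<integral>\<^sup>+x. 2 * k x + (\<Sum>S\<in>\<S>. ennreal (4 / ?v * (cmod (I S))\<^sup>2) * indicator S x)
      + 2 * (indicator E x * t x) \<partial>lborel)"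
    by (rule nn_integral_mono) (rule pointwise)
  also have "\<dots> = 2 * (\<integral>\<^sup>+x. k x \<partial>lborel) + (\<Sum>S\<in>\<S>. ennreal (4 / ?v * (cmod (I S))\<^sup>2) * ennreal ?v)
      + 2 * (\<integral>\<^sup>+x. indicator E x * t x \<partial>lborel)"
  proof -
    have "(\<integral>\<^sup>+x. (\<Sum>S\<in>\<S>. ennreal (4 / ?v * (cmod (I S))\<^sup>2) * indicator S x) \<partial>lborel)
        = (\<Sum>S\<in>\<S>. ennreal (4 / ?v * (cmod (I S))\<^sup>2) * ennreal ?v)"
      by (subst nn_integral_sum) (auto simp: Sm Sv nn_integral_cmult_indicator intro!: sum.cong)
    moreover have "(\<lambda>x. \<Sum>S\<in>\<S>. ennreal (4 / ?v * (cmod (I S))\<^sup>2) * indicator S x) \<in> borel_measurable lborel"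
      using Sm by (intro borel_measurable_sum) auto
    ultimately show ?thesis
      by (simp add: nn_integral_add nn_integral_cmult)
  qed
  also have "\<dots> \<le> 2 * ennreal ((2 * h) ^ DIM('a) * (real DIM('a) * h\<^sup>2 * ?D))
      + (\<Sum>S\<in>\<S>. ennreal (4 / ?v * (cmod (I S))\<^sup>2) * ennreal ?v) + 2 * ennreal (?v * (\<epsilon> * (norm u)\<^sup>2))"
    using nn_integral_cell_differences_le[OF f uf u h] thin_part
    by (intro add_mono mult_left_mono) (auto simp: k_def)
  also have "\<dots> = ennreal ?v * ennreal (2 * 2 ^ DIM('a) * real DIM('a) * h\<^sup>2 * ?D + 2 * \<epsilon> * (norm u)\<^sup>2
        + 4 / ?v * (\<Sum>S\<in>\<S>. (cmod (I S))\<^sup>2))"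
  proof -
    have nonneg: "0 \<le> ?D"
      by (intro sum_nonneg) simp
    have "(\<Sum>S\<in>\<S>. ennreal (4 / ?v * (cmod (I S))\<^sup>2) * ennreal ?v) = (\<Sum>S\<in>\<S>. ennreal (4 * (cmod (I S))\<^sup>2))"
      using h by (intro sum.cong refl) (simp add: ennreal_mult[symmetric])
    also have "\<dots> = ennreal (4 * (\<Sum>S\<in>\<S>. (cmod (I S))\<^sup>2))"
      by (simp add: sum_distrib_left)
    finally have sum: "(\<Sum>S\<in>\<S>. ennreal (4 / ?v * (cmod (I S))\<^sup>2) * ennreal ?v) = ennreal (4 * (\<Sum>S\<in>\<S>. (cmod (I S))\<^sup>2))" .
    have two: "2 * ennreal a = ennreal (2 * a)" for a
      by (simp add: ennreal_mult')
    have "ennreal (2 * ((2 * h) ^ DIM('a) * (real DIM('a) * h\<^sup>2 * ?D)) + 4 * (\<Sum>S\<in>\<S>. (cmod (I S))\<^sup>2)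
          + 2 * (?v * (\<epsilon> * (norm u)\<^sup>2)))
        = ennreal (?v * (2 * 2 ^ DIM('a) * real DIM('a) * h\<^sup>2 * ?D + 2 * \<epsilon> * (norm u)\<^sup>2
        + 4 / ?v * (\<Sum>S\<in>\<S>. (cmod (I S))\<^sup>2)))"
      using h by (intro arg_cong[where f = ennreal]) (simp add: power_mult_distrib field_simps)
    then show ?thesis
      unfolding sum two using h \<epsilon> nonneg
      by (simp add: ennreal_plus[symmetric] ennreal_mult'[symmetric] sum_nonneg del: ennreal_plus)
  qed
  finally have "(\<integral>\<^sup>+x. indicator (\<Union>\<S> \<union> E) x * ennreal ((cmod (f x))\<^sup>2) \<partial>lborel)
      \<le> ennreal (2 * 2 ^ DIM('a) * real DIM('a) * h\<^sup>2 * ?D + 2 * \<epsilon> * (norm u)\<^sup>2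
        + 4 / ?v * (\<Sum>S\<in>\<S>. (cmod (I S))\<^sup>2))"
    using h by (subst (asm) ennreal_mult_le_mult_iff) auto
  moreover have "(\<integral>\<^sup>+x. indicator (\<Union>\<S> \<union> E) x * ennreal ((cmod (rep_L2 u x))\<^sup>2) \<partial>lebesgue)
      = (\<integral>\<^sup>+x. indicator (\<Union>\<S> \<union> E) x * ennreal ((cmod (f x))\<^sup>2) \<partial>lborel)"
  proof -
    have "(\<integral>\<^sup>+x. indicator (\<Union>\<S> \<union> E) x * ennreal ((cmod (rep_L2 u x))\<^sup>2) \<partial>lebesgue)
        = (\<integral>\<^sup>+x. indicator (\<Union>\<S> \<union> E) x * ennreal ((cmod (f x))\<^sup>2) \<partial>lebesgue)"
      by (rule nn_integral_cong_AE) (use uf in eventually_elim, simp)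
    also have "\<dots> = (\<integral>\<^sup>+x. indicator (\<Union>\<S> \<union> E) x * ennreal ((cmod (f x))\<^sup>2) \<partial>lborel)"
      by (rule nn_integral_completion) measurable
    finally show ?thesis .
  qed
  ultimately show ?thesis
    using I by simp
qed


section \<open>Weighted forms\<close>

definition weighted_form :: "('a::euclidean_space \<Rightarrow> real) \<Rightarrow> 'a L2 \<Rightarrow> 'a L2 \<Rightarrow> complex" where
  "weighted_form w u v = (LINT x|lebesgue. complex_of_real (w x) * (rep_L2 u x * cnj (rep_L2 v x)))"

definition weight_integrable :: "('a::euclidean_space \<Rightarrow> real) \<Rightarrow> 'a L2 \<Rightarrow> bool" where
  "weight_integrable w u \<longleftrightarrow> integrable lebesgue (\<lambda>x. w x * (cmod (rep_L2 u x))\<^sup>2)"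

lemma integrable_weighted_form:
  assumes w[measurable]: "w \<in> borel_measurable lebesgue" "\<And>x. 0 \<le> w x"
    and "weight_integrable w u" "weight_integrable w v"
  shows "integrable lebesgue (\<lambda>x. complex_of_real (w x) * (rep_L2 u x * cnj (rep_L2 v x)))"
proof (rule Bochner_Integration.integrable_bound)
  show "integrable lebesgue (\<lambda>x. w x * (cmod (rep_L2 u x))\<^sup>2 + w x * (cmod (rep_L2 v x))\<^sup>2)"
    using assms by (simp add: weight_integrable_def)
  show "(\<lambda>x. complex_of_real (w x) * (rep_L2 u x * cnj (rep_L2 v x))) \<in> borel_measurable lebesgue"
    by measurable
  have "a * b \<le> a\<^sup>2 + b\<^sup>2" if "0 \<le> a" "0 \<le> b" for a b :: real
    using sum_squares_bound[of a b] mult_nonneg_nonneg[OF that] by linarith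
  then have "w x * (cmod (rep_L2 u x) * cmod (rep_L2 v x))
      \<le> w x * ((cmod (rep_L2 u x))\<^sup>2 + (cmod (rep_L2 v x))\<^sup>2)" for x
    by (intro mult_left_mono w) auto
  then show "AE x in lebesgue. norm (complex_of_real (w x) * (rep_L2 u x * cnj (rep_L2 v x)))
      \<le> norm (w x * (cmod (rep_L2 u x))\<^sup>2 + w x * (cmod (rep_L2 v x))\<^sup>2)"
    by (intro always_eventually allI) (simp add: norm_mult w distrib_left)
qed

lemma weighted_form_add_left:
  assumes w[measurable]: "w \<in> borel_measurable lebesgue" "\<And>x. 0 \<le> w x"
    and "weight_integrable w u" "weight_integrable w v" "weight_integrable w y"
  shows "weighted_form w (u + v) y = weighted_form w u y + weighted_form w v y"
proof -
  have "weighted_form w (u + v) y = (LINT x|lebesgue. complex_of_real (w x) * (rep_L2 u x * cnj (rep_L2 y x))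
      + complex_of_real (w x) * (rep_L2 v x * cnj (rep_L2 y x)))"
    unfolding weighted_form_def
  proof (rule integral_cong_AE)
    show "AE x in lebesgue. complex_of_real (w x) * (rep_L2 (u + v) x * cnj (rep_L2 y x))
        = complex_of_real (w x) * (rep_L2 u x * cnj (rep_L2 y x))
      + complex_of_real (w x) * (rep_L2 v x * cnj (rep_L2 y x))"
      using rep_plus_L2[of u v] by eventually_elim (simp add: algebra_simps)
  qed measurable
  then show ?thesis
    using assms by (simp add: integrable_weighted_form weighted_form_def)
qed

lemma weighted_form_scale_left:
  assumes [measurable]: "w \<in> borel_measurable lebesgue"
  shows "weighted_form w (c *\<^sub>C u) v = c * weighted_form w u v"
proof -
  have "weighted_form w (c *\<^sub>C u) v
      = (LINT x|lebesgue. c * (complex_of_real (w x) * (rep_L2 u x * cnj (rep_L2 v x))))"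
    unfolding weighted_form_def
  proof (rule integral_cong_AE)
    show "AE x in lebesgue. complex_of_real (w x) * (rep_L2 (c *\<^sub>C u) x * cnj (rep_L2 v x))
        = c * (complex_of_real (w x) * (rep_L2 u x * cnj (rep_L2 v x)))"
      using rep_scaleC[of c u] by eventually_elim simp
  qed measurable
  then show ?thesis
    by (simp add: weighted_form_def)
qed

lemma weighted_form_commute: "weighted_form w u v = cnj (weighted_form w v u)"
  unfolding weighted_form_def
  by (subst Bochner_Integration.integral_cnj[symmetric]) (simp add: mult.commute)

lemma weighted_form_self:
  "weighted_form w u u = complex_of_real ((LINT x|lebesgue. w x * (cmod (rep_L2 u x))\<^sup>2))"
proof -
  have "complex_of_real (w x) * (rep_L2 u x * cnj (rep_L2 u x)) = complex_of_real (w x * (cmod (rep_L2 u x))\<^sup>2)" for x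
    by (simp add: of_real_cmod_square)
  then show ?thesis
    by (simp only: weighted_form_def integral_complex_of_real)
qed

lemma Re_dirichlet_form_self: "Re (dirichlet_form u u) = gradient_energy u"
  by (simp add: dirichlet_form_def cinner_self_norm)

section \<open>The potential energy of an extended-valued potential\<close>

abbreviation potential_energy :: "('a::euclidean_space \<Rightarrow> ennreal) \<Rightarrow> 'a L2 \<Rightarrow> ennreal" where
  "potential_energy V u \<equiv> (\<integral>\<^sup>+x. V x * ennreal ((cmod (rep_L2 u x))\<^sup>2) \<partial>lebesgue)"

lemma potential_energy_scaleC:
  assumes [measurable]: "V \<in> borel_measurable lebesgue"
  shows "potential_energy V (c *\<^sub>C u) = ennreal ((cmod c)\<^sup>2) * potential_energy V u"
proof -
  have "potential_energy V (c *\<^sub>C u) = (\<integral>\<^sup>+x. ennreal ((cmod c)\<^sup>2) * (V x * ennreal ((cmod (rep_L2 u x))\<^sup>2)) \<partial>lebesgue)"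
    by (rule nn_integral_cong_AE)
      (use rep_scaleC[of c u] in eventually_elim, simp add: norm_mult power_mult_distrib ennreal_mult mult_ac)
  then show ?thesis
    by (simp add: nn_integral_cmult)
qed

lemma potential_energy_add_le:
  assumes [measurable]: "V \<in> borel_measurable lebesgue"
  shows "potential_energy V (u + v) \<le> 2 * potential_energy V u + 2 * potential_energy V v"
proof -
  have "potential_energy V (u + v) \<le> (\<integral>\<^sup>+x. 2 * (V x * ennreal ((cmod (rep_L2 u x))\<^sup>2))
      + 2 * (V x * ennreal ((cmod (rep_L2 v x))\<^sup>2)) \<partial>lebesgue)"
  proof (rule nn_integral_mono_AE)
    show "AE x in lebesgue. V x * ennreal ((cmod (rep_L2 (u + v) x))\<^sup>2)
        \<le> 2 * (V x * ennreal ((cmod (rep_L2 u x))\<^sup>2)) + 2 * (V x * ennreal ((cmod (rep_L2 v x))\<^sup>2))"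
      using rep_plus_L2[of u v]
    proof eventually_elim
      case (elim x)
      have "(cmod (rep_L2 u x + rep_L2 v x))\<^sup>2 \<le> (cmod (rep_L2 u x) + cmod (rep_L2 v x))\<^sup>2"
        by (intro power_mono norm_triangle_ineq) simp
      also have "\<dots> \<le> 2 * (cmod (rep_L2 u x))\<^sup>2 + 2 * (cmod (rep_L2 v x))\<^sup>2"
        using sum_squares_bound[of "cmod (rep_L2 u x)" "cmod (rep_L2 v x)"] by (simp add: power2_sum)
      finally have "V x * ennreal ((cmod (rep_L2 u x + rep_L2 v x))\<^sup>2)
          \<le> V x * ennreal (2 * (cmod (rep_L2 u x))\<^sup>2 + 2 * (cmod (rep_L2 v x))\<^sup>2)"
        by (intro mult_left_mono ennreal_leI) auto
      also have "\<dots> = 2 * (V x * ennreal ((cmod (rep_L2 u x))\<^sup>2)) + 2 * (V x * ennreal ((cmod (rep_L2 v x))\<^sup>2))"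
        by (simp add: ennreal_plus ennreal_mult distrib_left mult_ac)
      finally show ?case
        using elim by simp
    qed
  qed
  also have "\<dots> = 2 * potential_energy V u + 2 * potential_energy V v"
    by (simp add: nn_integral_add nn_integral_cmult)
  finally show ?thesis .
qed

text \<open>Where the potential is infinite, a function of finite potential energy vanishes almost
  everywhere; there the integrands agree although \<open>enn2real\<close> maps \<open>\<infinity>\<close> to \<open>0\<close>.\<close>

lemma potential_energy_finite_imp:
  assumes V[measurable]: "V \<in> borel_measurable lebesgue" and fin: "potential_energy V u < \<infinity>"
  shows "weight_integrable (\<lambda>x. enn2real (V x)) u"
    and "ennreal ((LINT x|lebesgue. enn2real (V x) * (cmod (rep_L2 u x))\<^sup>2)) = potential_energy V u"
proof -
  have "AE x in lebesgue. V x * ennreal ((cmod (rep_L2 u x))\<^sup>2) \<noteq> \<infinity>"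
    using fin by (intro nn_integral_PInf_AE) auto
  then have eq: "AE x in lebesgue. ennreal (enn2real (V x) * (cmod (rep_L2 u x))\<^sup>2) = V x * ennreal ((cmod (rep_L2 u x))\<^sup>2)"
  proof eventually_elim
    case (elim x)
    show ?case
    proof (cases "rep_L2 u x = 0")
      case False
      then have "V x \<noteq> top"
        using elim by (auto simp: ennreal_top_mult)
      then show ?thesis
        by (simp add: ennreal_mult less_top)
    qed simp
  qed
  have nn: "(\<integral>\<^sup>+x. ennreal (enn2real (V x) * (cmod (rep_L2 u x))\<^sup>2) \<partial>lebesgue) = potential_energy V u"
    by (rule nn_integral_cong_AE[OF eq])
  show int: "weight_integrable (\<lambda>x. enn2real (V x)) u"
    unfolding weight_integrable_def
    by (rule integrableI_nonneg) (use fin nn in auto)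
  show "ennreal ((LINT x|lebesgue. enn2real (V x) * (cmod (rep_L2 u x))\<^sup>2)) = potential_energy V u"
    unfolding nn[symmetric]
    by (rule nn_integral_eq_integral[symmetric]) (use int in \<open>auto simp: weight_integrable_def\<close>)
qed

text \<open>Multiplication by \<open>\<infinity>\<close> is lower semicontinuous, though not continuous.\<close>

lemma ennreal_mult_le_liminf:
  fixes a L :: ennreal
  assumes "f \<longlonglongrightarrow> L"
  shows "a * L \<le> liminf (\<lambda>n. a * f n)"
proof (cases "a = top")
  case False
  then have "(\<lambda>n. a * f n) \<longlonglongrightarrow> a * L"
    by (intro ennreal_tendsto_cmult assms) (simp add: less_top)
  then show ?thesis
    by (simp add: lim_imp_Liminf)
next
  case True
  show ?thesis
  proof (cases "L = 0")
    case False
    then have "\<forall>\<^sub>F n in sequentially. 0 < f n"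
      by (intro order_tendstoD(1)[OF assms]) (simp add: zero_less_iff_neq_zero)
    then have "\<forall>\<^sub>F n in sequentially. top \<le> a * f n"
      by eventually_elim (simp add: True ennreal_top_mult)
    then have "top \<le> liminf (\<lambda>n. a * f n)"
      by (rule Liminf_bounded)
    then show ?thesis
      using top_greatest order_trans by blast
  qed simp
qed

text \<open>Fatou's lemma along a subsequence that converges almost everywhere.\<close>

lemma potential_energy_lower_semicontinuous:
  assumes V[measurable]: "V \<in> borel_measurable lebesgue" and lim: "U \<longlonglongrightarrow> l"
    and bound: "\<And>n. potential_energy V (U n) \<le> e"
  shows "potential_energy V l \<le> e"
proof -
  obtain r where r: "AE x in lebesgue. (\<lambda>n. rep_L2 (U (r n)) x) \<longlonglongrightarrow> rep_L2 l x"
    using L2_tendsto_AE_subseq[OF lim] by blast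
  have "potential_energy V l \<le> (\<integral>\<^sup>+x. liminf (\<lambda>n. V x * ennreal ((cmod (rep_L2 (U (r n)) x))\<^sup>2)) \<partial>lebesgue)"
  proof (rule nn_integral_mono_AE)
    show "AE x in lebesgue. V x * ennreal ((cmod (rep_L2 l x))\<^sup>2)
        \<le> liminf (\<lambda>n. V x * ennreal ((cmod (rep_L2 (U (r n)) x))\<^sup>2))"
      using r by eventually_elim (intro ennreal_mult_le_liminf tendsto_intros)
  qed
  also have "\<dots> \<le> liminf (\<lambda>n. potential_energy V (U (r n)))"
    by (rule nn_integral_liminf) measurable
  also have "\<dots> \<le> liminf (\<lambda>n. e)"
    by (intro Liminf_mono always_eventually allI bound)
  finally show ?thesis
    by (simp add: Liminf_const)
qed

lemma form_domain_iff: "u \<in> form_domain V \<longleftrightarrow> u \<in> W12 \<and> potential_energy V u < \<infinity>"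
  by (simp add: form_domain_def)

lemma form_domain_subspace:
  assumes V: "V \<in> borel_measurable lebesgue"
  shows "L2.subspace (form_domain V)"
proof (rule L2.subspaceI)
  have "potential_energy V 0 = 0"
    using potential_energy_scaleC[OF V, of 0 0] by simp
  then show "0 \<in> form_domain V"
    by (simp add: form_domain_iff L2.subspace_0[OF W12_subspace])
  show "x + y \<in> form_domain V" if "x \<in> form_domain V" "y \<in> form_domain V" for x y
  proof -
    have "2 * potential_energy V x + 2 * potential_energy V y < \<infinity>"
      using that by (simp add: form_domain_iff ennreal_mult_less_top)
    then have "potential_energy V (x + y) < \<infinity>"
      by (rule le_less_trans[OF potential_energy_add_le[OF V]])
    moreover have "x + y \<in> W12"
      using that by (intro L2.subspace_add[OF W12_subspace]) (simp_all add: form_domain_iff)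
    ultimately show ?thesis
      by (simp add: form_domain_iff)
  qed
  show "c *\<^sub>C x \<in> form_domain V" if "x \<in> form_domain V" for c x
    using that L2.subspace_scale[OF W12_subspace, of x c]
    by (simp add: form_domain_iff potential_energy_scaleC[OF V] ennreal_mult_less_top)
qed

section \<open>The Schroedinger form\<close>

locale schroedinger_potentials =
  fixes Vp :: "'a::euclidean_space \<Rightarrow> ennreal" and Vm :: "'a \<Rightarrow> real" and q C :: real
  assumes Vp [measurable]: "Vp \<in> borel_measurable lebesgue"
    and Vm [measurable]: "Vm \<in> borel_measurable lebesgue" and Vm_nonneg: "0 \<le> Vm x"
    and q: "0 \<le> q" "q < 1" and C: "0 \<le> C"
    and Vm_integrable: "u \<in> W12 \<Longrightarrow> weight_integrable Vm u"
    and Vm_bound: "u \<in> W12 \<Longrightarrow>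
      (LINT x|lebesgue. Vm x * (cmod (rep_L2 u x))\<^sup>2) \<le> q * gradient_energy u + C * (norm u)\<^sup>2"
begin

abbreviation "Q \<equiv> form_domain Vp"
abbreviation "a \<equiv> schroedinger_form Vp Vm"
abbreviation "P u \<equiv> (LINT x|lebesgue. enn2real (Vp x) * (cmod (rep_L2 u x))\<^sup>2)"

lemma a_eq: "a u v = dirichlet_form u v + weighted_form (\<lambda>x. enn2real (Vp x)) u v - weighted_form Vm u v"
  by (simp add: schroedinger_form_def weighted_form_def)

lemma Q_W12: "u \<in> Q \<Longrightarrow> u \<in> W12"
  by (simp add: form_domain_iff)

lemma Vp_integrable: "u \<in> Q \<Longrightarrow> weight_integrable (\<lambda>x. enn2real (Vp x)) u"
  by (simp add: form_domain_iff potential_energy_finite_imp(1)[OF Vp])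

lemma P_eq: "u \<in> Q \<Longrightarrow> ennreal (P u) = potential_energy Vp u"
  by (simp add: form_domain_iff potential_energy_finite_imp(2)[OF Vp])

lemma P_nonneg: "0 \<le> P u"
  by (intro Bochner_Integration.integral_nonneg) auto

lemma gradient_energy_nonneg: "0 \<le> gradient_energy u"
  by (intro sum_nonneg) auto

sublocale a: hermitian_form Q a
proof
  show "L2.subspace Q"
    by (rule form_domain_subspace[OF Vp])
next
  fix u v w assume uv: "u \<in> Q" "v \<in> Q" and w: "w \<in> Q"
  have "dirichlet_form (u + v) w = dirichlet_form u w + dirichlet_form v w"
    using uv by (simp add: dirichlet_form_def weak_deriv_add Q_W12 cinner_add_left sum.distrib)
  moreover have "weighted_form (\<lambda>x. enn2real (Vp x)) (u + v) w
      = weighted_form (\<lambda>x. enn2real (Vp x)) u w + weighted_form (\<lambda>x. enn2real (Vp x)) v w"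
    using uv w by (intro weighted_form_add_left Vp_integrable) auto
  moreover have "weighted_form Vm (u + v) w = weighted_form Vm u w + weighted_form Vm v w"
    using uv w by (intro weighted_form_add_left Vm_integrable Vm_nonneg Q_W12) auto
  ultimately show "a (u + v) w = a u w + a v w"
    by (simp add: a_eq)
next
  fix u v c assume uv: "u \<in> Q" "v \<in> Q"
  have "dirichlet_form (c *\<^sub>C u) v = c * dirichlet_form u v"
    using uv by (simp add: dirichlet_form_def weak_deriv_scaleC Q_W12 cinner_scaleC_left sum_distrib_left)
  then show "a (c *\<^sub>C u) v = c * a u v"
    by (simp add: a_eq weighted_form_scale_left algebra_simps)
next
  fix u v assume "u \<in> Q" "v \<in> Q"
  have "dirichlet_form u v = cnj (dirichlet_form v u)"
    unfolding dirichlet_form_def cnj_sum by (intro sum.cong refl cinner_commute)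
  then show "a u v = cnj (a v u)"
    using weighted_form_commute[of "\<lambda>x. enn2real (Vp x)" u v] weighted_form_commute[of Vm u v]
    by (simp add: a_eq)
qed

text \<open>The negative part of the potential uses up at most the fraction \<open>q\<close> of the gradient energy.\<close>

lemma a_self:
  assumes "u \<in> Q"
  shows "(1 - q) * gradient_energy u + P u - C * (norm u)\<^sup>2 \<le> Re (a u u)"
    and "Re (a u u) \<le> gradient_energy u + P u"
proof -
  let ?m = "(LINT x|lebesgue. Vm x * (cmod (rep_L2 u x))\<^sup>2)"
  have "Re (a u u) = gradient_energy u + P u - ?m"
    by (simp add: a_eq Re_dirichlet_form_self weighted_form_self)
  moreover have "0 \<le> ?m"
    by (intro Bochner_Integration.integral_nonneg) (auto simp: Vm_nonneg)
  ultimately show "(1 - q) * gradient_energy u + P u - C * (norm u)\<^sup>2 \<le> Re (a u u)"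
    "Re (a u u) \<le> gradient_energy u + P u"
    using Vm_bound[OF Q_W12[OF assms]] by (simp_all add: algebra_simps)
qed

text \<open>Adding this multiple of the identity makes the form coercive.\<close>

definition shift :: real where
  "shift = C + 1"

definition h :: "'a L2 \<Rightarrow> 'a L2 \<Rightarrow> complex" where
  "h u v = a u v + complex_of_real shift * cinner u v"

lemma Re_h_self: "Re (h u u) = Re (a u u) + shift * (norm u)\<^sup>2"
  by (simp add: h_def cinner_self_norm)

lemma h_lower:
  assumes "u \<in> Q"
  shows "(1 - q) * gradient_energy u + P u + (norm u)\<^sup>2 \<le> Re (h u u)"
  using a_self(1)[OF assms] by (simp add: Re_h_self shift_def algebra_simps)

text \<open>The three terms of the form norm converge separately: the gradients because weak
  derivatives are closed, the potential energy by lower semicontinuity.\<close>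

sublocale h: closed_coercive_form Q h
proof
  show "L2.subspace Q"
    by (rule a.subspace)
  show "h (u + v) w = h u w + h v w" if "u \<in> Q" "v \<in> Q" "w \<in> Q" for u v w
    using that by (simp add: h_def a.add_left cinner_add_left algebra_simps)
  show "h (c *\<^sub>C u) v = c * h u v" if "u \<in> Q" "v \<in> Q" for c u v
    using that by (simp add: h_def a.scale_left cinner_scaleC_left algebra_simps)
  show "h u v = cnj (h v u)" if "u \<in> Q" "v \<in> Q" for u v
    using a.commute[OF that] cinner_commute[of u v] by (simp add: h_def)
  show "(norm u)\<^sup>2 \<le> Re (h u u)" if "u \<in> Q" for u
  proof -
    have "0 \<le> (1 - q) * gradient_energy u"
      using q gradient_energy_nonneg by (intro mult_nonneg_nonneg) auto
    with h_lower[OF that] P_nonneg[of u] show ?thesis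
      by linarith
  qed
  fix U :: "nat \<Rightarrow> 'a L2" and l
  assume U: "\<And>n. U n \<in> Q" and lim: "U \<longlonglongrightarrow> l"
    and Cau: "\<And>e. 0 < e \<Longrightarrow> \<exists>N. \<forall>m\<ge>N. \<forall>n\<ge>N. Re (h (U m - U n) (U m - U n)) < e"
  have UQ: "U m - U n \<in> Q" for m n
    using U a.mem_diff by blast
  have "\<exists>g. (\<lambda>n. weak_deriv (U n) b) \<longlonglongrightarrow> g" if b: "b \<in> Basis" for b
  proof -
    have "Cauchy (\<lambda>n. weak_deriv (U n) b)"
    proof (rule CauchyI)
      fix e :: real assume "0 < e"
      then obtain N where N: "\<And>m n. N \<le> m \<Longrightarrow> N \<le> n \<Longrightarrow> Re (h (U m - U n) (U m - U n)) < (1 - q) * e\<^sup>2"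
        using Cau[of "(1 - q) * e\<^sup>2"] q by auto
      have "norm (weak_deriv (U m) b - weak_deriv (U n) b) < e" if "N \<le> m" "N \<le> n" for m n
      proof -
        have "(norm (weak_deriv (U m) b - weak_deriv (U n) b))\<^sup>2 \<le> gradient_energy (U m - U n)"
          using b U member_le_sum[of b Basis "\<lambda>b. (norm (weak_deriv (U m - U n) b))\<^sup>2"]
          by (simp add: weak_deriv_diff[OF Q_W12 Q_W12, symmetric])
        then have "(1 - q) * (norm (weak_deriv (U m) b - weak_deriv (U n) b))\<^sup>2
            \<le> (1 - q) * gradient_energy (U m - U n)"
          using q by (intro mult_left_mono) auto
        also have "\<dots> < (1 - q) * e\<^sup>2"
          using h_lower[OF UQ, of m n] P_nonneg[of "U m - U n"] N[OF that]
            zero_le_power2[of "norm (U m - U n)"] by linarith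
        finally have "(norm (weak_deriv (U m) b - weak_deriv (U n) b))\<^sup>2 < e\<^sup>2"
          using q by simp
        then show ?thesis
          using \<open>0 < e\<close> by (intro power2_less_imp_less[of _ e]) auto
      qed
      then show "\<exists>M. \<forall>m\<ge>M. \<forall>n\<ge>M. norm (weak_deriv (U m) b - weak_deriv (U n) b) < e"
        by blast
    qed
    then show ?thesis
      using Cauchy_convergent convergent_def by blast
  qed
  then obtain g where g: "\<And>b. b \<in> Basis \<Longrightarrow> (\<lambda>n. weak_deriv (U n) b) \<longlonglongrightarrow> g b"
    by metis
  have wd: "has_weak_deriv l b (g b)" if "b \<in> Basis" for b
    using has_weak_deriv_tendsto[OF _ lim g[OF that]] has_weak_deriv_weak_deriv[OF Q_W12[OF U] that] by blast
  then have l_W12: "l \<in> W12"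
    unfolding W12_def by blast
  have tail: "\<exists>N. \<forall>n\<ge>N. potential_energy Vp (U n - l) \<le> ennreal e" if "0 < e" for e
  proof -
    obtain N where N: "\<And>m n. N \<le> m \<Longrightarrow> N \<le> n \<Longrightarrow> Re (h (U m - U n) (U m - U n)) < e"
      using Cau[OF \<open>0 < e\<close>] by auto
    have "potential_energy Vp (U n - l) \<le> ennreal e" if n: "N \<le> n" for n
    proof (rule potential_energy_lower_semicontinuous[OF Vp])
      show "(\<lambda>m. U n - U (m + N)) \<longlonglongrightarrow> U n - l"
        by (intro tendsto_intros LIMSEQ_ignore_initial_segment lim)
      show "potential_energy Vp (U n - U (m + N)) \<le> ennreal e" for m
      proof -
        have "0 \<le> (1 - q) * gradient_energy (U n - U (m + N))"
          using q gradient_energy_nonneg by (intro mult_nonneg_nonneg) auto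
        then have "P (U n - U (m + N)) \<le> e"
          using h_lower[OF UQ, of n "m + N"] N[OF n, of "m + N"] zero_le_power2[of "norm (U n - U (m + N))"]
          by linarith
        then show ?thesis
          unfolding P_eq[OF UQ, symmetric] by (rule ennreal_leI)
      qed
    qed
    then show ?thesis
      by blast
  qed
  obtain N where "potential_energy Vp (U N - l) \<le> ennreal 1"
    using tail[of 1] by auto
  then have "U N - l \<in> Q"
    using L2.subspace_diff[OF W12_subspace Q_W12[OF U] l_W12]
    by (auto simp: form_domain_iff intro: le_less_trans)
  then have "U N - (U N - l) \<in> Q"
    by (rule a.mem_diff[OF U])
  then have l: "l \<in> Q"
    by simp
  then have UlQ: "U n - l \<in> Q" for n
    using U a.mem_diff by blast
  have "(\<lambda>n. gradient_energy (U n - l) + P (U n - l) + shift * (norm (U n - l))\<^sup>2) \<longlonglongrightarrow> 0 + 0 + shift * 0"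
  proof (intro tendsto_add tendsto_mult tendsto_const)
    have "(\<lambda>n. \<Sum>b\<in>Basis. (norm (weak_deriv (U n) b - g b))\<^sup>2) \<longlonglongrightarrow> (\<Sum>b\<in>(Basis :: 'a set). (norm (g b - g b))\<^sup>2)"
      by (intro tendsto_intros g)
    moreover have "gradient_energy (U n - l) = (\<Sum>b\<in>Basis. (norm (weak_deriv (U n) b - g b))\<^sup>2)" for n
      by (intro sum.cong refl) (simp add: weak_deriv_diff[OF Q_W12[OF U] l_W12] weak_deriv_eqI[OF wd])
    ultimately show "(\<lambda>n. gradient_energy (U n - l)) \<longlonglongrightarrow> 0"
      by simp
    have P_small: "\<exists>N. \<forall>n\<ge>N. P (U n - l) \<le> e" if "0 < e" for e
      using tail[OF that] that unfolding P_eq[OF UlQ, symmetric] by simp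
    show "(\<lambda>n. P (U n - l)) \<longlonglongrightarrow> 0"
    proof (rule LIMSEQ_I)
      fix e :: real assume "0 < e"
      then obtain N where N: "\<And>n. N \<le> n \<Longrightarrow> P (U n - l) \<le> e / 2"
        using P_small[of "e / 2"] by auto
      have "norm (P (U n - l) - 0) < e" if "N \<le> n" for n
        using N[OF that] P_nonneg[of "U n - l"] \<open>0 < e\<close> by simp
      then show "\<exists>N. \<forall>n\<ge>N. norm (P (U n - l) - 0) < e"
        by blast
    qed
    have "(\<lambda>n. (norm (U n - l))\<^sup>2) \<longlonglongrightarrow> (norm (l - l))\<^sup>2"
      by (intro tendsto_intros lim)
    then show "(\<lambda>n. (norm (U n - l))\<^sup>2) \<longlonglongrightarrow> 0"
      by simp
  qed
  then have upper: "(\<lambda>n. gradient_energy (U n - l) + P (U n - l) + shift * (norm (U n - l))\<^sup>2) \<longlonglongrightarrow> 0"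
    by simp
  have "(\<lambda>n. Re (h (U n - l) (U n - l))) \<longlonglongrightarrow> 0"
  proof (rule tendsto_sandwich[OF _ _ tendsto_const upper]; intro always_eventually allI)
    fix n
    have "0 \<le> (1 - q) * gradient_energy (U n - l)"
      using q gradient_energy_nonneg by (intro mult_nonneg_nonneg) auto
    then show "0 \<le> Re (h (U n - l) (U n - l))"
      using h_lower[OF UlQ, of n] P_nonneg[of "U n - l"] zero_le_power2[of "norm (U n - l)"] by linarith
    show "Re (h (U n - l) (U n - l)) \<le> gradient_energy (U n - l) + P (U n - l) + shift * (norm (U n - l))\<^sup>2"
      using a_self(2)[OF UlQ, of n] by (simp add: Re_h_self)
  qed
  with l show "l \<in> Q \<and> (\<lambda>n. Re (h (U n - l) (U n - l))) \<longlonglongrightarrow> 0"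
    by blast
qed

text \<open>Split the mass of \<open>u\<close>: where \<open>V\<^sub>+ > n\<close> it is at most \<open>P(u) / n\<close>; the rest lies in
  finitely many cells of a fine grid or in a set that is thin in every cell.\<close>

lemma energy_finite_below:
  assumes thin: "\<And>n::nat. thin_at_infinity {x. Vp x \<le> of_nat n}"
  shows "\<exists>B c. finite B \<and>
    (\<forall>u\<in>Q. M * (norm u)\<^sup>2 \<le> Re (a u u) + c * (\<Sum>w\<in>B. (cmod (cinner u w))\<^sup>2))"
proof -
  \<comment> \<open>Form smallness costs \<open>C\<close>, so the mass has to be multiplied by \<open>M + C\<close>.\<close>
  define L where "L = max 1 (M + C)"
  have L: "1 \<le> L" "M + C \<le> L"
    by (simp_all add: L_def)
  obtain n :: nat where n: "2 * L \<le> real n"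
    using real_arch_simple by blast
  have n_pos: "0 < real n"
    using n L by linarith
  define \<kappa> where "\<kappa> = 2 * 2 ^ DIM('a) * real DIM('a)"
  have \<kappa>: "0 < \<kappa>"
    by (simp add: \<kappa>_def)
  \<comment> \<open>The mesh size: cells lie in the unit cubes around their points, and \<open>2 L \<kappa> s\<^sup>2 \<le> 1 - q\<close>.\<close>
  define s where "s = min (1/2) ((1 - q) / (2 * L * \<kappa>))"
  have s: "0 < s" "s \<le> 1/2"
    using q L \<kappa> by (auto simp: s_def)
  have s_small: "2 * L * \<kappa> * s\<^sup>2 \<le> 1 - q"
  proof -
    have "2 * L * \<kappa> * s\<^sup>2 \<le> 2 * L * \<kappa> * s"
      using s L \<kappa> by (intro mult_left_mono) (auto simp: power2_eq_square mult_le_cancel_left1)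
    also have "\<dots> \<le> 2 * L * \<kappa> * ((1 - q) / (2 * L * \<kappa>))"
      using L \<kappa> by (intro mult_left_mono) (auto simp: s_def)
    also have "\<dots> = 1 - q"
      using L \<kappa> by simp
    finally show ?thesis .
  qed
  let ?v = "s ^ DIM('a)"
  have v: "0 < ?v"
    using s by simp
  define E0 where "E0 = {x. Vp x \<le> of_nat n}"
  have E0: "E0 \<in> sets lebesgue" "((\<lambda>k. measure lebesgue (E0 \<inter> unit_cube k)) \<longlongrightarrow> 0) at_infinity"
    using thin[of n] by (auto simp: thin_at_infinity_def E0_def)
  have "\<forall>\<^sub>F k in at_infinity. measure lebesgue (E0 \<inter> unit_cube k) < 1/4 * ?v"
    using order_tendstoD(2)[OF E0(2), of "1/4 * ?v"] v by simp
  then obtain R where R: "\<And>k. R \<le> norm k \<Longrightarrow> measure lebesgue (E0 \<inter> unit_cube k) < 1/4 * ?v"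
    unfolding eventually_at_infinity by blast
  define \<S> where "\<S> = cell s ` ball (0 :: 'a) R"
  have \<S>: "finite \<S>" "\<S> \<subseteq> range (cell s)"
    unfolding \<S>_def by (auto intro: finite_cells s)
  have \<S>_sets: "\<Union>\<S> \<in> sets lebesgue"
    using \<S> cell_borel by (intro sets.finite_Union) auto
  \<comment> \<open>The part of \<open>E0\<close> outside the chosen cells, and a Borel set that differs from it by a null set.\<close>
  define E1 where "E1 = E0 - \<Union>\<S>"
  have E1: "E1 \<in> sets lebesgue"
    unfolding E1_def using E0(1) \<S>_sets by blast
  obtain E where E: "E1 \<subseteq> E" "E \<in> sets lborel" "E - E1 \<in> null_sets lebesgue"
    using completion_upper[OF E1] by metis
  have thin_cell: "emeasure lborel (E \<inter> cell s y) \<le> ennreal (1/4 * ?v)" for y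
  proof -
    have cell_y: "cell s y \<in> sets lebesgue"
      using cell_borel by simp
    have "emeasure lborel (E \<inter> cell s y) = emeasure lebesgue (E \<inter> cell s y)"
      using E(2) cell_borel by simp
    also have "\<dots> \<le> emeasure lebesgue ((E1 \<inter> cell s y) \<union> (E - E1))"
      by (intro emeasure_mono sets.Un sets.Int E1 cell_y null_setsD2[OF E(3)]) (use E(1) in blast)
    also have "\<dots> = emeasure lebesgue (E1 \<inter> cell s y)"
      using E1 E(3) cell_y by (intro emeasure_Un_null_set) auto
    also have "\<dots> \<le> ennreal (1/4 * ?v)"
    proof (cases "norm y < R")
      case True
      then have "E1 \<inter> cell s y = {}"
        by (auto simp: E1_def \<S>_def)
      then show ?thesis
        by simp
    next
      case False
      have "cell s y \<subseteq> unit_cube y"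
      proof
        fix x assume x: "x \<in> cell s y"
        show "x \<in> unit_cube y"
          unfolding unit_cube_def mem_box
        proof (rule ballI)
          fix b :: 'a assume b: "b \<in> Basis"
          have "y \<bullet> b - 1/2 \<le> x \<bullet> b" "x \<bullet> b \<le> y \<bullet> b + 1/2"
            using mem_cell_imp_close[OF s(1) x b] s(2) by linarith+
          with b show "(y - (1/2) *\<^sub>R One) \<bullet> b \<le> x \<bullet> b \<and> x \<bullet> b \<le> (y + (1/2) *\<^sub>R One) \<bullet> b"
            by (simp add: inner_add_left inner_diff_left)
        qed
      qed
      then have sub: "E1 \<inter> cell s y \<subseteq> E0 \<inter> unit_cube y"
        by (auto simp: E1_def)
      have meas: "E0 \<inter> unit_cube y \<in> lmeasurable"
        using E0(1) by (intro bounded_set_imp_lmeasurable) (auto simp: unit_cube_def intro: bounded_subset[OF bounded_cbox])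
      have "emeasure lebesgue (E1 \<inter> cell s y) \<le> emeasure lebesgue (E0 \<inter> unit_cube y)"
        by (rule emeasure_mono[OF sub fmeasurableD[OF meas]])
      also have "\<dots> = ennreal (measure lebesgue (E0 \<inter> unit_cube y))"
        by (rule emeasure_eq_measure2[OF meas])
      also have "\<dots> \<le> ennreal (1/4 * ?v)"
        using R[of y] False by (intro ennreal_leI) simp
      finally show ?thesis .
    qed
    finally show ?thesis .
  qed
  define F :: "'a set \<Rightarrow> 'a L2" where "F S = conj_L2 (indicator S)" for S
  define B where "B = F ` \<S>"
  \<comment> \<open>The factor \<open>card \<S>\<close> arises because each term of a sum over \<open>\<S>\<close> is bounded by the whole sum over \<open>B\<close>.\<close>
  define c where "c = L * (8 / ?v) * real (card \<S>)"
  have "M * (norm u)\<^sup>2 \<le> Re (a u u) + c * (\<Sum>w\<in>B. (cmod (cinner u w))\<^sup>2)" if u: "u \<in> Q" for u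
  proof -
    let ?D = "gradient_energy u" and ?I = "\<Sum>S\<in>\<S>. (cmod (cinner u (F S)))\<^sup>2"
    let ?J = "\<Sum>w\<in>B. (cmod (cinner u w))\<^sup>2"
    let ?e = "\<lambda>x. ennreal ((cmod (rep_L2 u x))\<^sup>2)"
    have sets[measurable]: "\<Union>\<S> \<union> E \<in> sets lebesgue"
      using \<S>_sets E(2) by auto
    have "ennreal ((norm u)\<^sup>2) = (\<integral>\<^sup>+x. ?e x \<partial>lebesgue)"
      by (rule nn_integral_L2[symmetric])
    also have "\<dots> \<le> (\<integral>\<^sup>+x. ennreal (1 / real n) * (Vp x * ?e x) + indicator (\<Union>\<S> \<union> E) x * ?e x \<partial>lebesgue)"
    proof (rule nn_integral_mono)
      fix x
      show "?e x \<le> ennreal (1 / real n) * (Vp x * ?e x) + indicator (\<Union>\<S> \<union> E) x * ?e x"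
      proof (cases "x \<in> \<Union>\<S> \<union> E")
        case False
        then have "x \<notin> E0"
          using E(1) by (auto simp: E1_def)
        then have "ennreal (real n) \<le> Vp x"
          by (simp add: E0_def not_le less_imp_le ennreal_of_nat_eq_real_of_nat)
        then have "ennreal (1 / real n) * (ennreal (real n) * ?e x) \<le> ennreal (1 / real n) * (Vp x * ?e x)"
          by (intro mult_left_mono mult_right_mono) auto
        moreover have "ennreal (1 / real n) * (ennreal (real n) * ?e x) = ?e x"
          using n_pos by (simp add: ennreal_mult[symmetric] mult.assoc[symmetric])
        ultimately show ?thesis
          using False by simp
      qed simp
    qed
    also have "\<dots> = ennreal (1 / real n) * potential_energy Vp u
        + (\<integral>\<^sup>+x. indicator (\<Union>\<S> \<union> E) x * ?e x \<partial>lebesgue)"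
      by (simp add: nn_integral_add nn_integral_cmult)
    also have "\<dots> \<le> ennreal (1 / real n) * ennreal (P u)
        + ennreal (\<kappa> * s\<^sup>2 * ?D + 2 * (1/4) * (norm u)\<^sup>2 + 4 / ?v * ?I)"
      unfolding P_eq[OF u] \<kappa>_def F_def
      using E(2) thin_cell
      by (intro add_left_mono L2_mass_cells_thin_set_le Q_W12 u s \<S>) auto
    also have "\<dots> = ennreal (P u / real n + (\<kappa> * s\<^sup>2 * ?D + 2 * (1/4) * (norm u)\<^sup>2 + 4 / ?v * ?I))"
      using \<kappa> v n_pos P_nonneg[of u] gradient_energy_nonneg[of u]
      by (simp add: ennreal_mult[symmetric] ennreal_plus[symmetric] sum_nonneg del: ennreal_plus)
    finally have "(norm u)\<^sup>2 \<le> P u / real n + (\<kappa> * s\<^sup>2 * ?D + 2 * (1/4) * (norm u)\<^sup>2 + 4 / ?v * ?I)"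
      using \<kappa> v n_pos P_nonneg[of u] gradient_energy_nonneg[of u]
      by (subst (asm) ennreal_le_iff) (auto intro!: add_nonneg_nonneg sum_nonneg mult_nonneg_nonneg divide_nonneg_nonneg)
    then have "(norm u)\<^sup>2 \<le> 2 / real n * P u + 2 * \<kappa> * s\<^sup>2 * ?D + 8 / ?v * ?I"
      by (simp add: algebra_simps)
    then have "L * (norm u)\<^sup>2 \<le> L * (2 / real n * P u + 2 * \<kappa> * s\<^sup>2 * ?D + 8 / ?v * ?I)"
      using L by (intro mult_left_mono) auto
    also have "\<dots> = (2 * L / real n) * P u + (2 * L * \<kappa> * s\<^sup>2) * ?D + L * (8 / ?v) * ?I"
      by (simp add: algebra_simps)
    also have "\<dots> \<le> 1 * P u + (1 - q) * ?D + L * (8 / ?v) * (real (card \<S>) * ?J)"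
    proof (intro add_mono mult_right_mono mult_left_mono s_small P_nonneg gradient_energy_nonneg)
      show "2 * L / real n \<le> 1"
        using n n_pos by simp
      show "0 \<le> L * (8 / ?v)"
        using L v by simp
      show "?I \<le> real (card \<S>) * ?J"
      proof (rule sum_bounded_above)
        fix S assume "S \<in> \<S>"
        then show "(cmod (cinner u (F S)))\<^sup>2 \<le> ?J"
          using \<S>(1) by (intro member_le_sum[of "F S" B "\<lambda>w. (cmod (cinner u w))\<^sup>2"]) (auto simp: B_def)
      qed
    qed
    finally have "L * (norm u)\<^sup>2 \<le> P u + (1 - q) * ?D + c * ?J"
      by (simp add: c_def mult.assoc)
    moreover have "(M + C) * (norm u)\<^sup>2 \<le> L * (norm u)\<^sup>2"
      using L by (intro mult_right_mono) auto
    ultimately show ?thesis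
      using a_self(1)[OF u] by (simp add: algebra_simps)
  qed
  moreover have "finite B"
    using \<S>(1) by (simp add: B_def)
  ultimately show ?thesis
    by blast
qed

text \<open>The Riesz representation in the form norm solves \<open>(T + shift) u = f\<close>.\<close>

lemma discrete_operator_schroedinger:
  assumes thin: "\<And>n::nat. thin_at_infinity {x. Vp x \<le> of_nat n}"
  shows "discrete_operator (closure Q) (schroedinger_operator Vp Vm) shift"
proof
  have T: "(u, g) \<in> schroedinger_operator Vp Vm \<longleftrightarrow> u \<in> Q \<and> g \<in> closure Q \<and> (\<forall>v\<in>Q. a u v = cinner g v)" for u g
    by (simp add: schroedinger_operator_def form_operator_def)
  show K: "L2.subspace (closure Q)"
    by (rule L2_subspace_closure[OF a.subspace])
  show "closed (closure Q)"
    by simp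
  show "u \<in> closure Q \<and> g \<in> closure Q" if "(u, g) \<in> schroedinger_operator Vp Vm" for u g
    using that closure_subset unfolding T by blast
  show "(u - v, g - k) \<in> schroedinger_operator Vp Vm"
    if "(u, g) \<in> schroedinger_operator Vp Vm" "(v, k) \<in> schroedinger_operator Vp Vm" for u g v k
    using that L2.subspace_diff[OF K] unfolding T by (simp add: a.mem_diff a.diff_left cinner_minus_left)
  show "(z *\<^sub>C u, z *\<^sub>C g) \<in> schroedinger_operator Vp Vm" if "(u, g) \<in> schroedinger_operator Vp Vm" for u g z
    using that L2.subspace_scale[OF K] unfolding T by (simp add: a.mem_scale a.scale_left cinner_scaleC_left)
  show "cinner g v = cinner u k"
    if "(u, g) \<in> schroedinger_operator Vp Vm" "(v, k) \<in> schroedinger_operator Vp Vm" for u g v k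
    using that a.commute[of u v] cinner_commute[of u k] unfolding T by simp
  show "\<exists>u. (u, f - complex_of_real shift *\<^sub>C u) \<in> schroedinger_operator Vp Vm" if "f \<in> closure Q" for f
  proof -
    obtain u where u: "u \<in> Q" "\<forall>v\<in>Q. h u v = cinner f v"
      using h.Riesz_representation[of f] by (rule bexE)
    have "u \<in> closure Q"
      using u(1) closure_subset by blast
    then have "f - complex_of_real shift *\<^sub>C u \<in> closure Q"
      using that by (intro L2.subspace_diff[OF K] L2.subspace_scale[OF K])
    moreover have "a u v = cinner (f - complex_of_real shift *\<^sub>C u) v" if "v \<in> Q" for v
      using bspec[OF u(2) that] by (simp add: h_def cinner_minus_left cinner_scaleC_left algebra_simps)
    ultimately show ?thesis
      using u(1) unfolding T by blast
  qed
  show "norm u \<le> norm (g + complex_of_real shift *\<^sub>C u)" if "(u, g) \<in> schroedinger_operator Vp Vm" for u g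
  proof -
    have u: "u \<in> Q" "a u u = cinner g u"
      using that unfolding T by auto
    let ?k = "g + complex_of_real shift *\<^sub>C u"
    have "(norm u)\<^sup>2 \<le> Re (cinner ?k u)"
      using h.coercive[OF u(1)] by (simp add: h_def u(2) cinner_add_left cinner_scaleC_left)
    also have "\<dots> \<le> norm ?k * norm u"
      using complex_Re_le_cmod[of "cinner ?k u"] norm_cinner_le[of ?k u] by linarith
    finally have "norm u * norm u \<le> norm ?k * norm u"
      by (simp add: power2_eq_square)
    then show ?thesis
      by (cases "norm u = 0") auto
  qed
  show "\<exists>B c. finite B \<and> (\<forall>(u, g)\<in>schroedinger_operator Vp Vm.
      M * (norm u)\<^sup>2 \<le> Re (cinner g u) + c * (\<Sum>w\<in>B. (cmod (cinner u w))\<^sup>2))" for M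
  proof -
    obtain B c where "finite B"
      and B: "\<And>u. u \<in> Q \<Longrightarrow> M * (norm u)\<^sup>2 \<le> Re (a u u) + c * (\<Sum>w\<in>B. (cmod (cinner u w))\<^sup>2)"
      using energy_finite_below[OF thin, of M] by blast
    have "M * (norm u)\<^sup>2 \<le> Re (cinner g u) + c * (\<Sum>w\<in>B. (cmod (cinner u w))\<^sup>2)"
      if "(u, g) \<in> schroedinger_operator Vp Vm" for u g
      using B[of u] that unfolding T by auto
    with \<open>finite B\<close> show ?thesis
      by blast
  qed
qed

end

section \<open>Absence of essential spectrum\<close>

theorem theorem4p2:
  fixes Vp :: "'a::euclidean_space \<Rightarrow> ennreal" and Vm :: "'a \<Rightarrow> real"
  assumes "Vp \<in> borel_measurable lebesgue"
    and "Vm \<in> borel_measurable lebesgue"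
    and "\<And>x. 0 \<le> Vm x"
    and "form_small Vm"
    and "\<And>n::nat. thin_at_infinity {x. Vp x \<le> of_nat n}"
  shows "essential_spectrum (closure (form_domain Vp)) (schroedinger_operator Vp Vm) = {}"
proof -
  obtain q C where "q < 1" and small: "\<And>u. u \<in> W12 \<Longrightarrow> weight_integrable Vm u"
    "\<And>u. u \<in> W12 \<Longrightarrow> integral\<^sup>L lebesgue (\<lambda>x. Vm x * (cmod (rep_L2 u x))\<^sup>2)
       \<le> q * gradient_energy u + C * (norm u)\<^sup>2"
    using assms(4) unfolding form_small_def weight_integrable_def by blast
  interpret schroedinger_potentials Vp Vm "max q 0" "max C 0"
  proof
    fix u :: "'a L2" assume u: "u \<in> W12"
    have "q * gradient_energy u + C * (norm u)\<^sup>2 \<le> max q 0 * gradient_energy u + max C 0 * (norm u)\<^sup>2"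
      by (intro add_mono mult_right_mono sum_nonneg) auto
    with small(2)[OF u] show "integral\<^sup>L lebesgue (\<lambda>x. Vm x * (cmod (rep_L2 u x))\<^sup>2)
        \<le> max q 0 * gradient_energy u + max C 0 * (norm u)\<^sup>2"
      by linarith
  qed (use assms small(1) \<open>q < 1\<close> in auto)
  interpret discrete_operator "closure (form_domain Vp)" "schroedinger_operator Vp Vm" shift
    by (rule discrete_operator_schroedinger) (rule assms(5))
  show ?thesis
    by (rule essential_spectrum_empty)
qed

end
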